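(* Let $q$ be an odd prime power and $d\ge1$. For each of the types $*\in\{A,BC,D\}$, $$\sum_{F\in \mathcal{WF}( *,q)_d}s^{\alpha(F)}t^{w(F)}=\tilde M_d^*\prod_{j=1}^d\frac{1}{1-st^j},\qquad \tilde M_d^*=\sum_{\sigma\in \mathcal S_d^*}q^{l^*(\sigma)}s^{\beta(\sigma)}t^{\mathrm{Wmaj}(\sigma)}.$$
   Context: Flags: for type A, $\mathcal{WF}(A,q)_d$ is the set of weighted flags of $\mathbb F_q^d$ (sequences $V_1\subset\dots\subset V_k$, $k\ge0$, of subspaces with $0<\dim V_1<\dots<\dim V_k\le d$). For type BC, $\mathcal{WF}(BC,q)_d$ is the set of weighted flags of a symplectic space $(\mathbb F_q^{2d},\omega)$, i.e. strictly increasing sequences of nonzero subspaces on which $\omega$ vanishes. For type D, $\mathcal{WF}(D,q)_d$ is the set of weighted even flags of $\mathcal H_q^d$, the orthogonal sum of $d$ copies of $\mathbb F_q^2$ with quadratic form $(x,y)\mapsto xy$: strictly increasing sequences $V_1\subset\dots\subset V_k$ of nonzero subspaces on which the quadratic form vanishes, with $\dim V_k-\dim(V_k\cap\mathcal I)$ even for a fixed $d$-dimensional totally isotropic subspace $\mathcal I$. A weighted flag carries strictly positive integers $w_1,\dots,w_k$; $w(F)=\sum_iw_i\dim V_i$ and $\alpha(F)=\sum_iw_i$. Groups: $\mathcal S_d^A=\mathcal S_d$ (permutations of $\{1,\dots,d\}$); $\mathcal S_d^{BC}=\mathcal S_d^\pm$, permutations $\sigma$ of $\{\pm1,\dots,\pm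 d\}$ with $\sigma(-i)=-\sigma(i)$; $\mathcal S_d^D\subset\mathcal S_d^\pm$, those with an even number of $i\in\{1,\dots,d\}$ with $\sigma(i)<0$. Let $\mathrm{Inv}(\sigma)=\#\{0<i<j\le d:\sigma(i)\sigma(j)(\sigma(i)-\sigma(j))>0\}$ and $N(\sigma)=\{1\le i\le d:\sigma(i)<0\}$. Then $l^A(\sigma)=\mathrm{Inv}(\sigma)$, $l^{BC}(\sigma)=\mathrm{Inv}(\sigma)+\sum_{i\in N(\sigma)}(d+1+\sigma(i))$, $l^D(\sigma)=\mathrm{Inv}(\sigma)+\sum_{i\in N(\sigma)}(d+\sigma(i))$. $\mathrm{Wmaj}(\sigma)=\sum_{1\le i<d,\ \sigma(i)>\sigma(i+1)}i+|N(\sigma)|$ (usual order). $\beta(\sigma)=[\sigma(d)<0]+\#\{1\le i<d:\sigma(i)\sigma(i+1)(\sigma(i)-\sigma(i+1))>0\}$, where $[\text{true}]=1,[\text{false}]=0$. *)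

theory Defs
  imports "HOL-Analysis.Analysis" "HOL-Computational_Algebra.Formal_Power_Series"
    "HOL-Combinatorics.Permutations"
begin

section \<open>Weighted flags\<close>

text \<open>
  The space $F_q^d$ is \<open>'k ^ 'n\<close> with \<open>CARD('k) = q\<close> and \<open>CARD('n) = d\<close>; the spaces of dimension
  $2d$ are \<open>'k ^ ('n \<times> 2)\<close>. A flag is the list $[V_1, \dots, V_k]$, the empty flag being \<open>[]\<close>.
\<close>

definition flags_A :: "('k::field ^ 'n) set list set" where
  "flags_A = {Vs. (\<forall>V \<in> set Vs. vec.subspace V \<and> 0 < vec.dim V \<and> vec.dim V \<le> CARD('n)) \<and>
                  sorted_wrt (\<lambda>V W. V \<subseteq> W \<and> vec.dim V < vec.dim W) Vs}"

definition symplectic_form :: "('k::field ^ 'm \<Rightarrow> 'k ^ 'm \<Rightarrow> 'k) \<Rightarrow> bool" where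
  "symplectic_form \<omega> \<longleftrightarrow>
     (\<forall>x. Vector_Spaces.linear (*s) (*) (\<lambda>y. \<omega> x y)) \<and>
     (\<forall>y. Vector_Spaces.linear (*s) (*) (\<lambda>x. \<omega> x y)) \<and>
     (\<forall>x. \<omega> x x = 0) \<and>
     (\<forall>x. (\<forall>y. \<omega> x y = 0) \<longrightarrow> x = 0)"

definition flags_BC :: "('k::field ^ 'm \<Rightarrow> 'k ^ 'm \<Rightarrow> 'k) \<Rightarrow> ('k ^ 'm) set list set" where
  "flags_BC \<omega> = {Vs. (\<forall>V \<in> set Vs. vec.subspace V \<and> V \<noteq> {0} \<and> (\<forall>x\<in>V. \<forall>y\<in>V. \<omega> x y = 0)) \<and>
                     sorted_wrt (\<subset>) Vs}"

text \<open>The \<open>i\<close>-th copy of the hyperbolic plane has the coordinates \<open>(i, 1)\<close> and \<open>(i, 2)\<close>.\<close>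

definition hyp_form :: "'k::field ^ ('n::finite \<times> 2) \<Rightarrow> 'k" where
  "hyp_form v = (\<Sum>i\<in>UNIV. v $ (i, 1) * v $ (i, 2))"

definition totally_isotropic :: "('k::field ^ ('n::finite \<times> 2)) set \<Rightarrow> bool" where
  "totally_isotropic V \<longleftrightarrow> vec.subspace V \<and> (\<forall>x\<in>V. hyp_form x = 0)"

definition even_flags_D :: "('k::field ^ ('n::finite \<times> 2)) set \<Rightarrow> ('k ^ ('n \<times> 2)) set list set" where
  "even_flags_D I = {Vs. (\<forall>V \<in> set Vs. totally_isotropic V \<and> V \<noteq> {0}) \<and>
                         sorted_wrt (\<subset>) Vs \<and>
                         (Vs \<noteq> [] \<longrightarrow> even (vec.dim (last Vs) - vec.dim (last Vs \<inter> I)))}"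

definition weighted :: "'v set list set \<Rightarrow> ('v set list \<times> nat list) set" where
  "weighted Fs = {(Vs, ws). Vs \<in> Fs \<and> length ws = length Vs \<and> (\<forall>w \<in> set ws. 0 < w)}"

definition flag_weight :: "('k::field ^ 'm) set list \<times> nat list \<Rightarrow> nat" where
  "flag_weight F = (\<Sum>i<length (fst F). snd F ! i * vec.dim (fst F ! i))"

definition flag_alpha :: "'v set list \<times> nat list \<Rightarrow> nat" where
  "flag_alpha F = (\<Sum>i<length (fst F). snd F ! i)"


section \<open>Groups of signed permutations and their statistics\<close>

datatype weyl_type = Type_A | Type_BC | Type_D

text \<open>Permutations are extended to all integers by the identity.\<close>

definition neg_set :: "nat \<Rightarrow> (int \<Rightarrow> int) \<Rightarrow> int set" where
  "neg_set d \<sigma> = {i. 1 \<le> i \<and> i \<le> int d \<and> \<sigma> i < 0}"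

definition signed_perms :: "nat \<Rightarrow> (int \<Rightarrow> int) set" where
  "signed_perms d = {\<sigma>. \<sigma> permutes ({- int d..int d} - {0}) \<and>
                        (\<forall>i \<in> {- int d..int d} - {0}. \<sigma> (- i) = - \<sigma> i)}"

fun weyl_group :: "weyl_type \<Rightarrow> nat \<Rightarrow> (int \<Rightarrow> int) set" where
  "weyl_group Type_A d = {\<sigma>. \<sigma> permutes {1..int d}}"
| "weyl_group Type_BC d = signed_perms d"
| "weyl_group Type_D d = {\<sigma> \<in> signed_perms d. even (card (neg_set d \<sigma>))}"

definition inversions :: "nat \<Rightarrow> (int \<Rightarrow> int) \<Rightarrow> nat" where
  "inversions d \<sigma> =
     card {(i, j). 0 < i \<and> i < j \<and> j \<le> int d \<and> \<sigma> i * \<sigma> j * (\<sigma> i - \<sigma> j) > 0}"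

text \<open>The arguments of \<open>nat\<close> below are nonnegative, since \<open>\<sigma> i \<ge> - int d\<close>.\<close>

fun weyl_length :: "weyl_type \<Rightarrow> nat \<Rightarrow> (int \<Rightarrow> int) \<Rightarrow> nat" where
  "weyl_length Type_A d \<sigma> = inversions d \<sigma>"
| "weyl_length Type_BC d \<sigma> = inversions d \<sigma> + (\<Sum>i\<in>neg_set d \<sigma>. nat (int d + 1 + \<sigma> i))"
| "weyl_length Type_D d \<sigma> = inversions d \<sigma> + (\<Sum>i\<in>neg_set d \<sigma>. nat (int d + \<sigma> i))"

definition wmaj :: "nat \<Rightarrow> (int \<Rightarrow> int) \<Rightarrow> nat" where
  "wmaj d \<sigma> = (\<Sum>i | 1 \<le> i \<and> i < int d \<and> \<sigma> i > \<sigma> (i + 1). nat i) + card (neg_set d \<sigma>)"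

definition beta_stat :: "nat \<Rightarrow> (int \<Rightarrow> int) \<Rightarrow> nat" where
  "beta_stat d \<sigma> = of_bool (\<sigma> (int d) < 0) +
     card {i. 1 \<le> i \<and> i < int d \<and> \<sigma> i * \<sigma> (i + 1) * (\<sigma> i - \<sigma> (i + 1)) > 0}"


section \<open>Generating series\<close>

text \<open>
  Identities are stated in the ring of formal power series $Q[[t]][[s]]$, whose library topology is the
  \<open>s\<close>-adic one: convergence means that every coefficient of a power of \<open>s\<close> is eventually constant.
\<close>

definition var_s :: "rat fps fps" where
  "var_s = fps_X"

definition var_t :: "rat fps fps" where
  "var_t = fps_const fps_X"

definition M_tilde :: "weyl_type \<Rightarrow> nat \<Rightarrow> nat \<Rightarrow> rat fps fps" where
  "M_tilde \<tau> q d =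
     (\<Sum>\<sigma>\<in>weyl_group \<tau> d. of_nat q ^ weyl_length \<tau> d \<sigma> * var_s ^ beta_stat d \<sigma> * var_t ^ wmaj d \<sigma>)"

end

theory Submission
  imports Defs "HOL-Combinatorics.Multiset_Permutations"
begin

text \<open>
  Put $x_j = s t^j$ and $y_j = x_j / (1 - x_j)$. Summing over the weights turns the left-hand side into
  the sum over $S \subseteq \{1, \dots, d\}$ of $f(S) \prod_{j \in S} y_j$, where $f(S)$ is the number of
  flags with set of dimensions $S$. For $\sigma$ let $D(\sigma)$ be its set of descents in the order
  $1 < \dots < d < -d < \dots < -1$, together with $d$ if $\sigma(d) < 0$. Then
  $\beta(\sigma) = |D(\sigma)|$, and $\mathrm{Wmaj}(\sigma)$ is the sum of $D(\sigma)$. Since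
  $1 / (1 - x_j) = 1 + y_j$, the right-hand side is the sum over $S$ of $\prod_{j \in S} y_j$ times the
  sum of $q^{l(\sigma)}$ over all $\sigma$ with $D(\sigma) \subseteq S$; this last sum has to be $f(S)$.
  With $m = \max S$, both numbers factor as a $q$-multinomial coefficient for $S \setminus \{m\}$ times a
  factor depending on $m$ only: the number of admissible top spaces of dimension $m$, respectively the
  weighted number of sets $\{\sigma(1), \dots, \sigma(m)\}$. The latter are sorted by their number $k$ of
  negative letters, the former by $k = \dim V - \dim (V \cap I)$ for a maximal isotropic $I$, and the
  contributions agree for every $k$. Types A, BC and D correspond to $k = 0$, all $k$ and even $k$.
\<close>

subsection \<open>Gaussian binomial coefficients\<close>

text \<open>Below the top space of a flag, likewise, every chain of subspaces is admissible, since
  isotropy passes to subspaces. The obstacle to counting top spaces is the quadratic condition.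
  Fixing I removes it: for x in I one has Q(v + x) = Q(v) + b(v, x), so inside a coset of I the
  condition is affine in x. A space V is therefore counted through bases that start with a basis of
  the intersection with I and continue outside I. In type D the affine condition costs one dimension
  at each of the k outer vectors; in type BC it is absent. This is the difference of k between the
  two lengths, whose summands are d + \<sigma>(i) and d + 1 + \<sigma>(i); the parameter
  \<open>e\<close> carries it on both sides. There are infinitely many weighted flags, but finitely
  many for each value of \<alpha>, so the sum converges in the s-adic topology.\<close>

fun qbinom :: "nat \<Rightarrow> nat \<Rightarrow> nat \<Rightarrow> nat" where
  "qbinom q n 0 = 1"
| "qbinom q 0 (Suc k) = 0"
| "qbinom q (Suc n) (Suc k) = qbinom q n (Suc k) + q ^ (n - k) * qbinom q n k"

lemma qbinom_eq_0: "n < k \<Longrightarrow> qbinom q n k = 0"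
  by (induction q n k rule: qbinom.induct) auto

text \<open>The number of ordered independent \<open>k\<close>-tuples in an
  \<open>n\<close>-dimensional space over the field with \<open>q\<close> elements. Values are
  integers so that differences of powers can be treated by ring arithmetic.\<close>

definition qfall :: "nat \<Rightarrow> nat \<Rightarrow> nat \<Rightarrow> int" where
  "qfall q n k = (\<Prod>i<k. int q ^ n - int q ^ i)"

lemma qfall_0 [simp]: "qfall q n 0 = 1"
  by (simp add: qfall_def)

lemma qfall_Suc: "qfall q n (Suc k) = qfall q n k * (int q ^ n - int q ^ k)"
  by (simp add: qfall_def)

lemma qfall_Suc_Suc: "qfall q (Suc n) (Suc k) = (int q ^ Suc n - 1) * int q ^ k * qfall q n k"
proof -
  have "qfall q (Suc n) (Suc k) = (int q ^ Suc n - 1) * (\<Prod>i<k. int q ^ Suc n - int q ^ Suc i)"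
    unfolding qfall_def by (subst prod.lessThan_Suc_shift) simp
  also have "(\<Prod>i<k. int q ^ Suc n - int q ^ Suc i) = (\<Prod>i<k. int q * (int q ^ n - int q ^ i))"
    by (simp add: algebra_simps)
  also have "\<dots> = int q ^ k * qfall q n k"
    by (simp add: qfall_def prod.distrib)
  finally show ?thesis by simp
qed

lemma qfall_eq_0: "n < k \<Longrightarrow> qfall q n k = 0"
  unfolding qfall_def by (rule prod_zero) (auto intro!: bexI[of _ n])

lemma qfall_pos: "2 \<le> q \<Longrightarrow> k \<le> n \<Longrightarrow> 0 < qfall q n k"
  unfolding qfall_def by (intro prod_pos) (auto intro!: power_strict_increasing)

text \<open>The product formula for the Gaussian binomial without division. For \<open>k > n\<close>
  both sides vanish, so no range restriction arises.\<close>

lemma qbinom_qfall: "int (qbinom q n k) * qfall q k k = qfall q n k"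
proof (induction q n k rule: qbinom.induct)
  case (2 q k)
  then show ?case by (simp add: qfall_eq_0)
next
  case (3 q n k)
  show ?case
  proof (cases "k \<le> n")
    case True
    have "int (qbinom q (Suc n) (Suc k)) * qfall q (Suc k) (Suc k) =
      int (qbinom q n (Suc k)) * qfall q (Suc k) (Suc k) +
      int q ^ (n - k) * int (qbinom q n k) * qfall q (Suc k) (Suc k)"
      by (simp add: algebra_simps)
    also have "int (qbinom q n (Suc k)) * qfall q (Suc k) (Suc k) = qfall q n k * (int q ^ n - int q ^ k)"
      using 3 by (simp add: qfall_Suc)
    also have "int q ^ (n - k) * int (qbinom q n k) * qfall q (Suc k) (Suc k) =
       (int q ^ (n - k) * int q ^ k) * (int q ^ Suc k - 1) * (int (qbinom q n k) * qfall q k k)"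
      by (simp only: qfall_Suc_Suc mult_ac)
    also have "\<dots> = int q ^ n * (int q ^ Suc k - 1) * qfall q n k"
      using 3 True by (simp add: power_add[symmetric])
    finally show ?thesis
      by (simp add: qfall_Suc_Suc algebra_simps power_add)
  next
    case False
    then show ?thesis by (simp add: qbinom_eq_0 qfall_eq_0)
  qed
qed simp

lemma qfall_add: "a \<le> n \<Longrightarrow> qfall q n (a + b) = qfall q n a * int q ^ (a * b) * qfall q (n - a) b"
proof (induction a arbitrary: n)
  case (Suc a)
  then obtain n' where n: "n = Suc n'" "a \<le> n'" by (cases n) auto
  show ?case
    using Suc.IH[OF n(2)] by (simp add: n qfall_Suc_Suc power_add algebra_simps)
qed simp

text \<open>The right side depends only on \<open>a + b\<close>, so the order of the two choices can
  be exchanged. Bases are counted from the intersection with I outwards, while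
  \<open>iso_count\<close> chooses the \<open>k\<close> negative letters first.\<close>

lemma qbinom_mult:
  assumes "2 \<le> q" "a + b \<le> n"
  shows "int (qbinom q n a * qbinom q (n - a) b) * qfall q a a * qfall q b b * int q ^ (a * b)
    = qfall q n (a + b)"
proof -
  have "int (qbinom q n a * qbinom q (n - a) b) * qfall q a a * qfall q b b * int q ^ (a * b)
    = (int (qbinom q n a) * qfall q a a) * int q ^ (a * b) * (int (qbinom q (n - a) b) * qfall q b b)"
    by (simp add: algebra_simps)
  also have "\<dots> = qfall q n (a + b)"
    using assms by (simp add: qbinom_qfall qfall_add)
  finally show ?thesis .
qed

text \<open>The q-multinomial coefficient, which over a field with \<open>q\<close> elements counts
  chains of subspaces of an \<open>n\<close>-dimensional space with set of dimensions
  \<open>S\<close>. It is built from the maximum downwards, the way both words and flags are taken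
  apart. The value 1 for infinite \<open>S\<close> is a default.\<close>

function qmult :: "nat \<Rightarrow> nat \<Rightarrow> nat set \<Rightarrow> nat" where
  "qmult q n S = (if finite S \<and> S \<noteq> {} then qbinom q n (Max S) * qmult q (Max S) (S - {Max S}) else 1)"
  by auto
termination
  by (relation "Wellfounded.measure (\<lambda>(q, n, S). card S)") (auto simp: card_gt_0_iff)

declare qmult.simps [simp del]

lemma qmult_empty [simp]: "qmult q n {} = 1"
  by (simp add: qmult.simps)

lemma qmult_insert:
  assumes "finite S" "\<forall>x\<in>S. x < s"
  shows "qmult q n (insert s S) = qbinom q n s * qmult q s S"
proof -
  have "Max (insert s S) = s" using assms by (intro Max_eqI) auto
  moreover have "insert s S - {s} = S" using assms by auto
  ultimately show ?thesis using assms by (subst qmult.simps) simp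
qed

subsection \<open>Words and inversions\<close>

fun inv_list :: "'a::linorder list \<Rightarrow> nat" where
  "inv_list [] = 0"
| "inv_list (x # xs) = length (filter (\<lambda>y. y < x) xs) + inv_list xs"

definition des_list :: "'a::linorder list \<Rightarrow> nat set" where
  "des_list w = {i. 0 < i \<and> i < length w \<and> w ! (i - 1) > w ! i}"

definition cross_inv :: "'a::linorder set \<Rightarrow> 'a set \<Rightarrow> nat" where
  "cross_inv B C = card {(x, y) \<in> B \<times> C. y < x}"

lemma cross_inv_alt: "finite B \<Longrightarrow> finite C \<Longrightarrow> cross_inv B C = (\<Sum>x\<in>B. card {y\<in>C. y < x})"
proof -
  assume *: "finite B" "finite C"
  have "{(x, y) \<in> B \<times> C. y < x} = (SIGMA x:B. {y\<in>C. y < x})" by auto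
  then show ?thesis using * by (simp add: cross_inv_def)
qed

lemma inv_list_append:
  "inv_list (xs @ ys) = inv_list xs + inv_list ys + (\<Sum>x\<leftarrow>xs. length (filter (\<lambda>y. y < x) ys))"
  by (induction xs) auto

lemma inv_list_append_distinct:
  assumes "distinct xs" "distinct ys"
  shows "inv_list (xs @ ys) = inv_list xs + inv_list ys + cross_inv (set xs) (set ys)"
proof -
  have "length (filter (\<lambda>y. y < x) ys) = card {y\<in>set ys. y < x}" for x
    using assms(2) by (metis distinct_card distinct_filter set_filter)
  then show ?thesis
    using assms by (simp add: inv_list_append cross_inv_alt sum_list_distinct_conv_sum_set)
qed

lemma inv_list_sorted: "sorted w \<Longrightarrow> inv_list w = 0"
  by (induction w) (auto simp: filter_empty_conv)

lemma inv_list_conv_card: "inv_list w = card {(i, j). i < j \<and> j < length w \<and> w ! j < w ! i}"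
proof (induction w)
  case (Cons x xs)
  let ?P = "{(i, j). i < j \<and> j < length xs \<and> xs ! j < xs ! i}"
  let ?Q = "{j. j < length xs \<and> xs ! j < x}"
  have eq: "{(i, j). i < j \<and> j < length (x # xs) \<and> (x # xs) ! j < (x # xs) ! i} =
     map_prod Suc Suc ` ?P \<union> (\<lambda>j. (0, Suc j)) ` ?Q" (is "?L = ?R")
  proof (intro equalityI subsetI)
    fix z assume "z \<in> ?L"
    then obtain i j where z: "z = (i, j)" "i < j" "j < length (x # xs)" "(x # xs) ! j < (x # xs) ! i"
      by auto
    then obtain j' where j: "j = Suc j'" by (cases j) auto
    show "z \<in> ?R"
      using z j by (cases i) (auto simp: image_iff)
  qed auto
  have fin: "finite ?P"
    by (rule finite_subset[of _ "{..<length xs} \<times> {..<length xs}"]) auto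
  have "card (map_prod Suc Suc ` ?P \<union> (\<lambda>j. (0, Suc j)) ` ?Q) = card ?P + card ?Q"
    using fin by (subst card_Un_disjoint) (auto simp: card_image inj_on_def)
  then show ?case
    unfolding eq using Cons by (simp add: length_filter_conv_card)
qed simp

lemma des_list_empty_iff: "des_list w = {} \<longleftrightarrow> sorted w"
proof
  assume *: "des_list w = {}"
  show "sorted w"
    unfolding sorted_iff_nth_Suc
  proof (intro allI impI)
    fix i assume "Suc i < length w"
    moreover have "Suc i \<notin> des_list w" using * by simp
    ultimately show "w ! i \<le> w ! Suc i" by (auto simp: des_list_def)
  qed
next
  assume *: "sorted w"
  have "w ! (i - 1) \<le> w ! i" if "i < length w" for i
    using * that by (intro sorted_nth_mono) auto
  then show "des_list w = {}" by (fastforce simp: des_list_def)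
qed

text \<open>Position \<open>length xs\<close> is always allowed, so nothing is required at the
  junction; a descent inside \<open>ys\<close> would sit beyond \<open>length xs\<close>, where the
  allowed set has no element.\<close>

lemma des_list_append_subset_iff:
  assumes "S \<subseteq> {..<length xs}"
  shows "des_list (xs @ ys) \<subseteq> insert (length xs) S \<longleftrightarrow> des_list xs \<subseteq> S \<and> sorted ys"
    (is "?L \<longleftrightarrow> ?R")
proof
  assume L: ?L
  show ?R
  proof
    show "des_list xs \<subseteq> S"
    proof
      fix i assume i: "i \<in> des_list xs"
      then have "i \<in> des_list (xs @ ys)" by (auto simp: des_list_def nth_append)
      with L i show "i \<in> S" by (auto simp: des_list_def)
    qed
    show "sorted ys"
      unfolding des_list_empty_iff[symmetric]
    proof (rule ccontr)
      assume "des_list ys \<noteq> {}"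
      then obtain i where i: "i \<in> des_list ys" by auto
      then have "length xs + i \<in> des_list (xs @ ys)"
        by (auto simp: des_list_def nth_append)
      with L have "length xs + i \<in> insert (length xs) S" by (rule subsetD)
      with i assms show False by (auto simp: des_list_def)
    qed
  qed
next
  assume R: ?R
  show ?L
  proof
    fix i assume i: "i \<in> des_list (xs @ ys)"
    consider "i < length xs" | "i = length xs" | "i > length xs" by linarith
    then show "i \<in> insert (length xs) S"
    proof cases
      case 1
      then have "i \<in> des_list xs"
        using i by (auto simp: des_list_def nth_append split: if_splits)
      with R show ?thesis by auto
    next
      case 3
      then have "i - length xs \<in> des_list ys"
        using i by (auto simp: des_list_def nth_append split: if_splits)
      then show ?thesis using R des_list_empty_iff by blast
    qed simp
  qed
qed

section \<open>Words with descents in a given set\<close>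

definition des_words :: "'a::linorder set \<Rightarrow> nat set \<Rightarrow> 'a list set" where
  "des_words T S = {w \<in> permutations_of_set T. des_list w \<subseteq> S}"

lemma finite_des_words [simp]: "finite (des_words T S)"
  by (simp add: des_words_def)

lemma sum_split_words:
  fixes F :: "'a::linorder set set" and C :: "'a set \<Rightarrow> 'a set"
  assumes W: "W = (\<lambda>(B, u). u @ sorted_list_of_set (C B)) ` (SIGMA B:F. des_words B S)"
    and F: "finite F" "\<And>B. B \<in> F \<Longrightarrow> finite B \<and> card B = s"
    and C: "\<And>B. B \<in> F \<Longrightarrow> finite (C B)"
    and h: "\<And>B. B \<in> F \<Longrightarrow> (\<Sum>u\<in>des_words B S. q ^ inv_list u) = (M::nat)"
    and g: "\<And>B u. B \<in> F \<Longrightarrow> set u = B \<Longrightarrow> g (u @ sorted_list_of_set (C B)) = G B"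
  shows "(\<Sum>w\<in>W. q ^ (inv_list w + g w)) = (\<Sum>B\<in>F. q ^ (cross_inv B (C B) + G B)) * M"
proof -
  let ?f = "\<lambda>(B, u). u @ sorted_list_of_set (C B)"
  have inj: "inj_on ?f (SIGMA B:F. des_words B S)"
  proof (rule inj_onI)
    fix x y assume x: "x \<in> (SIGMA B:F. des_words B S)" and y: "y \<in> (SIGMA B:F. des_words B S)"
      and xy: "?f x = ?f y"
    obtain B u B' u' where eq: "x = (B, u)" "y = (B', u')" by (cases x, cases y)
    have set: "set u = B" "set u' = B'" "distinct u" "distinct u'"
      using x y unfolding eq by (auto simp: des_words_def permutations_of_set_def)
    then have "length u = s" "length u' = s" 
      using x y F unfolding eq by (auto simp: distinct_card[symmetric])
    then have "u = u'" using xy unfolding eq by simp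
    then show "x = y" using set by (simp add: eq)
  qed
  have "(\<Sum>w\<in>W. q ^ (inv_list w + g w)) =
     (\<Sum>(B, u)\<in>(SIGMA B:F. des_words B S). q ^ (inv_list u) * q ^ (cross_inv B (C B) + G B))"
    unfolding W
  proof (subst sum.reindex[OF inj], rule sum.cong[OF refl])
    fix x assume x: "x \<in> (SIGMA B:F. des_words B S)"
    obtain B u where eq: "x = (B, u)" by (cases x)
    have B: "B \<in> F" "set u = B" "distinct u"
      using x unfolding eq by (auto simp: des_words_def permutations_of_set_def)
    have "inv_list (u @ sorted_list_of_set (C B)) = inv_list u + cross_inv B (C B)"
      using B C by (simp add: inv_list_append_distinct inv_list_sorted)
    then show "((\<lambda>w. q ^ (inv_list w + g w)) \<circ> ?f) x =
      (case x of (B, u) \<Rightarrow> q ^ (inv_list u) * q ^ (cross_inv B (C B) + G B))"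
      using B g by (simp add: eq power_add)
  qed
  also have "\<dots> = (\<Sum>B\<in>F. \<Sum>u\<in>des_words B S. q ^ (inv_list u) * q ^ (cross_inv B (C B) + G B))"
    using F by (subst sum.Sigma) auto
  also have "\<dots> = (\<Sum>B\<in>F. q ^ (cross_inv B (C B) + G B) * M)"
    by (intro sum.cong) (simp_all add: sum_distrib_right[symmetric] h)
  finally show ?thesis by (simp add: sum_distrib_right)
qed

lemma sum_subsets_insert:
  fixes f :: "'a set \<Rightarrow> nat"
  assumes "finite T" "t \<notin> T"
  shows "(\<Sum>B | B \<subseteq> insert t T \<and> card B = Suc k. f B) =
    (\<Sum>B | B \<subseteq> T \<and> card B = Suc k. f B) + (\<Sum>B | B \<subseteq> T \<and> card B = k. f (insert t B))"
proof -
  let ?X = "{B. B \<subseteq> T \<and> card B = Suc k}" and ?Y = "{B. B \<subseteq> T \<and> card B = k}"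
  have eq: "{B. B \<subseteq> insert t T \<and> card B = Suc k} = ?X \<union> insert t ` ?Y"
  proof (intro equalityI subsetI)
    fix B assume B: "B \<in> {B. B \<subseteq> insert t T \<and> card B = Suc k}"
    show "B \<in> ?X \<union> insert t ` ?Y"
    proof (cases "t \<in> B")
      case True
      then have "B = insert t (B - {t})" by auto
      moreover have "B - {t} \<in> ?Y" using B True by auto
      ultimately show ?thesis by blast
    qed (use B in auto)
  next
    fix B assume "B \<in> ?X \<union> insert t ` ?Y"
    moreover have "card (insert t Y) = Suc (card Y)" if "Y \<subseteq> T" for Y
      using that assms by (meson card_insert_disjoint finite_subset subsetD)
    ultimately show "B \<in> {B. B \<subseteq> insert t T \<and> card B = Suc k}"
      by auto
  qed
  have inj: "inj_on (insert t) ?Y"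
    using assms by (intro inj_onI) (auto simp: set_eq_iff)
  show ?thesis
    unfolding eq using assms inj
    by (subst sum.union_disjoint) (auto simp: sum.reindex)
qed

text \<open>A new maximum outside \<open>B\<close> creates no cross inversion, while inside
  \<open>B\<close> it lies above each of the \<open>card T - k\<close> letters outside. This is
  exactly the recursion of \<open>qbinom\<close>, which explains the choice of that form of the
  Pascal rule.\<close>

lemma sum_cross_inv:
  fixes T :: "'a::linorder set"
  assumes "finite T"
  shows "(\<Sum>B | B \<subseteq> T \<and> card B = s. q ^ cross_inv B (T - B)) = qbinom q (card T) s"
  using assms
proof (induction T arbitrary: s rule: finite_linorder_max_induct)
  case empty
  show ?case
  proof (cases s)
    case 0
    have "{B. B \<subseteq> {} \<and> card B = 0} = {{} :: 'a set}" by auto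
    then show ?thesis unfolding 0 by (simp only:) (simp add: cross_inv_def)
  next
    case (Suc k)
    have "{B. B \<subseteq> {} \<and> card B = Suc k} = ({} :: 'a set set)" by auto
    then show ?thesis unfolding Suc by (simp only:) simp
  qed
next
  case (insert t T)
  have t: "t \<notin> T" using insert by auto
  show ?case
  proof (cases s)
    case 0
    have "{B. B \<subseteq> insert t T \<and> card B = 0} = {{}}"
      using insert(1) by (auto dest: finite_subset)
    then show ?thesis by (simp add: 0 cross_inv_def)
  next
    case (Suc k)
    have 1: "cross_inv B (insert t T - B) = cross_inv B (T - B)" if "B \<subseteq> T" for B
    proof -
      have "{(x, y) \<in> B \<times> (insert t T - B). y < x} = {(x, y) \<in> B \<times> (T - B). y < x}"
        using that insert(2) by (auto 4 4 dest: subsetD)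
      then show ?thesis by (simp add: cross_inv_def)
    qed
    have 2: "cross_inv (insert t B) (insert t T - insert t B) = (card T - card B) + cross_inv B (T - B)"
      if B: "B \<subseteq> T" for B
    proof -
      have fB: "finite B" using B insert finite_subset by blast
      have "insert t T - insert t B = T - B" using t by auto
      moreover have "{y \<in> T - B. y < t} = T - B" using insert by auto
      moreover have "t \<notin> B" using B t by auto
      ultimately show ?thesis
        using B t fB insert(1) by (subst (1 2) cross_inv_alt) (simp_all add: card_Diff_subset)
    qed
    have "(\<Sum>B | B \<subseteq> insert t T \<and> card B = s. q ^ cross_inv B (insert t T - B)) =
      (\<Sum>B | B \<subseteq> T \<and> card B = Suc k. q ^ cross_inv B (T - B)) +
      (\<Sum>B | B \<subseteq> T \<and> card B = k. q ^ (card T - k) * q ^ cross_inv B (T - B))"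
    proof -
      have "(\<Sum>B | B \<subseteq> T \<and> card B = Suc k. q ^ cross_inv B (insert t T - B)) =
        (\<Sum>B | B \<subseteq> T \<and> card B = Suc k. q ^ cross_inv B (T - B))"
        by (intro sum.cong) (simp_all add: 1)
      moreover have "(\<Sum>B | B \<subseteq> T \<and> card B = k. q ^ cross_inv (insert t B) (insert t T - insert t B)) =
        (\<Sum>B | B \<subseteq> T \<and> card B = k. q ^ (card T - k) * q ^ cross_inv B (T - B))"
        by (intro sum.cong refl) (simp only: 2 power_add mem_Collect_eq)
      ultimately show ?thesis
        unfolding Suc sum_subsets_insert[OF insert(1) t] by (simp only:)
    qed
    also have "\<dots> = qbinom q (card T) (Suc k) + q ^ (card T - k) * qbinom q (card T) k"
      by (simp add: insert.IH sum_distrib_left[symmetric])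
    finally show ?thesis using insert(1) t by (simp add: Suc)
  qed
qed

text \<open>The coefficient of \<open>z ^ k\<close> in the product of the factors
  \<open>1 + z * q ^ i\<close> for \<open>i < d\<close>, as in the q-binomial theorem. It accounts
  for the choice of the negative letters.\<close>

lemma sum_power_subsets:
  "(\<Sum>N | N \<subseteq> {..<d} \<and> card N = k. q ^ \<Sum>N) = q ^ (k * (k - 1) div 2) * qbinom q d k"
proof (induction d arbitrary: k)
  case 0
  show ?case
  proof (cases k)
    case 0
    have "{N. N \<subseteq> {..<0} \<and> card N = 0} = {{} :: nat set}" by auto
    then show ?thesis unfolding 0 by (simp only:) simp
  next
    case (Suc j)
    have "{N. N \<subseteq> {..<0} \<and> card N = Suc j} = ({} :: nat set set)" by auto
    then show ?thesis unfolding Suc by (simp only:) simp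
  qed
next
  case (Suc d)
  show ?case
  proof (cases k)
    case 0
    have "{N. N \<subseteq> {..<Suc d} \<and> card N = 0} = {{}}"
      by (auto dest: finite_subset)
    then show ?thesis by (simp add: 0)
  next
    case (Suc j)
    have "\<Sum>(insert d N) = d + \<Sum>N" if "N \<subseteq> {..<d}" for N
      using that by (subst sum.insert) (auto dest: finite_subset)
    then have "(\<Sum>N | N \<subseteq> {..<Suc d} \<and> card N = k. q ^ \<Sum>N) =
      (\<Sum>N | N \<subseteq> {..<d} \<and> card N = Suc j. q ^ \<Sum>N) + (\<Sum>N | N \<subseteq> {..<d} \<and> card N = j. q ^ d * q ^ \<Sum>N)"
      unfolding Suc lessThan_Suc
      by (subst sum_subsets_insert) (auto intro!: sum.cong simp: power_add)
    also have "\<dots> = q ^ (Suc j * j div 2) * qbinom q d (Suc j) + q ^ (d + j * (j - 1) div 2) * qbinom q d j"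
      by (simp add: Suc.IH sum_distrib_left[symmetric] power_add)
    \<comment> \<open>The exponent \<open>d\<close> of the adjoined element splits as
      \<open>j + (d - j)\<close>: the part \<open>j\<close> completes the next triangular number,
      and \<open>d - j\<close> is the exponent in the recursion.\<close>
    also have "q ^ (d + j * (j - 1) div 2) * qbinom q d j = q ^ (Suc j * j div 2) * q ^ (d - j) * qbinom q d j"
    proof (cases "j \<le> d")
      case True
      have "Suc j * j = j * (j - 1) + 2 * j" by (cases j) auto
      then have "Suc j * j div 2 = j * (j - 1) div 2 + j" by simp
      then show ?thesis using True by (simp add: power_add[symmetric] add.commute)
    qed (simp add: qbinom_eq_0)
    finally show ?thesis by (simp add: Suc algebra_simps)
  qed
qed

text \<open>No descent is allowed beyond position \<open>s\<close>, so the tail is increasing and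
  determined by the set of the first \<open>s\<close> letters.\<close>

lemma des_words_insert:
  fixes T :: "'a::linorder set"
  assumes "finite T" "S \<subseteq> {..<s}" "s \<le> card T"
  shows "des_words T (insert s S) = (\<lambda>(B, u). u @ sorted_list_of_set (T - B)) `
    (SIGMA B:{B. B \<subseteq> T \<and> card B = s}. des_words B S)" (is "_ = ?R")
proof (intro equalityI subsetI)
  fix w assume "w \<in> des_words T (insert s S)"
  then have w: "distinct w" "set w = T" "des_list w \<subseteq> insert s S"
    by (auto simp: des_words_def permutations_of_set_def)
  then have "length w = card T" using distinct_card by force
  define u v where "u = take s w" and "v = drop s w"
  have uv: "w = u @ v" "length u = s"
    using \<open>length w = card T\<close> assms by (auto simp: u_def v_def)
  have "des_list u \<subseteq> S \<and> sorted v"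
    using w assms(2) des_list_append_subset_iff[of S u v] by (auto simp: uv)
  moreover have "set v = T - set u" "distinct v" "distinct u" "set u \<subseteq> T" using w uv by auto
  moreover have "v = sorted_list_of_set (set v)"
    using calculation by (metis sorted_list_of_set.idem_if_sorted_distinct)
  moreover have "card (set u) = s" using calculation uv by (simp add: distinct_card)
  ultimately show "w \<in> ?R"
    unfolding uv(1) by (auto simp: image_iff des_words_def permutations_of_set_def intro!: exI[of _ "set u"] exI[of _ u])
next
  fix w assume "w \<in> ?R"
  then obtain B u where B: "B \<subseteq> T" "card B = s" "set u = B" "distinct u" "des_list u \<subseteq> S"
     "w = u @ sorted_list_of_set (T - B)"
    by (auto simp: des_words_def permutations_of_set_def)
  have "length u = s" using B by (metis distinct_card)
  then have "des_list w \<subseteq> insert s S"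
    using B assms des_list_append_subset_iff[of S u] by auto
  then show "w \<in> des_words T (insert s S)"
    using B assms(1) by (auto simp: des_words_def permutations_of_set_def)
qed

text \<open>Removing the largest allowed descent splits off one Gaussian binomial and leaves words
  on \<open>s\<close> letters. The induction runs over arbitrary alphabets \<open>T\<close>, because
  the prefix may use any set of \<open>s\<close> letters and only their number matters.\<close>

lemma sum_des_words:
  fixes T :: "'a::linorder set"
  assumes "finite T" "finite S" "S \<subseteq> {..card T}"
  shows "(\<Sum>w\<in>des_words T S. q ^ inv_list w) = qmult q (card T) S"
  using assms(2,1,3)
proof (induction S arbitrary: T rule: finite_linorder_max_induct)
  case empty
  have "des_words T {} = {sorted_list_of_set T}"
    using empty by (auto simp: des_words_def permutations_of_set_def des_list_empty_iff
        sorted_list_of_set.idem_if_sorted_distinct)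
  then show ?case by (simp add: inv_list_sorted)
next
  case (insert s S)
  have S: "S \<subseteq> {..<s}" using insert by auto
  let ?F = "{B. B \<subseteq> T \<and> card B = s}"
  have "(\<Sum>w\<in>des_words T (insert s S). q ^ (inv_list w + 0)) =
    (\<Sum>B\<in>?F. q ^ (cross_inv B (T - B) + 0)) * qmult q s S"
  proof (rule sum_split_words[where s = s, OF des_words_insert])
    show "(\<Sum>u\<in>des_words B S. q ^ inv_list u) = qmult q s S" if "B \<in> ?F" for B
    proof -
      have "finite B" "card B = s" using that insert.prems finite_subset by auto
      moreover have "S \<subseteq> {..card B}" using S \<open>card B = s\<close> by auto
      ultimately show ?thesis using insert.IH[of B] by simp
    qed
  qed (use insert S in \<open>auto dest: finite_subset\<close>)
  then show ?case
    using insert by (simp add: sum_cross_inv qmult_insert)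
qed

subsection \<open>Signed words\<close>

text \<open>Letters are represented by keys in \<open>{1..2 * d}\<close>; the keys \<open>x\<close>
  and \<open>2 * d + 1 - x\<close> belong to opposite letters. A transversal contains at most one
  sign of each absolute value.\<close>

definition transversal :: "nat \<Rightarrow> nat set \<Rightarrow> bool" where
  "transversal d B \<longleftrightarrow> B \<subseteq> {1..2 * d} \<and> (\<forall>x\<in>B. 2 * d + 1 - x \<notin> B)"

text \<open>Keys above \<open>d\<close> are those of negative letters.\<close>

definition big_part :: "nat \<Rightarrow> nat set \<Rightarrow> nat set" where
  "big_part d B = {x \<in> B. d < x}"

definition unused :: "nat \<Rightarrow> nat set \<Rightarrow> nat set" where
  "unused d B = {1..d} - (\<lambda>x. if x \<le> d then x else 2 * d + 1 - x) ` B"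

text \<open>A negative letter \<open>a\<close> has key \<open>2 * d + 1 + a\<close>, so its summand
  is \<open>d + a + e\<close>: the sign part of the length, with \<open>e = 1\<close> in type BC and
  \<open>e = 0\<close> in type D.\<close>

definition big_stat :: "nat \<Rightarrow> nat \<Rightarrow> nat set \<Rightarrow> nat" where
  "big_stat e d B = (\<Sum>x\<in>big_part d B. x - d - 1 + e)"

definition signed_words :: "nat \<Rightarrow> nat set \<Rightarrow> nat list set" where
  "signed_words d K = {w. distinct w \<and> length w = d \<and> transversal d (set w) \<and> card (big_part d (set w)) \<in> K}"

text \<open>A negative last letter counts as a descent at \<open>d\<close>, as if a separator lying
  between the keys of positive and of negative letters were appended to the word.\<close>

definition signed_des :: "nat \<Rightarrow> nat list \<Rightarrow> nat set" where
  "signed_des d w = des_list w \<union> (if last w > d then {d} else {})"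

lemma transversal_finite: "transversal d B \<Longrightarrow> finite B"
  unfolding transversal_def by (meson finite_atLeastAtMost finite_subset)

lemma finite_transversals: "finite {B. transversal d B \<and> P B}"
  by (rule finite_subset[of _ "Pow {1..2 * d}"]) (auto simp: transversal_def)

lemma finite_signed_words: "finite (signed_words d K)"
  by (rule finite_subset[OF _ finite_lists_length_eq[of "{1..2 * d}" d]])
    (auto simp: signed_words_def transversal_def)

lemma finite_unused [simp]: "finite (unused d B)"
  by (simp add: unused_def)

lemma unused_iff:
  assumes "transversal d B"
  shows "x \<in> unused d B \<longleftrightarrow> 1 \<le> x \<and> x \<le> d \<and> x \<notin> B \<and> 2 * d + 1 - x \<notin> B"
proof -
  have "x \<in> (\<lambda>x. if x \<le> d then x else 2 * d + 1 - x) ` B \<longleftrightarrow> x \<in> B \<or> 2 * d + 1 - x \<in> B"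
    if "1 \<le> x" "x \<le> d"
  proof
    assume "x \<in> (\<lambda>x. if x \<le> d then x else 2 * d + 1 - x) ` B"
    then obtain y where y: "y \<in> B" "x = (if y \<le> d then y else 2 * d + 1 - y)" by auto
    moreover have "y \<le> 2 * d" using y assms by (auto simp: transversal_def)
    ultimately show "x \<in> B \<or> 2 * d + 1 - x \<in> B" by (auto split: if_splits)
  next
    assume "x \<in> B \<or> 2 * d + 1 - x \<in> B"
    then show "x \<in> (\<lambda>x. if x \<le> d then x else 2 * d + 1 - x) ` B"
    proof
      assume "x \<in> B"
      then show ?thesis using that by (auto intro!: image_eqI[of _ _ x])
    next
      assume "2 * d + 1 - x \<in> B"
      then show ?thesis using that by (auto intro!: image_eqI[of _ _ "2 * d + 1 - x"])
    qed
  qed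
  then show ?thesis by (auto simp: unused_def)
qed

text \<open>Folding each key above \<open>d\<close> onto its partner is injective on a transversal
  and lands in \<open>{1..d}\<close>.\<close>

lemma card_unused:
  assumes "transversal d B"
  shows "card (unused d B) = d - card B" "card B \<le> d"
proof -
  let ?f = "\<lambda>x. if x \<le> d then x else 2 * d + 1 - x"
  have B: "x \<le> 2 * d" "1 \<le> x" "2 * d + 1 - x \<notin> B" if "x \<in> B" for x
    using that assms by (auto simp: transversal_def)
  have inj: "inj_on ?f B"
  proof (rule inj_onI)
    fix x y assume xy: "x \<in> B" "y \<in> B" and eq: "?f x = ?f y"
    consider "x = y" | "x = 2 * d + 1 - y"
      using eq B(1)[OF xy(1)] B(1)[OF xy(2)] by (auto split: if_splits)
    then show "x = y" using B(3)[OF xy(2)] xy by cases auto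
  qed
  have sub: "?f ` B \<subseteq> {1..d}" using B by (fastforce split: if_splits)
  show "card (unused d B) = d - card B"
    unfolding unused_def using sub transversal_finite[OF assms]
    by (simp only: card_Diff_subset card_image[OF inj] finite_imageI) simp
  show "card B \<le> d" using card_mono[OF _ sub] unfolding card_image[OF inj] by simp
qed

text \<open>If \<open>s < d\<close>, then \<open>d\<close> is not an allowed descent, so the last
  letter is positive; the tail is increasing, hence entirely positive. Having \<open>d - s\<close>
  letters, it must use up exactly the free absolute values.\<close>

lemma signed_words_split:
  assumes "S \<subseteq> {..<s}" "s \<le> d"
  shows "{w \<in> signed_words d K. signed_des d w \<subseteq> insert s S} =
    (\<lambda>(B, u). u @ sorted_list_of_set (unused d B)) `
    (SIGMA B:{B. transversal d B \<and> card B = s \<and> card (big_part d B) \<in> K}. des_words B S)"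
    (is "_ = ?R")
proof (intro equalityI subsetI)
  fix w assume "w \<in> {w \<in> signed_words d K. signed_des d w \<subseteq> insert s S}"
  then have w: "distinct w" "length w = d" "transversal d (set w)" "card (big_part d (set w)) \<in> K"
      "des_list w \<subseteq> insert s S" "last w > d \<Longrightarrow> d \<in> insert s S"
    by (auto simp: signed_words_def signed_des_def split: if_splits)
  define u v where "u = take s w" and "v = drop s w"
  have uv: "w = u @ v" "length u = s" "length v = d - s"
    using w assms by (auto simp: u_def v_def)
  have d: "des_list u \<subseteq> S" "sorted v" "distinct u" "distinct v"
    using w assms(1) des_list_append_subset_iff[of S u v] by (auto simp: uv)
  have tr: "transversal d (set u)" using w by (auto simp: uv transversal_def)
  have cu: "card (set u) = s" using d uv by (simp add: distinct_card)
  have small: "x \<le> d" if x: "x \<in> set v" for x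
  proof -
    have "s < d" "v \<noteq> []" using x uv by (cases v; auto)+
    then have "d \<notin> insert s S" using assms by auto
    then have "last v \<le> d" using w(6) \<open>v \<noteq> []\<close> by (auto simp: uv(1) not_less[symmetric])
    moreover have "x \<le> last v"
      using d(2) x \<open>v \<noteq> []\<close> by (metis in_set_conv_nth last_conv_nth sorted_nth_mono
          One_nat_def diff_less length_greater_0_conv lessI less_Suc_eq_le Suc_pred')
    ultimately show ?thesis by simp
  qed
  have "set v \<subseteq> unused d (set u)"
  proof
    fix x assume x: "x \<in> set v"
    then have "x \<in> set w" by (simp add: uv)
    then have "2 * d + 1 - x \<notin> set w" "1 \<le> x" using w(3) by (auto simp: transversal_def)
    then show "x \<in> unused d (set u)"
      using x small[OF x] w(1) by (auto simp: unused_iff[OF tr] uv)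
  qed
  moreover have "card (set v) = card (unused d (set u))"
    using card_unused[OF tr] cu d uv by (simp add: distinct_card)
  ultimately have "set v = unused d (set u)" by (intro card_subset_eq) auto
  then have "v = sorted_list_of_set (unused d (set u))"
    using d by (metis sorted_list_of_set.idem_if_sorted_distinct)
  moreover have "big_part d (set w) = big_part d (set u)"
    using small by (force simp: big_part_def uv)
  ultimately show "w \<in> ?R"
    using w(4) tr cu d unfolding uv(1)
    by (auto simp: image_iff des_words_def permutations_of_set_def intro!: exI[of _ "set u"] exI[of _ u])
next
  fix w assume "w \<in> ?R"
  then obtain B u where B: "transversal d B" "card B = s" "card (big_part d B) \<in> K"
     "set u = B" "distinct u" "des_list u \<subseteq> S" "w = u @ sorted_list_of_set (unused d B)"
    by (auto simp: des_words_def permutations_of_set_def)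
  note un = unused_iff[OF B(1)]
  have len: "length u = s" using B by (metis distinct_card)
  have des: "des_list w \<subseteq> insert s S"
    using B len assms des_list_append_subset_iff[of S u] by auto
  have set: "set w = B \<union> unused d B" using B by simp
  have dist: "distinct w" using B un by auto
  have "length w = d" using B len card_unused[OF B(1)] assms by simp
  moreover have "transversal d (set w)"
    unfolding transversal_def
  proof
    show "set w \<subseteq> {1..2 * d}" using B(1) un by (auto simp: set transversal_def)
    show "\<forall>x\<in>set w. 2 * d + 1 - x \<notin> set w"
    proof
      fix x assume x: "x \<in> set w"
      then have "1 \<le> x" "x \<le> 2 * d" using \<open>set w \<subseteq> {1..2 * d}\<close> by auto
      then have "2 * d + 1 - (2 * d + 1 - x) = x" by simp
      then show "2 * d + 1 - x \<notin> set w"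
        using x un B(1) by (auto simp: set transversal_def)
    qed
  qed
  moreover have "big_part d (set w) = big_part d B"
    using un by (auto simp: set big_part_def)
  moreover have "d \<in> insert s S" if "last w > d"
  proof (rule ccontr)
    assume "d \<notin> insert s S"
    then have "s < d" using assms by auto
    then have "unused d B \<noteq> {}" using card_unused[OF B(1)] B(2) by auto
    then have ne: "sorted_list_of_set (unused d B) \<noteq> []" by simp
    then have "last w \<in> unused d B"
      using B(7) last_in_set[OF ne] by simp
    then show False using that un by auto
  qed
  ultimately show "w \<in> {w \<in> signed_words d K. signed_des d w \<subseteq> insert s S}"
    using B dist des by (auto simp: signed_words_def signed_des_def)
qed

text \<open>This counts both the isotropic subspaces \<open>V\<close> of dimension \<open>m\<close> with \<open>dim (V \<inter> I) = m - k\<close> for a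
  maximal isotropic \<open>I\<close>, and (with weights) the sets of the first \<open>m\<close> letters of a signed permutation
  having \<open>k\<close> negative ones.\<close>

definition iso_count :: "nat \<Rightarrow> nat \<Rightarrow> nat \<Rightarrow> nat \<Rightarrow> nat \<Rightarrow> nat" where
  "iso_count q e d m k =
     q ^ (k * (d - m) + k * (k - 1) div 2 + e * k) * qbinom q d k * qbinom q (d - k) (m - k)"

lemma transversal_parts:
  assumes N: "N \<subseteq> {..<d}" and P: "P \<subseteq> {1..d} - (\<lambda>n. d - n) ` N"
  defines "B \<equiv> P \<union> (\<lambda>n. d + 1 + n) ` N"
  shows "transversal d B" "big_part d B = (\<lambda>n. d + 1 + n) ` N"
    "unused d B = {1..d} - (\<lambda>n. d - n) ` N - P" "card B = card P + card N"
    "big_stat e d B = \<Sum>N + e * card N"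
    "cross_inv B (unused d B) = card N * (d - card B) + cross_inv P ({1..d} - (\<lambda>n. d - n) ` N - P)"
proof -
  have P1: "x \<le> d" "1 \<le> x" "n \<in> N \<Longrightarrow> x \<noteq> d - n" if "x \<in> P" for x n using P that by auto
  have N1: "n < d" if "n \<in> N" for n using N that by auto
  have fin: "finite N" "finite P" using N P by (auto intro: finite_subset)
  show tr: "transversal d B"
    unfolding transversal_def
  proof (intro conjI ballI notI)
    show "B \<subseteq> {1..2 * d}" unfolding B_def using P1 N1 by fastforce
    fix x assume x: "x \<in> B" "2 * d + 1 - x \<in> B"
    from x(1) consider "x \<in> P" | n where "n \<in> N" "x = d + 1 + n" by (auto simp: B_def)
    then show False
    proof cases
      case 1
      then have "2 * d + 1 - x \<notin> P" using P1(1)[of x] P1(1)[of "2 * d + 1 - x"] by linarith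
      then obtain n where "n \<in> N" "2 * d + 1 - x = d + 1 + n" using x(2) by (auto simp: B_def)
      then show False using P1(3)[OF 1] P1(1)[OF 1] by fastforce
    next
      case 2
      then have eq: "2 * d + 1 - x = d - n" using N1[of n] by linarith
      have "d - n \<notin> P" using P1(3) 2 by blast
      then show False using x(2) unfolding eq by (auto simp: B_def)
    qed
  qed
  show big: "big_part d B = (\<lambda>n. d + 1 + n) ` N"
    using P1 by (fastforce simp: big_part_def B_def)
  show un: "unused d B = {1..d} - (\<lambda>n. d - n) ` N - P"
  proof (rule set_eqI)
    fix x
    have "2 * d + 1 - x \<in> B \<longleftrightarrow> x \<in> (\<lambda>n. d - n) ` N" if x: "1 \<le> x" "x \<le> d"
    proof -
      have "2 * d + 1 - x \<notin> P" using P1(1)[of "2 * d + 1 - x"] x by auto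
      moreover have "2 * d + 1 - x = d + 1 + n \<longleftrightarrow> x = d - n" if "n \<in> N" for n
        using x N1[OF that] by auto
      ultimately show ?thesis unfolding B_def by blast
    qed
    moreover have "x \<in> B \<longleftrightarrow> x \<in> P" if x: "x \<le> d" using x by (auto simp: B_def)
    ultimately show "x \<in> unused d B \<longleftrightarrow> x \<in> {1..d} - (\<lambda>n. d - n) ` N - P"
      unfolding unused_iff[OF tr] by auto
  qed
  have disj: "P \<inter> (\<lambda>n. d + 1 + n) ` N = {}" using P1 by fastforce
  show card: "card B = card P + card N"
    unfolding B_def using fin disj by (subst card_Un_disjoint) (auto simp: card_image inj_on_def)
  show "big_stat e d B = \<Sum>N + e * card N"
    unfolding big_stat_def big by (subst sum.reindex) (simp_all add: sum.distrib inj_on_def)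
  let ?C = "{1..d} - (\<lambda>n. d - n) ` N - P"
  have "{y \<in> ?C. y < d + 1 + n} = ?C" for n by auto
  moreover have "card ?C = d - card B" using card_unused(1)[OF tr] un by simp
  ultimately have "(\<Sum>x\<in>(\<lambda>n. d + 1 + n) ` N. card {y \<in> ?C. y < x}) = card N * (d - card B)"
    by (subst sum.reindex) (simp_all add: inj_on_def)
  then show "cross_inv B (unused d B) = card N * (d - card B) + cross_inv P ?C"
    unfolding un using fin disj
    by (simp add: cross_inv_alt B_def sum.union_disjoint)
qed

lemma sum_transversals:
  assumes "k \<le> m" "m \<le> d"
  shows "(\<Sum>B | transversal d B \<and> card B = m \<and> card (big_part d B) = k.
            q ^ (cross_inv B (unused d B) + big_stat e d B)) = iso_count q e d m k"
proof -
  let ?N = "{N. N \<subseteq> {..<d} \<and> card N = k}"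
  let ?T = "\<lambda>N. {1..d} - (\<lambda>n. d - n) ` N"
  let ?P = "\<lambda>N. {P. P \<subseteq> ?T N \<and> card P = m - k}"
  let ?i = "\<lambda>(N, P). P \<union> (\<lambda>n. d + 1 + n) ` N"
  let ?j = "\<lambda>B. ((\<lambda>x. x - d - 1) ` big_part d B, {x \<in> B. x \<le> d})"
  have finN: "finite N" if "N \<in> ?N" for N using that finite_subset by auto
  have "(\<Sum>B | transversal d B \<and> card B = m \<and> card (big_part d B) = k.
            q ^ (cross_inv B (unused d B) + big_stat e d B)) =
     (\<Sum>(N, P)\<in>Sigma ?N ?P. q ^ (k * (d - m) + e * k) * q ^ \<Sum>N * q ^ cross_inv P (?T N - P))"
  proof (rule sum.reindex_bij_witness[where i = ?i and j = ?j])
    fix B assume B: "B \<in> {B. transversal d B \<and> card B = m \<and> card (big_part d B) = k}"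
    define N P where "N = (\<lambda>x. x - d - 1) ` big_part d B" and "P = {x \<in> B. x \<le> d}"
    have j: "?j B = (N, P)" by (simp add: N_def P_def)
    have bnd: "1 \<le> x" "x \<le> 2 * d" "2 * d + 1 - x \<notin> B" if "x \<in> B" for x
      using B that by (auto simp: transversal_def)
    have N': "(\<lambda>n. d + 1 + n) ` N = big_part d B"
      by (auto simp: N_def image_image big_part_def)
    have cN: "card N = k"
    proof -
      have "inj_on (\<lambda>x. x - d - 1) (big_part d B)" by (auto simp: inj_on_def big_part_def)
      then show ?thesis using B by (simp add: N_def card_image)
    qed
    have N: "N \<subseteq> {..<d}" using bnd by (fastforce simp: N_def big_part_def)
    have P: "P \<subseteq> ?T N"
    proof
      fix x assume x: "x \<in> P"
      have "x \<notin> (\<lambda>n. d - n) ` N"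
      proof
        assume "x \<in> (\<lambda>n. d - n) ` N"
        then obtain y where y: "y \<in> B" "d < y" "x = d - (y - d - 1)"
          by (auto simp: N_def big_part_def)
        then have "x = 2 * d + 1 - y" using bnd(2)[of y] by linarith
        then show False using bnd(3)[OF y(1)] x by (simp add: P_def)
      qed
      then show "x \<in> ?T N" using x bnd(1)[of x] by (simp add: P_def)
    qed
    have B_eq: "P \<union> (\<lambda>n. d + 1 + n) ` N = B"
      unfolding N' by (auto simp: P_def big_part_def)
    note parts = transversal_parts[OF N P, unfolded B_eq]
    have cP: "card P = m - k" using parts(4) B cN by auto
    show "?i (?j B) = B" unfolding j using B_eq by simp
    show "?j B \<in> Sigma ?N ?P" unfolding j using N cN P cP by simp
    show "(case ?j B of (N, P) \<Rightarrow> q ^ (k * (d - m) + e * k) * q ^ \<Sum>N * q ^ cross_inv P (?T N - P)) =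
      q ^ (cross_inv B (unused d B) + big_stat e d B)"
      unfolding j using parts(5)[of e] parts(6) B cN by (simp add: power_add)
  next
    fix x assume x: "x \<in> Sigma ?N ?P"
    obtain N P where eq: "x = (N, P)" by (cases x)
    have N: "N \<subseteq> {..<d}" "card N = k" and P: "P \<subseteq> ?T N" "card P = m - k"
      using x by (auto simp: eq)
    note parts = transversal_parts[OF N(1) P(1)]
    have "(\<lambda>x. x - d - 1) ` (\<lambda>n. d + 1 + n) ` N = N" by (simp add: image_image)
    moreover have "{x \<in> P \<union> (\<lambda>n. d + 1 + n) ` N. x \<le> d} = P" using P by auto
    ultimately show "?j (?i x) = x"
      unfolding eq by (simp only: prod.case parts(2))
    have "card ((\<lambda>n. d + 1 + n) ` N) = k" using N by (simp add: card_image inj_on_def)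
    then show "?i x \<in> {B. transversal d B \<and> card B = m \<and> card (big_part d B) = k}"
      unfolding eq using parts(1,2,4) N P assms by simp
  qed
  also have "\<dots> = (\<Sum>N\<in>?N. \<Sum>P\<in>?P N. q ^ (k * (d - m) + e * k) * q ^ \<Sum>N * q ^ cross_inv P (?T N - P))"
    by (rule sum.Sigma[symmetric]) (auto intro: finite_subset)
  also have "\<dots> = (\<Sum>N\<in>?N. q ^ (k * (d - m) + e * k) * q ^ \<Sum>N * qbinom q (d - k) (m - k))"
  proof (rule sum.cong[OF refl])
    fix N assume N: "N \<in> ?N"
    have "inj_on (\<lambda>n. d - n) N" using N by (auto simp: inj_on_def)
    then have "card ((\<lambda>n. d - n) ` N) = k" using N by (simp add: card_image)
    moreover have "(\<lambda>n. d - n) ` N \<subseteq> {1..d}" using N by auto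
    ultimately have "card (?T N) = d - k" using finN[OF N] by (simp add: card_Diff_subset)
    then have "(\<Sum>P\<in>?P N. q ^ cross_inv P (?T N - P)) = qbinom q (d - k) (m - k)"
      using sum_cross_inv[of "?T N" q "m - k"] by simp
    then show "(\<Sum>P\<in>?P N. q ^ (k * (d - m) + e * k) * q ^ \<Sum>N * q ^ cross_inv P (?T N - P)) =
       q ^ (k * (d - m) + e * k) * q ^ \<Sum>N * qbinom q (d - k) (m - k)"
      by (simp only: sum_distrib_left[symmetric])
  qed
  also have "\<dots> = q ^ (k * (d - m) + e * k) * (\<Sum>N\<in>?N. q ^ \<Sum>N) * qbinom q (d - k) (m - k)"
    by (simp add: sum_distrib_left sum_distrib_right)
  also have "\<dots> = iso_count q e d m k"
    by (simp add: sum_power_subsets iso_count_def power_add)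
  finally show ?thesis .
qed

lemma sum_signed_words:
  assumes "finite S" "S \<subseteq> {..<m}" "m \<le> d"
  shows "(\<Sum>w | w \<in> signed_words d K \<and> signed_des d w \<subseteq> insert m S. q ^ (inv_list w + big_stat e d (set w))) =
    (\<Sum>k | k \<in> K \<and> k \<le> m. iso_count q e d m k) * qmult q m S"
proof -
  let ?F = "{B. transversal d B \<and> card B = m \<and> card (big_part d B) \<in> K}"
  let ?f = "\<lambda>B. q ^ (cross_inv B (unused d B) + big_stat e d B)"
  have "(\<Sum>w | w \<in> signed_words d K \<and> signed_des d w \<subseteq> insert m S. q ^ (inv_list w + big_stat e d (set w))) =
     (\<Sum>B\<in>?F. ?f B) * qmult q m S"
  proof (rule sum_split_words[where s = m, OF signed_words_split[OF assms(2,3)]])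
    show "finite ?F" by (rule finite_transversals)
    show B: "finite B \<and> card B = m" if "B \<in> ?F" for B
      using that transversal_finite by auto
    have "S \<subseteq> {..m}" using assms(2) by auto
    then show "(\<Sum>u\<in>des_words B S. q ^ inv_list u) = qmult q m S" if "B \<in> ?F" for B
      using B[OF that] assms(1) sum_des_words[of B S q] by simp
    show "big_stat e d (set (u @ sorted_list_of_set (unused d B))) = big_stat e d B"
      if "B \<in> ?F" "set u = B" for B u
    proof -
      have "big_part d (B \<union> unused d B) = big_part d B" by (auto simp: big_part_def unused_def)
      then show ?thesis using that by (simp add: big_stat_def)
    qed
  qed auto
  also have "(\<Sum>B\<in>?F. ?f B) = (\<Sum>k | k \<in> K \<and> k \<le> m. \<Sum>B\<in>{B\<in>?F. card (big_part d B) = k}. ?f B)"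
  proof (rule sum.group[symmetric])
    show "(\<lambda>B. card (big_part d B)) ` ?F \<subseteq> {k. k \<in> K \<and> k \<le> m}"
      by (auto simp: big_part_def intro!: card_mono transversal_finite)
  qed (auto intro!: finite_transversals)
  also have "\<dots> = (\<Sum>k | k \<in> K \<and> k \<le> m. iso_count q e d m k)"
  proof (rule sum.cong[OF refl])
    fix k assume k: "k \<in> {k. k \<in> K \<and> k \<le> m}"
    then have "{B\<in>?F. card (big_part d B) = k} = {B. transversal d B \<and> card B = m \<and> card (big_part d B) = k}"
      by auto
    then show "(\<Sum>B\<in>{B\<in>?F. card (big_part d B) = k}. ?f B) = iso_count q e d m k"
      using sum_transversals[of k m d q e] k assms by simp
  qed
  finally show ?thesis .
qed

subsection \<open>Signed permutations as words\<close>

text \<open>The key realises the order $1 < \dots < d < -d < \dots < -1$, for which the sign conditions in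
  \<open>inversions\<close> and \<open>beta_stat\<close> say that two letters are out of order.\<close>

definition signed_key :: "nat \<Rightarrow> int \<Rightarrow> nat" where
  "signed_key d x = nat (if 0 < x then x else 2 * int d + 1 + x)"

definition perm_word :: "nat \<Rightarrow> (int \<Rightarrow> int) \<Rightarrow> nat list" where
  "perm_word d \<sigma> = map (\<lambda>i. signed_key d (\<sigma> (int i + 1))) [0..<d]"

text \<open>Common ground of the three groups. An element of the type A group is the identity on
  negative integers, hence usually not odd and not in \<open>signed_perms\<close>; all statistics
  depend only on the values on \<open>{1..int d}\<close>.\<close>

definition signed_inj :: "nat \<Rightarrow> (int \<Rightarrow> int) \<Rightarrow> bool" where
  "signed_inj d \<sigma> \<longleftrightarrow> (\<forall>i\<in>{1..int d}. \<sigma> i \<noteq> 0 \<and> \<bar>\<sigma> i\<bar> \<le> int d) \<and> inj_on (\<lambda>i. \<bar>\<sigma> i\<bar>) {1..int d}"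

lemma zero_less_mult_pos_iff: "0 < c \<Longrightarrow> 0 < c * x \<longleftrightarrow> 0 < x" for c x :: int
  by (simp add: zero_less_mult_iff)

text \<open>For equal signs the product \<open>a * b\<close> is positive and the key is increasing;
  for opposite signs it is negative, which reverses the comparison, and the key puts the negative
  letter last.\<close>

lemma signed_key_less_iff:
  assumes "a \<noteq> 0" "b \<noteq> 0" "\<bar>a\<bar> \<le> int d" "\<bar>b\<bar> \<le> int d" "\<bar>a\<bar> \<noteq> \<bar>b\<bar>"
  shows "signed_key d b < signed_key d a \<longleftrightarrow> 0 < a * b * (a - b)"
proof -
  consider "a > 0" "b > 0" | "a > 0" "b < 0" | "a < 0" "b > 0" | "a < 0" "b < 0"
    using assms by linarith
  then show ?thesis
  proof cases
    case 1
    then have "a * b > 0" by simp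
    then have "0 < a * b * (a - b) \<longleftrightarrow> b < a" by (subst zero_less_mult_pos_iff) simp_all
    then show ?thesis using 1 by (simp add: signed_key_def)
  next
    case 2
    then have "a * b < 0" "a - b > 0" by (simp_all add: mult_pos_neg)
    then have "a * b * (a - b) < 0" by (rule mult_neg_pos)
    then show ?thesis using 2 assms by (simp add: signed_key_def)
  next
    case 3
    then have "a * b < 0" "a - b < 0" by (simp_all add: mult_neg_pos)
    then have "0 < a * b * (a - b)" by (rule mult_neg_neg)
    then show ?thesis using 3 assms by (simp add: signed_key_def)
  next
    case 4
    then have "a * b > 0" by (simp add: mult_neg_neg)
    then have "0 < a * b * (a - b) \<longleftrightarrow> b < a" by (subst zero_less_mult_pos_iff) simp_all
    then show ?thesis using 4 assms by (simp add: signed_key_def)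
  qed
qed

lemma signed_key_bounds:
  assumes "a \<noteq> 0" "\<bar>a\<bar> \<le> int d"
  shows "1 \<le> signed_key d a" "signed_key d a \<le> 2 * d" "d < signed_key d a \<longleftrightarrow> a < 0"
    "signed_key d (- a) = 2 * d + 1 - signed_key d a"
  using assms by (auto simp: signed_key_def)

lemma signed_key_inj:
  assumes "a \<noteq> 0" "b \<noteq> 0" "\<bar>a\<bar> \<le> int d" "\<bar>b\<bar> \<le> int d" "signed_key d a = signed_key d b"
  shows "a = b"
  using assms by (auto simp: signed_key_def split: if_splits)

lemma length_perm_word [simp]: "length (perm_word d \<sigma>) = d"
  by (simp add: perm_word_def)

lemma nth_perm_word [simp]: "i < d \<Longrightarrow> perm_word d \<sigma> ! i = signed_key d (\<sigma> (int i + 1))"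
  by (simp add: perm_word_def)

lemma set_perm_word: "set (perm_word d \<sigma>) = (\<lambda>i. signed_key d (\<sigma> i)) ` {1..int d}"
proof -
  have "{1..int d} = (\<lambda>i. int i + 1) ` {0..<d}"
  proof (intro equalityI subsetI)
    fix x assume "x \<in> {1..int d}"
    then show "x \<in> (\<lambda>i. int i + 1) ` {0..<d}"
      by (intro image_eqI[of _ _ "nat (x - 1)"]) auto
  qed auto
  then show ?thesis by (simp add: perm_word_def image_image)
qed

context
  fixes d :: nat and \<sigma> :: "int \<Rightarrow> int"
  assumes inj: "signed_inj d \<sigma>"
begin

lemma signed_injD: "1 \<le> i \<Longrightarrow> i \<le> int d \<Longrightarrow> \<sigma> i \<noteq> 0" "1 \<le> i \<Longrightarrow> i \<le> int d \<Longrightarrow> \<bar>\<sigma> i\<bar> \<le> int d"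
  "1 \<le> i \<Longrightarrow> i \<le> int d \<Longrightarrow> 1 \<le> j \<Longrightarrow> j \<le> int d \<Longrightarrow> i \<noteq> j \<Longrightarrow> \<bar>\<sigma> i\<bar> \<noteq> \<bar>\<sigma> j\<bar>"
  using inj unfolding signed_inj_def by (simp_all, meson atLeastAtMost_iff inj_onD)

lemma signed_key_inj_on: "inj_on (\<lambda>i. signed_key d (\<sigma> i)) {1..int d}"
proof (rule inj_onI)
  fix i j assume ij: "i \<in> {1..int d}" "j \<in> {1..int d}" and eq: "signed_key d (\<sigma> i) = signed_key d (\<sigma> j)"
  have "\<sigma> i = \<sigma> j" by (rule signed_key_inj[OF _ _ _ _ eq]) (use ij signed_injD in auto)
  then show "i = j" using signed_injD(3)[of i j] ij by auto
qed

lemma distinct_perm_word: "distinct (perm_word d \<sigma>)"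
  unfolding perm_word_def distinct_map
proof
  show "inj_on (\<lambda>i. signed_key d (\<sigma> (int i + 1))) (set [0..<d])"
    using signed_key_inj_on by (fastforce simp: inj_on_def)
qed simp

lemma transversal_perm_word: "transversal d (set (perm_word d \<sigma>))"
  unfolding transversal_def set_perm_word
proof (intro conjI ballI notI)
  show "(\<lambda>i. signed_key d (\<sigma> i)) ` {1..int d} \<subseteq> {1..2 * d}"
    using signed_key_bounds signed_injD by fastforce
  fix x assume "x \<in> (\<lambda>i. signed_key d (\<sigma> i)) ` {1..int d}" "2 * d + 1 - x \<in> (\<lambda>i. signed_key d (\<sigma> i)) ` {1..int d}"
  then obtain i j where ij: "1 \<le> i" "i \<le> int d" "1 \<le> j" "j \<le> int d"
    and x: "x = signed_key d (\<sigma> i)" "2 * d + 1 - x = signed_key d (\<sigma> j)" by auto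
  \<comment> \<open>The reflected key is that of the negated letter, so a violation yields two
    positions with equal absolute value, hence a single position \<open>i\<close> with
    \<open>- \<sigma> i = \<sigma> i\<close>.\<close>
  have "signed_key d (- \<sigma> i) = signed_key d (\<sigma> j)"
    using signed_key_bounds(4)[of "\<sigma> i" d] signed_injD(1,2)[OF ij(1,2)] x by simp
  then have eq: "- \<sigma> i = \<sigma> j"
    by (rule signed_key_inj[rotated 4]) (use ij signed_injD in auto)
  then have "\<bar>\<sigma> i\<bar> = \<bar>\<sigma> j\<bar>" by (metis abs_minus_cancel)
  then have "i = j" using signed_injD(3)[of i j] ij by auto
  then show False using eq signed_injD(1)[of i] ij by auto
qed

lemma big_part_perm_word: "big_part d (set (perm_word d \<sigma>)) = (\<lambda>i. signed_key d (\<sigma> i)) ` neg_set d \<sigma>"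
proof -
  have "d < signed_key d (\<sigma> i) \<longleftrightarrow> \<sigma> i < 0" if "1 \<le> i" "i \<le> int d" for i
    using signed_key_bounds(3) signed_injD that by blast
  then show ?thesis unfolding big_part_def set_perm_word neg_set_def by auto
qed

lemma neg_set_subset: "neg_set d \<sigma> \<subseteq> {1..int d}"
  by (auto simp: neg_set_def)

lemma card_big_part_perm_word: "card (big_part d (set (perm_word d \<sigma>))) = card (neg_set d \<sigma>)"
  unfolding big_part_perm_word
  by (rule card_image) (rule inj_on_subset[OF signed_key_inj_on neg_set_subset])

lemma big_stat_perm_word:
  "big_stat e d (set (perm_word d \<sigma>)) = (\<Sum>i\<in>neg_set d \<sigma>. nat (int d + int e + \<sigma> i))"
  unfolding big_stat_def big_part_perm_word
proof (subst sum.reindex[OF inj_on_subset[OF signed_key_inj_on neg_set_subset]], rule sum.cong[OF refl])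
  fix i assume "i \<in> neg_set d \<sigma>"
  then have "\<sigma> i < 0" "1 \<le> i" "i \<le> int d" by (auto simp: neg_set_def)
  then show "((\<lambda>x. x - d - 1 + e) \<circ> (\<lambda>i. signed_key d (\<sigma> i))) i = nat (int d + int e + \<sigma> i)"
    using signed_injD(2)[of i] by (auto simp: signed_key_def)
qed

lemma signed_key_perm_less_iff:
  assumes "1 \<le> i" "i \<le> int d" "1 \<le> j" "j \<le> int d" "i \<noteq> j"
  shows "signed_key d (\<sigma> j) < signed_key d (\<sigma> i) \<longleftrightarrow> 0 < \<sigma> i * \<sigma> j * (\<sigma> i - \<sigma> j)"
  using assms signed_injD by (intro signed_key_less_iff) auto

lemma inversions_perm_word: "inversions d \<sigma> = inv_list (perm_word d \<sigma>)"
proof -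
  let ?f = "map_prod (\<lambda>i. int i + 1) (\<lambda>i. int i + 1)"
  let ?A = "{(i, j). i < j \<and> j < length (perm_word d \<sigma>) \<and> perm_word d \<sigma> ! j < perm_word d \<sigma> ! i}"
  have "{(i, j). 0 < i \<and> i < j \<and> j \<le> int d \<and> \<sigma> i * \<sigma> j * (\<sigma> i - \<sigma> j) > 0} = ?f ` ?A" (is "?L = ?R")
  proof (intro equalityI subsetI)
    fix x assume "x \<in> ?L"
    then obtain i j where x: "x = (i, j)" and ij: "0 < i" "i < j" "j \<le> int d" "\<sigma> i * \<sigma> j * (\<sigma> i - \<sigma> j) > 0"
      by auto
    then have "(nat (i - 1), nat (j - 1)) \<in> ?A"
      using signed_key_perm_less_iff[of i j] by auto
    moreover have "x = ?f (nat (i - 1), nat (j - 1))" using ij x by simp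
    ultimately show "x \<in> ?R" by blast
  next
    fix x assume "x \<in> ?R"
    then obtain i j where x: "x = (int i + 1, int j + 1)"
      and ij: "i < j" "j < d" "signed_key d (\<sigma> (int j + 1)) < signed_key d (\<sigma> (int i + 1))"
      by (auto simp del: of_nat_Suc)
    then show "x \<in> ?L"
      using signed_key_perm_less_iff[of "int i + 1" "int j + 1"] by auto
  qed
  moreover have "inj_on ?f ?A" by (auto simp: inj_on_def)
  ultimately show ?thesis
    unfolding inversions_def inv_list_conv_card by (simp only: card_image)
qed

definition int_des :: "int set" where
  "int_des = {i. 1 \<le> i \<and> i < int d \<and> \<sigma> i * \<sigma> (i + 1) * (\<sigma> i - \<sigma> (i + 1)) > 0}"

lemma des_list_perm_word: "int ` des_list (perm_word d \<sigma>) = int_des"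
proof (intro equalityI subsetI)
  fix x assume "x \<in> int ` des_list (perm_word d \<sigma>)"
  then obtain i where i: "x = int i" "0 < i" "i < d" "signed_key d (\<sigma> (int i + 1)) < signed_key d (\<sigma> (int (i - 1) + 1))"
    by (auto simp: des_list_def)
  then have "int (i - 1) + 1 = int i" by simp
  with i show "x \<in> int_des"
    using signed_key_perm_less_iff[of "int i" "int i + 1"] by (auto simp: int_des_def)
next
  fix x assume "x \<in> int_des"
  then have x: "1 \<le> x" "x < int d" "\<sigma> x * \<sigma> (x + 1) * (\<sigma> x - \<sigma> (x + 1)) > 0" by (auto simp: int_des_def)
  then have "signed_key d (\<sigma> (x + 1)) < signed_key d (\<sigma> x)"
    using signed_key_perm_less_iff[of x "x + 1"] by auto
  moreover have "int (nat x - 1) + 1 = x" using x by simp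
  ultimately have "nat x \<in> des_list (perm_word d \<sigma>)"
    using x by (auto simp: des_list_def)
  then show "x \<in> int ` des_list (perm_word d \<sigma>)" using x by force
qed

lemma signed_des_perm_word:
  assumes "d \<ge> 1"
  shows "int ` signed_des d (perm_word d \<sigma>) = int_des \<union> (if \<sigma> (int d) < 0 then {int d} else {})"
proof -
  have "last (perm_word d \<sigma>) = perm_word d \<sigma> ! (d - 1)"
    using assms by (subst last_conv_nth) (auto simp: perm_word_def)
  also have "\<dots> = signed_key d (\<sigma> (int d))" using assms by (simp add: of_nat_diff)
  finally have "last (perm_word d \<sigma>) > d \<longleftrightarrow> \<sigma> (int d) < 0"
    using signed_key_bounds(3)[of "\<sigma> (int d)" d] signed_injD[of "int d"] assms by simp
  then show ?thesis unfolding signed_des_def image_Un des_list_perm_word by auto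
qed

lemma beta_stat_perm_word:
  assumes "d \<ge> 1"
  shows "beta_stat d \<sigma> = card (signed_des d (perm_word d \<sigma>))"
proof -
  have fin: "finite int_des" by (rule finite_subset[of _ "{1..int d}"]) (auto simp: int_des_def)
  have "card (signed_des d (perm_word d \<sigma>)) = card (int ` signed_des d (perm_word d \<sigma>))"
    by (simp add: card_image)
  also have "\<dots> = beta_stat d \<sigma>"
    unfolding signed_des_perm_word[OF assms] beta_stat_def int_des_def[symmetric]
    using fin by (auto simp: int_des_def card_insert_if)
  finally show ?thesis by simp
qed

text \<open>At each sign change the two descent conventions differ, by \<open>i\<close> times the difference of the
  sign indicators at \<open>i\<close> and \<open>i + 1\<close>; summation by parts turns the total into the number of signs.\<close>

lemma wmaj_perm_word:
  assumes "d \<ge> 1"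
  shows "wmaj d \<sigma> = \<Sum>(signed_des d (perm_word d \<sigma>))"
proof -
  define n where "n = (\<lambda>i::nat. of_bool (\<sigma> (int i) < 0) :: int)"
  define new old where "new = (\<lambda>i. of_bool (\<sigma> (int i) * \<sigma> (int i + 1) * (\<sigma> (int i) - \<sigma> (int i + 1)) > 0) :: int)"
    and "old = (\<lambda>i. of_bool (\<sigma> (int i) > \<sigma> (int i + 1)) :: int)"
  have step: "new i - old i = n i - n (Suc i)" if "i \<in> {1..<d}" for i
  proof -
    let ?a = "\<sigma> (int i)" and ?b = "\<sigma> (int i + 1)"
    have nz: "?a \<noteq> 0" "?b \<noteq> 0" using signed_injD(1) that by auto
    consider "?a > 0" "?b > 0" | "?a > 0" "?b < 0" | "?a < 0" "?b > 0" | "?a < 0" "?b < 0"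
      using nz by linarith
    then show ?thesis
    proof cases
      case 1
      then have "?a * ?b > 0" by simp
      then have "?a * ?b * (?a - ?b) > 0 \<longleftrightarrow> ?b < ?a" by (subst zero_less_mult_pos_iff) simp_all
      then show ?thesis using 1 by (simp add: new_def old_def n_def add.commute)
    next
      case 2
      then have "?a * ?b < 0" by (simp add: mult_pos_neg)
      then have "?a * ?b * (?a - ?b) < 0" by (rule mult_neg_pos) (use 2 in simp)
      then show ?thesis using 2 by (simp add: new_def old_def n_def add.commute)
    next
      case 3
      then have "?a * ?b < 0" by (simp add: mult_neg_pos)
      then have "?a * ?b * (?a - ?b) > 0" by (rule mult_neg_neg) (use 3 in simp)
      then show ?thesis using 3 by (simp add: new_def old_def n_def add.commute)
    next
      case 4
      then have "?a * ?b > 0" by (simp add: mult_neg_neg)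
      then have "?a * ?b * (?a - ?b) > 0 \<longleftrightarrow> ?b < ?a" by (subst zero_less_mult_pos_iff) simp_all
      then show ?thesis using 4 by (simp add: new_def old_def n_def add.commute)
    qed
  qed
  have parts: "(\<Sum>i\<in>{1..<m}. int i * (n i - n (Suc i))) + int m * n m = (\<Sum>i\<in>{1..m}. n i)"
    if "m \<ge> 1" for m
    using that by (induction m rule: dec_induct) (simp_all add: algebra_simps)
  have neg: "int (card (neg_set d \<sigma>)) = (\<Sum>i\<in>{1..d}. n i)"
  proof -
    have "neg_set d \<sigma> = int ` {i\<in>{1..d}. \<sigma> (int i) < 0}"
    proof (intro equalityI subsetI)
      fix x assume "x \<in> neg_set d \<sigma>"
      then show "x \<in> int ` {i\<in>{1..d}. \<sigma> (int i) < 0}"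
        by (intro image_eqI[of _ _ "nat x"]) (auto simp: neg_set_def)
    qed (auto simp: neg_set_def)
    then have "card (neg_set d \<sigma>) = card {i\<in>{1..d}. \<sigma> (int i) < 0}" by (simp add: card_image)
    then show ?thesis by (simp add: n_def Int_def)
  qed
  have conv: "(\<Sum>i | 1 \<le> i \<and> i < int d \<and> P i. i) = (\<Sum>i\<in>{1..<d}. int i * of_bool (P (int i)))" for P
  proof -
    have "{i. 1 \<le> i \<and> i < int d \<and> P i} = int ` {i\<in>{1..<d}. P (int i)}"
    proof (intro equalityI subsetI)
      fix x assume "x \<in> {i. 1 \<le> i \<and> i < int d \<and> P i}"
      then show "x \<in> int ` {i\<in>{1..<d}. P (int i)}"
        by (intro image_eqI[of _ _ "nat x"]) auto
    qed auto
    then have "(\<Sum>i | 1 \<le> i \<and> i < int d \<and> P i. i) = (\<Sum>i\<in>{i\<in>{1..<d}. P (int i)}. int i)"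
      by (simp add: sum.reindex)
    also have "\<dots> = (\<Sum>i\<in>{1..<d}. int i * of_bool (P (int i)))"
      by (subst sum.inter_filter) (simp, rule sum.cong, simp_all)
    finally show ?thesis .
  qed
  have fin: "finite int_des" by (rule finite_subset[of _ "{1..int d}"]) (auto simp: int_des_def)
  have "int (\<Sum>(signed_des d (perm_word d \<sigma>))) = \<Sum>(int ` signed_des d (perm_word d \<sigma>))"
    by (simp add: sum.reindex)
  also have "\<dots> = \<Sum>int_des + int d * n d"
    unfolding signed_des_perm_word[OF assms] using fin by (auto simp: n_def int_des_def)
  also have "\<Sum>int_des = (\<Sum>i\<in>{1..<d}. int i * new i)"
    unfolding int_des_def new_def by (rule conv)
  also have "\<dots> = (\<Sum>i\<in>{1..<d}. int i * (n i - n (Suc i)) + int i * old i)"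
    by (intro sum.cong refl) (simp add: step[symmetric] algebra_simps)
  also have "\<dots> + int d * n d = int (card (neg_set d \<sigma>)) + (\<Sum>i\<in>{1..<d}. int i * old i)"
    using parts[OF assms] by (simp add: neg sum.distrib)
  also have "(\<Sum>i\<in>{1..<d}. int i * old i) = (\<Sum>i | 1 \<le> i \<and> i < int d \<and> \<sigma> i > \<sigma> (i + 1). i)"
    unfolding old_def by (rule conv[symmetric])
  also have "\<dots> = int (\<Sum>i | 1 \<le> i \<and> i < int d \<and> \<sigma> i > \<sigma> (i + 1). nat i)"
    by (simp add: of_nat_sum)
  finally show ?thesis unfolding wmaj_def by linarith
qed

end


section \<open>Signed permutations and signed words in bijection\<close>

lemma signed_perms_signed_inj:
  assumes "\<sigma> \<in> signed_perms d"
  shows "signed_inj d \<sigma>"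
proof -
  let ?S = "{- int d..int d} - {0}"
  have p: "\<sigma> permutes ?S" and odd: "\<And>i. i \<in> ?S \<Longrightarrow> \<sigma> (- i) = - \<sigma> i"
    using assms by (auto simp: signed_perms_def)
  have in_S: "\<sigma> i \<in> ?S" if "i \<in> {1..int d}" for i
    using that permutes_in_image[OF p, of i] by auto
  show ?thesis
    unfolding signed_inj_def
  proof (intro conjI ballI inj_onI)
    fix i assume "i \<in> {1..int d}"
    then show "\<sigma> i \<noteq> 0" "\<bar>\<sigma> i\<bar> \<le> int d" using in_S by fastforce+
  next
    fix i j assume ij: "i \<in> {1..int d}" "j \<in> {1..int d}" "\<bar>\<sigma> i\<bar> = \<bar>\<sigma> j\<bar>"
    then consider "\<sigma> i = \<sigma> j" | "\<sigma> i = \<sigma> (- j)" using odd[of j] by (auto simp: abs_eq_iff)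
    then show "i = j"
    proof cases
      case 1
      then show ?thesis by (rule injD[OF permutes_inj[OF p]])
    next
      case 2
      then have "i = - j" by (rule injD[OF permutes_inj[OF p]])
      then show ?thesis using ij by simp
    qed
  qed
qed

lemma perms_signed_inj:
  assumes "\<sigma> permutes {1..int d}"
  shows "signed_inj d \<sigma>" "neg_set d \<sigma> = {}"
proof -
  have in_S: "\<sigma> i \<in> {1..int d}" if "i \<in> {1..int d}" for i
    using that permutes_in_image[OF assms, of i] by auto
  show "neg_set d \<sigma> = {}" using in_S by (fastforce simp: neg_set_def)
  show "signed_inj d \<sigma>"
    unfolding signed_inj_def
  proof (intro conjI ballI inj_onI)
    fix i assume "i \<in> {1..int d}"
    then show "\<sigma> i \<noteq> 0" "\<bar>\<sigma> i\<bar> \<le> int d" using in_S by fastforce+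
  next
    fix i j assume ij: "i \<in> {1..int d}" "j \<in> {1..int d}" "\<bar>\<sigma> i\<bar> = \<bar>\<sigma> j\<bar>"
    then have "\<sigma> i = \<sigma> j" using in_S[of i] in_S[of j] by auto
    then show "i = j" by (rule injD[OF permutes_inj[OF assms]])
  qed
qed

lemma perm_word_eqD:
  assumes "signed_inj d \<sigma>" "signed_inj d \<tau>" "perm_word d \<sigma> = perm_word d \<tau>" "i \<in> {1..int d}"
  shows "\<sigma> i = \<tau> i"
proof (rule signed_key_inj)
  have "perm_word d \<sigma> ! (nat i - 1) = perm_word d \<tau> ! (nat i - 1)" using assms by simp
  moreover have "int (nat i - 1) + 1 = i" "nat i - 1 < d" using assms(4) by auto
  ultimately show "signed_key d (\<sigma> i) = signed_key d (\<tau> i)" by simp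
qed (use assms in \<open>auto simp: signed_inj_def\<close>)

definition unkey :: "nat \<Rightarrow> nat \<Rightarrow> int" where
  "unkey d x = (if x \<le> d then int x else int x - 2 * int d - 1)"

lemma signed_key_unkey: "1 \<le> x \<Longrightarrow> x \<le> 2 * d \<Longrightarrow> signed_key d (unkey d x) = x"
  by (auto simp: signed_key_def unkey_def)

lemma unkey_bounds: "1 \<le> x \<Longrightarrow> x \<le> 2 * d \<Longrightarrow> unkey d x \<in> {- int d..int d} - {0}"
  by (auto simp: unkey_def)

lemma perm_word_eqI:
  assumes "length w = d" "set w \<subseteq> {1..2 * d}" "\<And>i. i \<in> {1..int d} \<Longrightarrow> \<sigma> i = unkey d (w ! (nat i - 1))"
  shows "perm_word d \<sigma> = w"
proof (rule nth_equalityI)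
  fix i assume i: "i < length (perm_word d \<sigma>)"
  then have "w ! i \<in> {1..2 * d}" using assms(1,2) nth_mem[of i w] by (metis length_perm_word subsetD)
  moreover have "nat (int i + 1) - 1 = i" by simp
  ultimately show "perm_word d \<sigma> ! i = w ! i"
    using i assms(3)[of "int i + 1"] by (simp add: signed_key_unkey)
qed (use assms in simp)

lemma bij_betw_signed_perms:
  "bij_betw (perm_word d) {\<sigma> \<in> signed_perms d. card (neg_set d \<sigma>) \<in> K} (signed_words d K)"
  unfolding bij_betw_def
proof
  let ?S = "{- int d..int d} - {0}"
  let ?P = "{\<sigma> \<in> signed_perms d. card (neg_set d \<sigma>) \<in> K}"
  show "inj_on (perm_word d) ?P"
  proof (rule inj_onI, rule ext)
    fix \<sigma> \<tau> i assume st: "\<sigma> \<in> ?P" "\<tau> \<in> ?P" "perm_word d \<sigma> = perm_word d \<tau>"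
    have si: "signed_inj d \<sigma>" "signed_inj d \<tau>" using st signed_perms_signed_inj by auto
    note eq = perm_word_eqD[OF si st(3)]
    have p: "\<sigma> permutes ?S" "\<tau> permutes ?S" using st by (auto simp: signed_perms_def)
    have odd: "\<sigma> (- i) = - \<sigma> i" "\<tau> (- i) = - \<tau> i" if "i \<in> ?S" for i
      using that st by (auto simp: signed_perms_def)
    consider "i \<in> {1..int d}" | "- i \<in> {1..int d}" | "i \<notin> ?S" by fastforce
    then show "\<sigma> i = \<tau> i"
    proof cases
      case 2
      then show ?thesis using eq[of "- i"] odd[of "- i"] by auto
    next
      case 3
      then show ?thesis using p by (simp add: permutes_not_in)
    qed (rule eq)
  qed
  show "perm_word d ` ?P = signed_words d K"
  proof (intro equalityI subsetI)
    fix w assume "w \<in> perm_word d ` ?P"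
    then obtain \<sigma> where s: "\<sigma> \<in> ?P" "w = perm_word d \<sigma>" by auto
    then have "signed_inj d \<sigma>" using signed_perms_signed_inj by auto
    then show "w \<in> signed_words d K"
      using s by (simp add: signed_words_def distinct_perm_word transversal_perm_word card_big_part_perm_word)
  next
    fix w assume w: "w \<in> signed_words d K"
    then have w1: "distinct w" "length w = d" "set w \<subseteq> {1..2 * d}" "\<And>x. x \<in> set w \<Longrightarrow> 2 * d + 1 - x \<notin> set w"
      by (auto simp: signed_words_def transversal_def)
    define f where "f = (\<lambda>i::int. unkey d (w ! (nat i - 1)))"
    \<comment> \<open>A word prescribes the values on \<open>{1..int d}\<close>; oddness forces
      those on the negative integers down to \<open>- int d\<close>, and everything else is
      fixed.\<close>
    define \<sigma> where "\<sigma> = (\<lambda>i. if i \<in> {1..int d} then f i else if - i \<in> {1..int d} then - f (- i) else i)"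
    have mem: "w ! (nat i - 1) \<in> set w" if "i \<in> {1..int d}" for i
      using that w1(2) by (intro nth_mem) auto
    have f: "f i \<in> ?S" if "i \<in> {1..int d}" for i
      using mem[OF that] w1(3) unfolding f_def by (intro unkey_bounds) auto
    have f_inj: "i = j" if ij: "i \<in> {1..int d}" "j \<in> {1..int d}" and eq: "f i = f j" for i j
    proof -
      have "w ! (nat i - 1) = w ! (nat j - 1)"
        using eq mem[OF ij(1)] mem[OF ij(2)] w1(3) unfolding f_def
        by (metis atLeastAtMost_iff signed_key_unkey subsetD)
      then have "nat i - 1 = nat j - 1"
        using nth_eq_iff_index_eq[OF w1(1), of "nat i - 1" "nat j - 1"] ij w1(2) by auto
      then show ?thesis using ij by auto
    qed
    \<comment> \<open>The transversal condition enters here: it keeps the values at positive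
      arguments apart from those at negative arguments.\<close>
    have f_opp: "f i \<noteq> - f j" if ij: "i \<in> {1..int d}" "j \<in> {1..int d}" for i j
    proof
      assume eq: "f i = - f j"
      let ?x = "w ! (nat i - 1)" and ?y = "w ! (nat j - 1)"
      have b: "1 \<le> ?x" "?x \<le> 2 * d" "1 \<le> ?y" "?y \<le> 2 * d"
        using mem[OF ij(1)] mem[OF ij(2)] w1(3) by auto
      then have "?x = 2 * d + 1 - ?y"
        using eq unfolding f_def unkey_def by (simp split: if_splits; linarith)
      then show False using w1(4)[OF mem[OF ij(2)]] mem[OF ij(1)] by simp
    qed
    have pos_neg: "i \<in> {1..int d} \<or> (i \<notin> {1..int d} \<and> - i \<in> {1..int d})" if "i \<in> ?S" for i using that by auto
    have range: "\<sigma> ` ?S \<subseteq> ?S"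
    proof
      fix y assume "y \<in> \<sigma> ` ?S"
      then obtain i where i: "i \<in> ?S" "y = \<sigma> i" by (rule imageE)
      then show "y \<in> ?S" using pos_neg[OF i(1)] f[of i] f[of "- i"] by (auto simp: \<sigma>_def)
    qed
    have inj: "inj_on \<sigma> ?S"
    proof (rule inj_onI)
      fix i j assume i: "i \<in> ?S" and j: "j \<in> ?S" and eq: "\<sigma> i = \<sigma> j"
      show "i = j"
        using pos_neg[OF i] pos_neg[OF j]
      proof (elim disjE conjE)
        assume "i \<in> {1..int d}" "j \<in> {1..int d}"
        then show ?thesis using eq f_inj by (simp add: \<sigma>_def)
      next
        assume a: "i \<in> {1..int d}" "j \<notin> {1..int d}" "- j \<in> {1..int d}"
        then have "\<sigma> i = f i" "\<sigma> j = - f (- j)" unfolding \<sigma>_def by (simp_all only: if_True if_False)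
        then show ?thesis using eq f_opp[OF a(1,3)] by (simp only:)
      next
        assume a: "j \<in> {1..int d}" "i \<notin> {1..int d}" "- i \<in> {1..int d}"
        then have "\<sigma> j = f j" "\<sigma> i = - f (- i)" unfolding \<sigma>_def by (simp_all only: if_True if_False)
        then show ?thesis using eq f_opp[OF a(1,3)] by (simp only:)
      next
        assume a: "i \<notin> {1..int d}" "- i \<in> {1..int d}" "j \<notin> {1..int d}" "- j \<in> {1..int d}"
        then have "\<sigma> i = - f (- i)" "\<sigma> j = - f (- j)" unfolding \<sigma>_def by (simp_all only: if_True if_False)
        then have "f (- i) = f (- j)" using eq by (simp only: neg_equal_iff_equal)
        then have "- i = - j" by (rule f_inj[OF a(2,4)])
        then show ?thesis by simp
      qed
    qed
    have "\<sigma> permutes ?S"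
    proof (rule bij_imp_permutes)
      show "bij_betw \<sigma> ?S ?S"
        using endo_inj_surj[OF _ range inj] inj by (simp add: bij_betw_def)
      show "\<sigma> i = i" if "i \<notin> ?S" for i using that by (auto simp: \<sigma>_def)
    qed
    moreover have "\<sigma> (- i) = - \<sigma> i" if "i \<in> ?S" for i
      using pos_neg[OF that] by (auto simp: \<sigma>_def)
    ultimately have sp: "\<sigma> \<in> signed_perms d" by (simp add: signed_perms_def)
    have word: "perm_word d \<sigma> = w"
      using w1 by (intro perm_word_eqI) (auto simp: \<sigma>_def f_def)
    have "card (neg_set d \<sigma>) \<in> K"
      using w card_big_part_perm_word[OF signed_perms_signed_inj[OF sp]] by (simp add: word signed_words_def)
    then show "w \<in> perm_word d ` ?P" using sp word by blast
  qed
qed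

text \<open>Not an instance of \<open>bij_betw_signed_perms\<close>: the extension to negative
  integers is now the identity instead of the odd one. In the absence of big keys every key is the
  letter itself.\<close>

lemma bij_betw_perms:
  "bij_betw (perm_word d) {\<sigma>. \<sigma> permutes {1..int d}} (signed_words d {0})"
  unfolding bij_betw_def
proof
  let ?P = "{\<sigma>. \<sigma> permutes {1..int d}}"
  show "inj_on (perm_word d) ?P"
  proof (rule inj_onI, rule ext)
    fix \<sigma> \<tau> i assume st: "\<sigma> \<in> ?P" "\<tau> \<in> ?P" "perm_word d \<sigma> = perm_word d \<tau>"
    then show "\<sigma> i = \<tau> i"
      using perm_word_eqD[OF perms_signed_inj(1) perms_signed_inj(1) st(3), of i]
      by (cases "i \<in> {1..int d}") (auto simp: permutes_not_in)
  qed
  show "perm_word d ` ?P = signed_words d {0}"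
  proof (intro equalityI subsetI)
    fix w assume "w \<in> perm_word d ` ?P"
    then obtain \<sigma> where s: "\<sigma> permutes {1..int d}" "w = perm_word d \<sigma>" by auto
    note si = perms_signed_inj[OF s(1)]
    show "w \<in> signed_words d {0}"
      using si s by (simp add: signed_words_def distinct_perm_word transversal_perm_word card_big_part_perm_word)
  next
    fix w assume w: "w \<in> signed_words d {0}"
    then have w1: "distinct w" "length w = d" "set w \<subseteq> {1..2 * d}" "big_part d (set w) = {}"
      by (auto simp: signed_words_def transversal_def big_part_def)
    then have small: "x \<in> {1..d}" if "x \<in> set w" for x using that by (force simp: big_part_def)
    define \<sigma> where "\<sigma> = (\<lambda>i. if i \<in> {1..int d} then int (w ! (nat i - 1)) else i)"
    have mem: "w ! (nat i - 1) \<in> {1..d}" if "i \<in> {1..int d}" for i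
      using that w1(2) by (intro small nth_mem) auto
    have range: "\<sigma> ` {1..int d} \<subseteq> {1..int d}"
    proof
      fix y assume "y \<in> \<sigma> ` {1..int d}"
      then obtain i where i: "i \<in> {1..int d}" "y = \<sigma> i" by auto
      then show "y \<in> {1..int d}" using mem[OF i(1)] by (auto simp: \<sigma>_def)
    qed
    have inj: "inj_on \<sigma> {1..int d}"
    proof (rule inj_onI)
      fix i j assume ij: "i \<in> {1..int d}" "j \<in> {1..int d}" "\<sigma> i = \<sigma> j"
      then have "w ! (nat i - 1) = w ! (nat j - 1)" by (simp add: \<sigma>_def)
      then have "nat i - 1 = nat j - 1"
        using nth_eq_iff_index_eq[OF w1(1), of "nat i - 1" "nat j - 1"] ij w1(2) by auto
      then show "i = j" using ij by auto
    qed
    have p: "\<sigma> permutes {1..int d}"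
    proof (rule bij_imp_permutes)
      show "bij_betw \<sigma> {1..int d} {1..int d}"
        using endo_inj_surj[OF _ range inj] inj by (simp add: bij_betw_def)
      show "\<sigma> i = i" if "i \<notin> {1..int d}" for i using that by (auto simp: \<sigma>_def)
    qed
    have "perm_word d \<sigma> = w"
    proof (rule perm_word_eqI)
      fix i assume "i \<in> {1..int d}"
      then show "\<sigma> i = unkey d (w ! (nat i - 1))" using mem[of i] by (simp add: \<sigma>_def unkey_def)
    qed (use w1 in auto)
    then show "w \<in> perm_word d ` ?P" using p by blast
  qed
qed

section \<open>The three types in terms of words\<close>

fun type_signs :: "weyl_type \<Rightarrow> nat set" where
  "type_signs Type_A = {0}"
| "type_signs Type_BC = UNIV"
| "type_signs Type_D = {k. even k}"

text \<open>In types BC and D this number serves both as \<open>e\<close> in \<open>big_stat\<close>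
  and as \<open>e\<close> in the locale \<open>polar_space\<close>, which is the link between
  lengths and counts of subspaces.\<close>

fun type_shift :: "weyl_type \<Rightarrow> nat" where
  "type_shift Type_A = 0"
| "type_shift Type_BC = 1"
| "type_shift Type_D = 0"

lemma weyl_group_words:
  "bij_betw (perm_word d) (weyl_group \<tau> d) (signed_words d (type_signs \<tau>))"
  using bij_betw_perms[of d] bij_betw_signed_perms[of d "type_signs \<tau>"] by (cases \<tau>) simp_all

lemma weyl_group_signed_inj: "\<sigma> \<in> weyl_group \<tau> d \<Longrightarrow> signed_inj d \<sigma>"
  using signed_perms_signed_inj perms_signed_inj by (cases \<tau>) auto

lemma weyl_length_perm_word:
  assumes "\<sigma> \<in> weyl_group \<tau> d"
  shows "weyl_length \<tau> d \<sigma> = inv_list (perm_word d \<sigma>) + big_stat (type_shift \<tau>) d (set (perm_word d \<sigma>))"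
proof -
  note si = weyl_group_signed_inj[OF assms]
  show ?thesis
    using assms perms_signed_inj(2)[of \<sigma> d] inversions_perm_word[OF si]
    by (cases \<tau>) (simp_all add: big_stat_perm_word[OF si])
qed

text \<open>The monomial of a permutation becomes a product over its signed descents, the shape to
  which \<open>prod_st_expand\<close> applies.\<close>

lemma M_tilde_words:
  assumes "d \<ge> 1"
  shows "M_tilde \<tau> q d = (\<Sum>w\<in>signed_words d (type_signs \<tau>).
     of_nat (q ^ (inv_list w + big_stat (type_shift \<tau>) d (set w))) * (\<Prod>j\<in>signed_des d w. var_s * var_t ^ j))"
  unfolding M_tilde_def
proof (subst sum.reindex_bij_betw[OF weyl_group_words, symmetric], rule sum.cong[OF refl])
  fix \<sigma> assume s: "\<sigma> \<in> weyl_group \<tau> d"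
  note si = weyl_group_signed_inj[OF s]
  have "(\<Prod>j\<in>signed_des d (perm_word d \<sigma>). var_s * var_t ^ j) = var_s ^ beta_stat d \<sigma> * var_t ^ wmaj d \<sigma>"
    using beta_stat_perm_word[OF si assms] wmaj_perm_word[OF si assms]
    by (simp add: prod.distrib power_sum)
  then show "of_nat q ^ weyl_length \<tau> d \<sigma> * var_s ^ beta_stat d \<sigma> * var_t ^ wmaj d \<sigma> =
     of_nat (q ^ (inv_list (perm_word d \<sigma>) + big_stat (type_shift \<tau>) d (set (perm_word d \<sigma>)))) *
     (\<Prod>j\<in>signed_des d (perm_word d \<sigma>). var_s * var_t ^ j)"
    by (simp add: weyl_length_perm_word[OF s] mult.assoc)
qed

subsection \<open>Subspaces of a finite vector space\<close>

lemma card_field_ge_2: "2 \<le> CARD('k::{field,finite})"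
proof -
  have "card {0, 1 :: 'k} \<le> CARD('k)" by (rule card_mono) auto
  then show ?thesis by simp
qed

text \<open>For \<open>x\<close> outside the span, the translates of the span by the multiples of
  \<open>x\<close> are pairwise disjoint, one for each scalar.\<close>

lemma card_span_insert:
  fixes U :: "('k::{field,finite} ^ 'm::finite) set"
  assumes "x \<notin> vec.span U"
  shows "card (vec.span (insert x U)) = CARD('k) * card (vec.span U)"
proof -
  let ?f = "\<lambda>(c, u). u + c *s x"
  have "vec.span (insert x U) = ?f ` (UNIV \<times> vec.span U)"
  proof (intro equalityI subsetI)
    fix y assume "y \<in> vec.span (insert x U)"
    then obtain c where "y - c *s x \<in> vec.span U" by (auto simp: vec.span_insert)
    then show "y \<in> ?f ` (UNIV \<times> vec.span U)" by (intro image_eqI[of _ _ "(c, y - c *s x)"]) auto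
  next
    fix y assume "y \<in> ?f ` (UNIV \<times> vec.span U)"
    then obtain c u where "u \<in> vec.span U" "y = u + c *s x" by auto
    then show "y \<in> vec.span (insert x U)" by (auto simp: vec.span_insert intro!: exI[of _ c])
  qed
  moreover have "inj_on ?f (UNIV \<times> vec.span U)"
  proof (rule inj_onI, clarify)
    fix c u c' u' assume u: "u \<in> vec.span U" "u' \<in> vec.span U" and eq: "u + c *s x = u' + c' *s x"
    have "(c - c') *s x = u' - u" using eq by (simp add: vec.scale_left_diff_distrib algebra_simps)
    then have in_span: "(c - c') *s x \<in> vec.span U" using u by (simp add: vec.span_diff)
    have "c = c'"
    proof (rule ccontr)
      assume "c \<noteq> c'"
      moreover have "inverse k *s (k *s x) = x" if "k \<noteq> 0" for k using that by simp
      ultimately have "inverse (c - c') *s ((c - c') *s x) = x" by (metis eq_iff_diff_eq_0)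
      then show False using in_span vec.span_scale assms by metis
    qed
    then show "c = c' \<and> u = u'" using eq by simp
  qed
  ultimately show ?thesis by (simp add: card_image card_cartesian_product)
qed

text \<open>Independence modulo \<open>U\<close>, tested along the list. The condition on an entry
  involves only its predecessors, so such lists can be counted entry by entry.\<close>

definition indep_over :: "('k::field ^ 'm) set \<Rightarrow> ('k ^ 'm) list \<Rightarrow> bool" where
  "indep_over U ws \<longleftrightarrow> (\<forall>j<length ws. ws ! j \<notin> vec.span (U \<union> set (take j ws)))"

lemma indep_over_Nil [simp]: "indep_over U []"
  by (simp add: indep_over_def)

lemma indep_over_snoc [simp]:
  "indep_over U (ws @ [w]) \<longleftrightarrow> indep_over U ws \<and> w \<notin> vec.span (U \<union> set ws)"
  unfolding indep_over_def by (auto simp: less_Suc_eq nth_append)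

lemma indep_over_append:
  "indep_over U (xs @ ys) \<longleftrightarrow> indep_over U xs \<and> indep_over (U \<union> set xs) ys"
proof (induction ys rule: rev_induct)
  case (snoc y ys)
  then show ?case
    unfolding append_assoc[symmetric] indep_over_snoc by (simp add: Un_assoc)
qed simp

lemma card_span_indep:
  fixes U :: "('k::{field,finite} ^ 'm::finite) set"
  assumes "indep_over U ws"
  shows "card (vec.span (U \<union> set ws)) = CARD('k) ^ length ws * card (vec.span U)"
  using assms
proof (induction ws rule: rev_induct)
  case (snoc w ws)
  then show ?case using card_span_insert[of w "U \<union> set ws"] by simp
qed simp

lemma basis_list_exists:
  fixes V :: "('k::{field,finite} ^ 'm::finite) set"
  assumes "vec.subspace V"
  obtains xs where "indep_over {} xs" "vec.span (set xs) = V" "length xs = vec.dim V"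
proof -
  obtain B where B: "B \<subseteq> V" "vec.independent B" "V \<subseteq> vec.span B" "card B = vec.dim V"
    using vec.basis_exists by blast
  obtain xs where xs: "set xs = B" "distinct xs"
    using finite_distinct_list[of B] by auto
  have "indep_over {} xs"
    unfolding indep_over_def
  proof (intro allI impI)
    fix j assume j: "j < length xs"
    have "set (take j xs) \<subseteq> B - {xs ! j}"
    proof
      fix x assume "x \<in> set (take j xs)"
      then obtain i where i: "i < j" "x = xs ! i" by (auto simp: in_set_conv_nth)
      then have "x \<in> set xs" "x \<noteq> xs ! j" using xs(2) j by (simp_all add: nth_eq_iff_index_eq)
      then show "x \<in> B - {xs ! j}" using xs(1) by simp
    qed
    then have "vec.span ({} \<union> set (take j xs)) \<subseteq> vec.span (B - {xs ! j})"
      by (simp add: vec.span_mono)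
    moreover have "xs ! j \<in> B" using xs j by auto
    then have "xs ! j \<notin> vec.span (B - {xs ! j})" using B(2) unfolding vec.dependent_def by blast
    ultimately show "xs ! j \<notin> vec.span ({} \<union> set (take j xs))" by blast
  qed
  moreover have "vec.span (set xs) = V"
    unfolding xs(1) using B assms by (meson equalityI vec.span_minimal)
  moreover have "length xs = vec.dim V" using B xs by (metis distinct_card)
  ultimately show ?thesis using that by blast
qed

lemma card_subspace:
  fixes V :: "('k::{field,finite} ^ 'm::finite) set"
  assumes "vec.subspace V"
  shows "card V = CARD('k) ^ vec.dim V"
proof -
  obtain xs where xs: "indep_over {} xs" "vec.span (set xs) = V" "length xs = vec.dim V"
    by (rule basis_list_exists[OF assms])
  then show ?thesis using card_span_indep[OF xs(1)] by simp
qed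

text \<open>Dimensions are read off from cardinalities: a field has at least two elements, so a
  power of its size determines the exponent.\<close>

lemma dim_eq_if_card:
  fixes V :: "('k::{field,finite} ^ 'm::finite) set"
  assumes "vec.subspace V" "card V = CARD('k) ^ n"
  shows "vec.dim V = n"
  using assms card_subspace[OF assms(1)] card_field_ge_2[where 'k = 'k] by simp

lemma card_span_list:
  fixes ws :: "('k::{field,finite} ^ 'm::finite) list"
  assumes "indep_over {} ws"
  shows "card (vec.span (set ws)) = CARD('k) ^ length ws"
  using card_span_indep[OF assms] by simp

lemma span_list_eqI:
  fixes V :: "('k::{field,finite} ^ 'm::finite) set"
  assumes "indep_over {} ws" "vec.subspace V" "set ws \<subseteq> V" "length ws = vec.dim V"
  shows "vec.span (set ws) = V"
proof (rule card_subset_eq)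
  show "vec.span (set ws) \<subseteq> V" using assms by (simp add: vec.span_minimal)
  show "card (vec.span (set ws)) = card V" by (simp only: card_span_list[OF assms(1)] card_subspace[OF assms(2)] assms(4))
qed simp

subsection \<open>Counting lists built step by step\<close>

text \<open>\<open>E\<close> gives the candidates for the next entry as a function of the prefix.
  When their number depends only on the length of the prefix, the lists are counted by a
  product.\<close>

definition step_lists :: "('a list \<Rightarrow> 'a set) \<Rightarrow> nat \<Rightarrow> 'a list set" where
  "step_lists E m = {L. length L = m \<and> (\<forall>j<m. L ! j \<in> E (take j L))}"

lemma step_lists_0 [simp]: "step_lists E 0 = {[]}"
  by (auto simp: step_lists_def)

lemma snoc_step_lists_iff: "L @ [x] \<in> step_lists E (Suc m) \<longleftrightarrow> L \<in> step_lists E m \<and> x \<in> E L"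
  by (auto simp: step_lists_def nth_append less_Suc_eq)

lemma step_lists_Suc: "step_lists E (Suc m) = (\<lambda>(L, x). L @ [x]) ` (SIGMA L:step_lists E m. E L)"
proof (intro equalityI subsetI)
  fix L assume L: "L \<in> step_lists E (Suc m)"
  then obtain L' x where eq: "L = L' @ [x]" by (cases L rule: rev_cases) (auto simp: step_lists_def)
  show "L \<in> (\<lambda>(L, x). L @ [x]) ` (SIGMA L:step_lists E m. E L)"
    using L unfolding eq snoc_step_lists_iff by (intro image_eqI[of _ _ "(L', x)"]) auto
next
  fix L assume "L \<in> (\<lambda>(L, x). L @ [x]) ` (SIGMA L:step_lists E m. E L)"
  then show "L \<in> step_lists E (Suc m)" by (auto simp: snoc_step_lists_iff)
qed

lemma finite_step_lists: "finite (step_lists E m :: 'a::finite list set)"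
  by (rule finite_subset[OF _ finite_lists_length_eq[of UNIV m]]) (auto simp: step_lists_def)

lemma card_step_lists:
  fixes E :: "'a::finite list \<Rightarrow> 'a set"
  assumes "\<And>j L. j < m \<Longrightarrow> L \<in> step_lists E j \<Longrightarrow> int (card (E L)) = n j"
  shows "int (card (step_lists E m)) = (\<Prod>j<m. n j)"
  using assms
proof (induction m)
  case (Suc m)
  have "card (step_lists E (Suc m)) = card (SIGMA L:step_lists E m. E L)"
    unfolding step_lists_Suc by (rule card_image) (auto simp: inj_on_def)
  also have "\<dots> = (\<Sum>L\<in>step_lists E m. card (E L))"
    by (rule card_SigmaI) (auto simp: finite_step_lists)
  finally have "int (card (step_lists E (Suc m))) = (\<Sum>L\<in>step_lists E m. n m)"
    using Suc.prems[of m] by (simp only: of_nat_sum lessI cong: sum.cong)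
  then show ?case using Suc by simp
qed simp

lemma card_by_fibres:
  assumes "finite X" "finite Y" "f ` X \<subseteq> Y" "\<And>y. y \<in> Y \<Longrightarrow> int (card {x \<in> X. f x = y}) = n"
  shows "int (card X) = int (card Y) * n"
proof -
  have "card X = (\<Sum>y\<in>Y. card {x \<in> X. f x = y})"
    using sum.group[OF assms(1-3), of "\<lambda>_. 1::nat"] by simp
  then show ?thesis using assms(4) by simp
qed

lemma indep_step_lists:
  fixes U :: "('k::field ^ 'm) set"
  shows "L \<in> step_lists (\<lambda>L. U - vec.span (set L)) m \<longleftrightarrow> length L = m \<and> set L \<subseteq> U \<and> indep_over {} L"
  unfolding step_lists_def indep_over_def set_conv_nth[of L] by auto

lemma card_indep_lists:
  fixes U :: "('k::{field,finite} ^ 'm::finite) set"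
  assumes "vec.subspace U"
  shows "int (card (step_lists (\<lambda>L. U - vec.span (set L)) m)) = qfall CARD('k) (vec.dim U) m"
  unfolding qfall_def
proof (rule card_step_lists)
  fix j L assume "L \<in> step_lists (\<lambda>L. U - vec.span (set L)) j"
  then have L: "length L = j" "set L \<subseteq> U" "indep_over {} L" by (auto simp: indep_step_lists)
  have sub: "vec.span (set L) \<subseteq> U" using L assms by (simp add: vec.span_minimal)
  have "card (vec.span (set L)) \<le> card U" using sub by (intro card_mono) auto
  then show "int (card (U - vec.span (set L))) = int CARD('k) ^ vec.dim U - int CARD('k) ^ j"
    using sub L by (simp add: card_Diff_subset of_nat_diff card_span_list card_subspace[OF assms])
qed

text \<open>Independent \<open>s\<close>-tuples in \<open>U\<close> are grouped by their span; the
  group of \<open>W\<close> consists of the ordered bases of \<open>W\<close>, and there are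
  \<open>qfall CARD('k) s s\<close> of them.\<close>

lemma card_subspaces:
  fixes U :: "('k::{field,finite} ^ 'm::finite) set"
  assumes "vec.subspace U"
  shows "card {W. vec.subspace W \<and> W \<subseteq> U \<and> vec.dim W = s} = qbinom CARD('k) (vec.dim U) s"
proof -
  let ?X = "step_lists (\<lambda>L. U - vec.span (set L)) s"
  let ?Y = "{W. vec.subspace W \<and> W \<subseteq> U \<and> vec.dim W = s}"
  have "int (card ?X) = int (card ?Y) * qfall CARD('k) s s"
  proof (rule card_by_fibres[where f = "\<lambda>L. vec.span (set L)"])
    show "(\<lambda>L. vec.span (set L)) ` ?X \<subseteq> ?Y"
    proof
      fix W assume "W \<in> (\<lambda>L. vec.span (set L)) ` ?X"
      then obtain L where L: "length L = s" "set L \<subseteq> U" "indep_over {} L" "W = vec.span (set L)"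
        by (auto simp: indep_step_lists)
      then have "vec.dim W = s" using card_span_list[OF L(3)] by (intro dim_eq_if_card) auto
      then show "W \<in> ?Y" using L assms by (simp add: vec.span_minimal)
    qed
    fix W assume W: "W \<in> ?Y"
    then have sW: "vec.subspace W" "W \<subseteq> U" "vec.dim W = s" by simp_all
    have "L \<in> ?X \<and> vec.span (set L) = W \<longleftrightarrow> L \<in> step_lists (\<lambda>L. W - vec.span (set L)) s" for L
    proof
      assume "L \<in> ?X \<and> vec.span (set L) = W"
      then show "L \<in> step_lists (\<lambda>L. W - vec.span (set L)) s"
        unfolding indep_step_lists using vec.span_superset[of "set L"] by blast
    next
      assume L: "L \<in> step_lists (\<lambda>L. W - vec.span (set L)) s"
      then show "L \<in> ?X \<and> vec.span (set L) = W"
        unfolding indep_step_lists using span_list_eqI[of L W] sW by auto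
    qed
    then have "{L \<in> ?X. vec.span (set L) = W} = step_lists (\<lambda>L. W - vec.span (set L)) s"
      by blast
    then show "int (card {L \<in> ?X. vec.span (set L) = W}) = qfall CARD('k) s s"
      using card_indep_lists[of W s] W by simp
  qed (simp_all add: finite_step_lists)
  then have "int (card ?Y) * qfall CARD('k) s s = int (qbinom CARD('k) (vec.dim U) s) * qfall CARD('k) s s"
    by (simp add: card_indep_lists[OF assms] qbinom_qfall)
  then show ?thesis using qfall_pos[OF card_field_ge_2[where 'k = 'k], of s s] by simp
qed

subsection \<open>Chains of subspaces with prescribed dimensions\<close>

text \<open>Only the last space is subject to \<open>T\<close>. Once it is split off, the condition
  on the rest is mere containment in it, which no longer depends on the form.\<close>

definition flag_chains :: "(('k::field ^ 'm) set \<Rightarrow> bool) \<Rightarrow> nat set \<Rightarrow> ('k ^ 'm) set list set" where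
  "flag_chains T S = {Vs. sorted_wrt (\<subset>) Vs \<and> (\<forall>V\<in>set Vs. vec.subspace V) \<and>
     (Vs \<noteq> [] \<longrightarrow> T (last Vs)) \<and> vec.dim ` set Vs = S}"

lemma dim_strict_mono:
  fixes V W :: "('k::field ^ 'm) set"
  assumes "vec.subspace V" "vec.subspace W" "V \<subset> W"
  shows "vec.dim V < vec.dim W"
  using assms vec.dim_psubset[of V W] by (simp add: vec.span_eq_iff[THEN iffD2])

text \<open>Dimensions grow strictly along a chain, and \<open>s\<close> exceeds every element of
  \<open>S\<close>, so \<open>s\<close> is the dimension of the last space.\<close>

lemma flag_chains_insert:
  assumes "\<forall>x\<in>S. x < s"
  shows "flag_chains T (insert s S) = (\<lambda>(V, Us). Us @ [V]) `
    (SIGMA V:{V. vec.subspace V \<and> T V \<and> vec.dim V = s}. flag_chains (\<lambda>W. W \<subset> V) S)" (is "_ = ?R")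
proof (intro equalityI subsetI)
  fix Vs assume Vs: "Vs \<in> flag_chains T (insert s S)"
  then have "Vs \<noteq> []" by (auto simp: flag_chains_def)
  then obtain Us V where eq: "Vs = Us @ [V]" by (cases Vs rule: rev_cases) auto
  have h: "sorted_wrt (\<subset>) Us" "\<And>W. W \<in> set Us \<Longrightarrow> W \<subset> V" "vec.subspace V"
    "\<And>W. W \<in> set Us \<Longrightarrow> vec.subspace W" "T V" "insert (vec.dim V) (vec.dim ` set Us) = insert s S"
    using Vs by (auto simp: flag_chains_def eq sorted_wrt_append)
  have lt: "vec.dim W < vec.dim V" if "W \<in> set Us" for W
    using dim_strict_mono h that by blast
  have "vec.dim V \<le> s" using h(6) assms by (metis insertCI insertE less_imp_le order_refl)
  moreover have "s \<le> vec.dim V" using h(6) lt by (metis imageE insertCI insertE less_imp_le order_refl)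
  ultimately have s: "vec.dim V = s" by simp
  have "s \<notin> S" "s \<notin> vec.dim ` set Us" using assms lt s by fastforce+
  then have "vec.dim ` set Us = S" using h(6) s by (metis insert_ident)
  then have "Us \<in> flag_chains (\<lambda>W. W \<subset> V) S" using h by (auto simp: flag_chains_def)
  then show "Vs \<in> ?R" using h s unfolding eq by (intro image_eqI[of _ _ "(V, Us)"]) auto
next
  fix Vs assume "Vs \<in> ?R"
  then obtain V Us where eq: "Vs = Us @ [V]" and h: "vec.subspace V" "T V" "vec.dim V = s"
    "Us \<in> flag_chains (\<lambda>W. W \<subset> V) S" by auto
  have "W \<subset> V" if "W \<in> set Us" for W
  proof -
    have "Us \<noteq> []" using that by auto
    then obtain Ws X where Us: "Us = Ws @ [X]" by (cases Us rule: rev_cases) auto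
    then have "X \<subset> V" "\<forall>W\<in>set Ws. W \<subset> X" using h(4) by (auto simp: flag_chains_def sorted_wrt_append)
    then show ?thesis using that unfolding Us by auto
  qed
  then show "Vs \<in> flag_chains T (insert s S)"
    using h by (auto simp: flag_chains_def eq sorted_wrt_append)
qed

lemma card_flag_chains_insert:
  fixes T :: "('k::{field,finite} ^ 'm::finite) set \<Rightarrow> bool"
  assumes "\<forall>x\<in>S. x < s"
    and "\<And>V :: ('k ^ 'm) set. vec.subspace V \<Longrightarrow> vec.dim V = s \<Longrightarrow> finite (flag_chains (\<lambda>W. W \<subset> V) S) \<and>
       card (flag_chains (\<lambda>W. W \<subset> V) S) = n"
  shows "finite (flag_chains T (insert s S)) \<and>
    card (flag_chains T (insert s S)) = card {V. vec.subspace V \<and> T V \<and> vec.dim V = s} * n"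
proof -
  let ?A = "SIGMA V:{V. vec.subspace V \<and> T V \<and> vec.dim V = s}. flag_chains (\<lambda>W. W \<subset> V) S"
  have fin: "finite ?A"
  proof (rule finite_SigmaI)
    fix V assume "V \<in> {V. vec.subspace V \<and> T V \<and> vec.dim V = s}"
    then show "finite (flag_chains (\<lambda>W. W \<subset> V) S)" using assms(2)[of V] by simp
  qed simp
  have "card (flag_chains T (insert s S)) = card ?A"
    unfolding flag_chains_insert[OF assms(1)] by (rule card_image) (auto simp: inj_on_def)
  also have "\<dots> = (\<Sum>V | vec.subspace V \<and> T V \<and> vec.dim V = s. card (flag_chains (\<lambda>W. W \<subset> V) S))"
    by (rule card_SigmaI) (simp, use assms(2) in blast)
  also have "\<dots> = card {V. vec.subspace V \<and> T V \<and> vec.dim V = s} * n"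
    using assms(2) by simp
  finally show ?thesis
    using fin flag_chains_insert[OF assms(1), of T] by simp
qed

lemma flag_chains_empty: "flag_chains T {} = {[]}"
  by (auto simp: flag_chains_def)

lemma card_flag_chains_psubset:
  fixes U :: "('k::{field,finite} ^ 'm::finite) set"
  assumes "finite S" "vec.subspace U" "S \<subseteq> {..<vec.dim U}"
  shows "finite (flag_chains (\<lambda>W. W \<subset> U) S) \<and>
    card (flag_chains (\<lambda>W. W \<subset> U) S) = qmult CARD('k) (vec.dim U) S"
  using assms
proof (induction S arbitrary: U rule: finite_linorder_max_induct)
  case empty
  then show ?case by (simp add: flag_chains_empty)
next
  case (insert s S)
  have S: "S \<subseteq> {..<s}" using insert by auto
  \<comment> \<open>Since \<open>s\<close> is smaller than the dimension of \<open>U\<close>, the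
    inclusion is automatically strict.\<close>
  have "{V. vec.subspace V \<and> V \<subset> U \<and> vec.dim V = s} = {V. vec.subspace V \<and> V \<subseteq> U \<and> vec.dim V = s}"
    using insert.prems by auto
  then have "card {V. vec.subspace V \<and> V \<subset> U \<and> vec.dim V = s} = qbinom CARD('k) (vec.dim U) s"
    using card_subspaces[OF insert.prems(1), of s] by simp
  moreover have "finite (flag_chains (\<lambda>W. W \<subset> V) S) \<and> card (flag_chains (\<lambda>W. W \<subset> V) S) = qmult CARD('k) s S"
    if "vec.subspace V" "vec.dim V = s" for V :: "('k ^ 'm) set"
    using insert.IH[OF that(1)] that(2) S by simp
  ultimately show ?case
    using card_flag_chains_insert[of S s "qmult CARD('k) s S" "\<lambda>W. W \<subset> U"] insert.hyps
    by (simp only: qmult_insert)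
qed

lemma card_flag_chains:
  fixes T :: "('k::{field,finite} ^ 'm::finite) set \<Rightarrow> bool"
  assumes "finite S" "\<forall>x\<in>S. x < s"
  shows "finite (flag_chains T (insert s S))"
    "card (flag_chains T (insert s S)) = card {V. vec.subspace V \<and> T V \<and> vec.dim V = s} * qmult CARD('k) s S"
proof -
  have "S \<subseteq> {..<s}" using assms by auto
  then show "finite (flag_chains T (insert s S))"
    "card (flag_chains T (insert s S)) = card {V. vec.subspace V \<and> T V \<and> vec.dim V = s} * qmult CARD('k) s S"
    using card_flag_chains_insert[of S s "qmult CARD('k) s S" T] card_flag_chains_psubset[OF assms(1)] assms(2)
    by auto
qed

subsection \<open>Isotropic subspaces\<close>

lemma prod_lessThan_add: "(\<Prod>j<a + k. f j) = (\<Prod>j<a. f j) * (\<Prod>j<k. f (a + j))"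
  for f :: "nat \<Rightarrow> 'a::comm_monoid_mult"
  by (induction k) (simp_all add: mult_ac)

text \<open>The case \<open>e = 1\<close> is the symplectic one, where \<open>Q\<close> is zero; for \<open>e = 0\<close>, \<open>b\<close> is the
  polarization of the quadratic form \<open>Q\<close>.\<close>

locale polar_space =
  fixes b :: "'k::{field,finite} ^ 'm::finite \<Rightarrow> 'k ^ 'm \<Rightarrow> 'k"
    and Q :: "'k ^ 'm \<Rightarrow> 'k" and e d :: nat
  assumes b_add_left: "b (x + x') y = b x y + b x' y"
    and b_scale_left: "b (c *s x) y = c * b x y"
    and b_add_right: "b x (y + y') = b x y + b x y'"
    and b_scale_right: "b x (c *s y) = c * b x y"
    and b_refl: "b x y = 0 \<Longrightarrow> b y x = 0"
    and b_nondeg: "(\<And>y. b x y = 0) \<Longrightarrow> x = 0"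
    and b_self: "Q x = 0 \<Longrightarrow> b x x = 0"
    and quad: "(e = 1 \<and> (\<forall>x. Q x = 0)) \<or>
       (e = 0 \<and> (\<forall>x y. Q (x + y) = Q x + Q y + b x y) \<and> (\<forall>c x. Q (c *s x) = c * c * Q x))"
    and card_index: "CARD('m) = 2 * d"
begin

definition isotropic :: "('k ^ 'm) set \<Rightarrow> bool" where
  "isotropic V \<longleftrightarrow> vec.subspace V \<and> (\<forall>x\<in>V. Q x = 0) \<and> (\<forall>x\<in>V. \<forall>y\<in>V. b x y = 0)"

definition perp :: "('k ^ 'm) set \<Rightarrow> ('k ^ 'm) set" where
  "perp U = {z. \<forall>u\<in>U. b u z = 0}"

section \<open>Orthogonal complements for a nondegenerate form\<close>

lemma b_zero_left [simp]: "b 0 y = 0" using b_scale_left[of 0 0 y] by simp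
lemma b_zero_right [simp]: "b x 0 = 0" using b_scale_right[of x 0 0] by simp

lemma b_minus_right: "b x (- y) = - b x y"
  using b_add_right[of x y "- y"] by (simp add: eq_neg_iff_add_eq_0 add.commute)

lemma b_diff_right: "b x (y - y') = b x y - b x y'"
  using b_add_right[of x y "- y'"] by (simp add: b_minus_right)

lemma subspace_perp: "vec.subspace (perp U)"
  by (rule vec.subspaceI) (auto simp: perp_def b_add_right b_scale_right)

lemma subspace_ortho: "vec.subspace {u. b u z = 0}"
  by (rule vec.subspaceI) (auto simp: b_add_left b_scale_left)

lemma b_span_left: "(\<And>u. u \<in> U \<Longrightarrow> b u z = 0) \<Longrightarrow> x \<in> vec.span U \<Longrightarrow> b x z = 0"
  using vec.span_minimal[OF _ subspace_ortho, of U z] by auto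

lemma perp_span [simp]: "perp (vec.span U) = perp U"
  using b_span_left vec.span_base by (fastforce simp: perp_def)

text \<open>By nondegeneracy the map sending \<open>z\<close> to its products with the unit vectors
  is injective, hence surjective on a finite space, so every functional is represented.\<close>

lemma functional_repr:
  fixes f :: "'k ^ 'm \<Rightarrow> 'k"
  assumes add: "\<And>x y. f (x + y) = f x + f y" and scale: "\<And>c x. f (c *s x) = c * f x"
  obtains z where "\<And>x. b x z = f x"
proof -
  have ind: "P x" if "vec.subspace {x. P x}" "\<And>i. P (axis i 1)" for P and x :: "'k ^ 'm"
  proof -
    have "vec.span cart_basis \<subseteq> {x. P x}"
      using that by (intro vec.span_minimal) (auto simp: cart_basis_def)
    then show ?thesis using span_cart_basis by auto
  qed
  define T where "T = (\<lambda>z. \<chi> i. b (axis i 1) z)"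
  have "inj T"
  proof (rule injI)
    fix z z' assume "T z = T z'"
    then have "b (axis i 1) (z - z') = 0" for i
      by (simp add: T_def vec_eq_iff b_diff_right)
    then have "b x (z - z') = 0" for x using ind[OF subspace_ortho] by blast
    then have "z - z' = 0" using b_nondeg b_refl by blast
    then show "z = z'" by simp
  qed
  then have "surj T" using finite_UNIV_inj_surj[of T] by simp
  then obtain z where z: "T z = (\<chi> i. f (axis i 1))" by (metis surjD)
  have f0: "f 0 = 0" using scale[of 0 0] by simp
  have "b x z = f x" for x
  proof (rule ind)
    show "vec.subspace {x. b x z = f x}"
      by (rule vec.subspaceI) (auto simp: b_add_left b_scale_left add scale f0)
    show "b (axis i 1) z = f (axis i 1)" for i
      using z by (simp add: T_def vec_eq_iff)
  qed
  then show ?thesis using that by blast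
qed

text \<open>Extending a basis gives a functional that vanishes on \<open>U\<close> but not at
  \<open>w\<close>; \<open>functional_repr\<close> turns it into a vector.\<close>

lemma perp_separates:
  assumes "w \<notin> vec.span U"
  obtains z where "z \<in> perp U" "b w z \<noteq> 0"
proof -
  obtain B where B: "B \<subseteq> vec.span U" "vec.independent B" "vec.span U \<subseteq> vec.span B"
    by (rule vec.basis_exists[of "vec.span U"])
  then have sp: "vec.span B = vec.span U" by (metis subset_antisym vec.span_minimal vec.subspace_span)
  have ind: "vec.independent (insert w B)" unfolding vec.independent_insert using B(2) assms sp by simp
  \<comment> \<open>The basis extension yields a vector-valued map sending \<open>w\<close> to a
    unit vector; its coordinate at the arbitrary index \<open>i\<close> is the functional.\<close>
  fix i :: 'm
  obtain g :: "'k ^ 'm \<Rightarrow> 'k ^ 'm" where g: "Vector_Spaces.linear (*s) (*s) g"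
    "\<forall>x\<in>insert w B. g x = (if x = w then axis i 1 else 0)"
    using vec.linear_independent_extend[OF ind, of "\<lambda>x. if x = w then axis i 1 else 0"] by blast
  interpret g: Vector_Spaces.linear "(*s)" "(*s)" g by (rule g(1))
  have "w \<notin> B" using assms sp vec.span_base by metis
  then have "g x = 0" if "x \<in> B" for x using g(2) that by auto
  then have g0: "g x = 0" if "x \<in> vec.span U" for x
    using vec.linear_eq_0_on_span[OF g(1)] that sp by blast
  obtain z where z: "\<And>x. b x z = g x $ i"
    by (rule functional_repr[of "\<lambda>x. g x $ i"]) (auto simp: g.add g.scale)
  have "z \<in> perp U" unfolding perp_def using z g0[OF vec.span_base] by simp
  moreover have "b w z \<noteq> 0" using z g(2) by (simp add: axis_def)
  ultimately show ?thesis using that by blast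
qed

text \<open>The vector \<open>z\<close> changes the value of one equation and leaves the earlier
  ones alone, so translation along it matches the solution sets for different right-hand sides. Each
  equation thus divides the number of solutions by the field size, whatever the values
  \<open>c\<close>.\<close>

lemma card_solutions:
  assumes "vec.subspace S"
    and "\<And>j. j < length ws \<Longrightarrow> \<exists>z\<in>S. (\<forall>i<j. b (ws ! i) z = 0) \<and> b (ws ! j) z \<noteq> 0"
  shows "card {x\<in>S. \<forall>i<length ws. b (ws ! i) x = c i} * CARD('k) ^ length ws = card S"
  using assms(2)
proof (induction ws rule: rev_induct)
  case (snoc w ws)
  let ?n = "length ws"
  define Y where "Y = {x\<in>S. \<forall>i<?n. b (ws ! i) x = c i}"
  have "\<exists>z\<in>S. (\<forall>i<j. b (ws ! i) z = 0) \<and> b (ws ! j) z \<noteq> 0" if "j < ?n" for j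
    using snoc.prems[of j] that by (auto simp: nth_append)
  then have Y: "card Y * CARD('k) ^ ?n = card S" unfolding Y_def by (rule snoc.IH)
  obtain z where z: "z \<in> S" "\<forall>i<?n. b (ws ! i) z = 0" "b w z \<noteq> 0"
    using snoc.prems[of ?n] by (auto simp: nth_append)
  have fibre: "card {x\<in>Y. b w x = t} = card {x\<in>Y. b w x = c ?n}" for t
  proof -
    \<comment> \<open>The multiple of \<open>z\<close> that moves the value of \<open>b w\<close>
      from \<open>t\<close> to the prescribed one.\<close>
    define l where "l = (c ?n - t) / b w z"
    have move: "x + r *s z \<in> Y" if "x \<in> Y" for x r
      using that z assms(1) by (auto simp: Y_def b_add_right b_scale_right vec.subspace_add vec.subspace_scale)
    have "bij_betw (\<lambda>x. x + l *s z) {x\<in>Y. b w x = t} {x\<in>Y. b w x = c ?n}"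
    proof (rule bij_betw_byWitness[where f' = "\<lambda>x. x + (- l) *s z"])
      show "(\<lambda>x. x + l *s z) ` {x\<in>Y. b w x = t} \<subseteq> {x\<in>Y. b w x = c ?n}"
        using move z(3) by (auto simp: b_add_right b_scale_right l_def)
      show "(\<lambda>x. x + (- l) *s z) ` {x\<in>Y. b w x = c ?n} \<subseteq> {x\<in>Y. b w x = t}"
        using move[of _ "- l"] z(3) by (auto simp: b_add_right b_scale_right b_minus_right b_diff_right l_def)
    qed auto
    then show ?thesis by (rule bij_betw_same_card)
  qed
  have "int (card Y) = int (card (UNIV :: 'k set)) * int (card {x\<in>Y. b w x = c ?n})"
  proof (rule card_by_fibres[where f = "b w"])
    show "int (card {x\<in>Y. b w x = t}) = int (card {x\<in>Y. b w x = c ?n})" for t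
      using fibre[of t] by (rule arg_cong)
  qed simp_all
  then have "card Y = CARD('k) * card {x\<in>Y. b w x = c ?n}" by (simp flip: of_nat_mult)
  moreover have "{x\<in>S. \<forall>i<length (ws @ [w]). b ((ws @ [w]) ! i) x = c i} = {x\<in>Y. b w x = c ?n}"
    by (auto simp: Y_def nth_append less_Suc_eq)
  ultimately show ?case using Y by (simp add: mult_ac)
qed simp

lemma card_perp_list:
  assumes "indep_over {} ws"
  shows "card (perp (set ws)) * CARD('k) ^ length ws = CARD('k) ^ (2 * d)"
proof -
  have "card {x\<in>UNIV. \<forall>i<length ws. b (ws ! i) x = 0} * CARD('k) ^ length ws = card (UNIV :: ('k ^ 'm) set)"
  proof (rule card_solutions)
    fix j assume "j < length ws"
    then have "ws ! j \<notin> vec.span (set (take j ws))" using assms by (simp add: indep_over_def)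
    then obtain z where z: "z \<in> perp (set (take j ws))" "b (ws ! j) z \<noteq> 0" by (rule perp_separates)
    have "b (ws ! i) z = 0" if "i < j" for i
    proof -
      have "ws ! i \<in> set (take j ws)" using that \<open>j < length ws\<close> by (auto simp: in_set_conv_nth)
      then show ?thesis using z(1) by (simp add: perp_def)
    qed
    then show "\<exists>z\<in>UNIV. (\<forall>i<j. b (ws ! i) z = 0) \<and> b (ws ! j) z \<noteq> 0" using z by blast
  qed simp
  moreover have "{x\<in>UNIV. \<forall>i<length ws. b (ws ! i) x = 0} = perp (set ws)"
    by (auto simp: perp_def set_conv_nth)
  moreover have "card (UNIV :: ('k ^ 'm) set) = CARD('k) ^ (2 * d)"
    using card_index by simp
  ultimately show ?thesis by simp
qed

lemma card_perp:
  assumes "vec.subspace U"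
  shows "card (perp U) * card U = CARD('k) ^ (2 * d)"
proof -
  obtain xs where xs: "indep_over {} xs" "vec.span (set xs) = U" "length xs = vec.dim U"
    by (rule basis_list_exists[OF assms])
  then show ?thesis using card_perp_list[OF xs(1)] perp_span[of "set xs"] card_subspace[OF assms] by simp
qed

lemma isotropic_subset_perp: "isotropic V \<Longrightarrow> V \<subseteq> perp V"
  by (auto simp: isotropic_def perp_def)

lemma isotropic_dim_le:
  assumes "isotropic V"
  shows "vec.dim V \<le> d"
proof -
  have sV: "vec.subspace V" using assms by (simp add: isotropic_def)
  have "card V * card V \<le> card (perp V) * card V"
    using isotropic_subset_perp[OF assms] by (intro mult_right_mono card_mono) auto
  then have "CARD('k) ^ (vec.dim V + vec.dim V) \<le> CARD('k) ^ (2 * d)"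
    unfolding card_perp[OF sV] power_add card_subspace[OF sV, symmetric] .
  then have "vec.dim V + vec.dim V \<le> 2 * d"
    using card_field_ge_2[where 'k = 'k] by (subst (asm) power_increasing_iff) auto
  then show ?thesis by simp
qed

lemma isotropic_subset: "isotropic V \<Longrightarrow> vec.subspace W \<Longrightarrow> W \<subseteq> V \<Longrightarrow> isotropic W"
  by (auto simp: isotropic_def)

lemma isotropic_span:
  assumes "\<And>x. x \<in> X \<Longrightarrow> Q x = 0" "\<And>x y. x \<in> X \<Longrightarrow> y \<in> X \<Longrightarrow> b x y = 0"
  shows "isotropic (vec.span X)"
proof -
  have 1: "b x y = 0" if "x \<in> vec.span X" "y \<in> X" for x y
    using b_span_left[of X y x] that assms(2) by blast
  have 2: "b x y = 0" if "x \<in> vec.span X" "y \<in> vec.span X" for x y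
    using b_span_left[of X x y] that 1 b_refl by blast
  \<comment> \<open>Membership in the span is carried through the induction, so that the polar term
    between the two summands is known to vanish.\<close>
  have "Q x = 0 \<and> x \<in> vec.span X" if "x \<in> vec.span X" for x
    using that
  proof (induction rule: vec.span_induct_alt)
    case base
    show ?case using quad by (metis mult_zero_left vec.scale_zero_left vec.span_zero)
  next
    case (step c x y)
    have "c *s x \<in> vec.span X" using step by (simp add: vec.span_base vec.span_scale)
    then have "b (c *s x) y = 0" "c *s x + y \<in> vec.span X" using 2 step vec.span_add by blast+
    then show ?case using quad step assms(1)[of x] by auto
  qed
  then show ?thesis using 2 by (auto simp: isotropic_def)
qed

text \<open>A maximal isotropic \<open>I\<close> is its own complement: a vector orthogonal to
  \<open>I\<close> can be adjoined, because in the symplectic case every vector is orthogonal to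
  itself. The dimension then follows from \<open>card_perp\<close>.\<close>

lemma lagrangian_exists:
  assumes "e = 1"
  obtains I where "isotropic I" "vec.dim I = d"
proof -
  have Q0: "Q x = 0" for x using quad assms by auto
  have "isotropic (vec.span {})" by (rule isotropic_span) auto
  then have ne: "{V. isotropic V} \<noteq> {}" by blast
  have "finite {V. isotropic V}" by simp
  then obtain I where I: "isotropic I" and max: "\<And>J. isotropic J \<Longrightarrow> I \<subseteq> J \<Longrightarrow> I = J"
    using finite_has_maximal[OF _ ne] by blast
  have sI: "vec.subspace I" using I by (simp add: isotropic_def)
  have "perp I \<subseteq> I"
  proof
    fix v assume v: "v \<in> perp I"
    have vI: "b u v = 0" "b v u = 0" if "u \<in> I" for u using v that b_refl by (auto simp: perp_def)
    have "isotropic (vec.span (insert v I))"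
      using I vI b_self[of v] Q0 by (intro isotropic_span) (auto simp: isotropic_def)
    then have "I = vec.span (insert v I)"
      using vec.span_superset[of "insert v I"] by (intro max) auto
    then show "v \<in> I" using vec.span_base[of v "insert v I"] by blast
  qed
  then have "perp I = I" using isotropic_subset_perp[OF I] by blast
  then have "CARD('k) ^ (vec.dim I + vec.dim I) = CARD('k) ^ (2 * d)"
    using card_perp[OF sI] card_subspace[OF sI] by (simp add: power_add)
  then have "vec.dim I = d" using card_field_ge_2[where 'k = 'k] by (simp add: power_inject_exp)
  then show ?thesis using that I by blast
qed

section \<open>Counting relative to a maximal isotropic subspace\<close>

context
  fixes I assumes I: "isotropic I" and dim_I: "vec.dim I = d"
begin

lemma I_facts: "vec.subspace I" "x \<in> I \<Longrightarrow> Q x = 0" "x \<in> I \<Longrightarrow> y \<in> I \<Longrightarrow> b x y = 0"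
    "card I = CARD('k) ^ d"
  using I dim_I card_subspace[of I] by (auto simp: isotropic_def)

lemma span_I [simp]: "vec.span I = I"
  using I_facts(1) by simp

lemma perp_I: "perp I = I"
proof (rule card_subset_eq[symmetric])
  show "I \<subseteq> perp I" by (rule isotropic_subset_perp[OF I])
  have "card (perp I) * CARD('k) ^ d = CARD('k) ^ d * CARD('k) ^ d"
    using card_perp[OF I_facts(1)] by (simp add: I_facts(4) mult_2 power_add)
  then show "card I = card (perp I)" by (simp add: I_facts(4))
qed simp

lemma e_le_1: "e \<le> 1"
  using quad by auto

text \<open>For \<open>x\<close> in \<open>I\<close> the term \<open>Q x\<close> vanishes, so in the
  orthogonal case the quadratic condition on \<open>v + x\<close> is an affine condition on
  \<open>x\<close>.\<close>

lemma Q_shift: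
  assumes "x \<in> I"
  shows "Q (v + x) = 0 \<longleftrightarrow> e = 1 \<or> b v x = - Q v"
  using quad I_facts(2)[OF assms] by (auto simp: eq_neg_iff_add_eq_0 add.commute)

text \<open>Translation by \<open>I\<close> preserves the vectors that are orthogonal to \<open>us\<close> and lie outside the span of
  \<open>I\<close> and \<open>vs\<close>; in each coset of \<open>I\<close> the remaining conditions are independent affine equations.\<close>

lemma card_extensions:
  assumes us: "set us \<subseteq> I" "indep_over {} us" and vs: "indep_over I vs" "length vs < d"
    and iso: "\<And>x y. x \<in> set us \<union> set vs \<Longrightarrow> y \<in> set us \<union> set vs \<Longrightarrow> b x y = 0"
  shows "int (card {v. Q v = 0 \<and> (\<forall>u\<in>set us \<union> set vs. b u v = 0) \<and> v \<notin> vec.span (I \<union> set vs)}) =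
    (int CARD('k) ^ (d - length us) - int CARD('k) ^ length vs) * int CARD('k) ^ (d - length vs - 1 + e)"
proof -
  let ?q = "CARD('k)" and ?a = "length us" and ?r = "length vs"
  define good where "good = {v. Q v = 0 \<and> (\<forall>u\<in>set us \<union> set vs. b u v = 0) \<and> v \<notin> vec.span (I \<union> set vs)}"
  define B where "B = vec.span (I \<union> set vs)"
  define Y where "Y = perp (set us) - B"
  have q0: "?q > 0" by simp
  have B_sub: "vec.subspace B" by (simp add: B_def)
  have I_B: "I \<subseteq> B" by (auto simp: B_def intro: vec.span_base)
  have B_perp: "B \<subseteq> perp (set us)"
    unfolding B_def
  proof (rule vec.span_minimal[OF _ subspace_perp])
    show "I \<union> set vs \<subseteq> perp (set us)" using us(1) iso I_facts(3) by (auto simp: perp_def)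
  qed
  have a_le: "?a \<le> d"
  proof -
    have "vec.span (set us) \<subseteq> I" using us(1) I_facts(1) by (simp add: vec.span_minimal)
    then have "card (vec.span (set us)) \<le> card I" by (intro card_mono) auto
    then have "?q ^ ?a \<le> ?q ^ d" by (simp only: card_span_list[OF us(2)] I_facts(4))
    then show ?thesis using card_field_ge_2[where 'k = 'k] by (subst (asm) power_increasing_iff) auto
  qed
  have card_A: "card (perp (set us)) = ?q ^ d * ?q ^ (d - ?a)"
  proof -
    have "card (perp (set us)) * ?q ^ ?a = (?q ^ d * ?q ^ (d - ?a)) * ?q ^ ?a"
      using card_perp_list[OF us(2)] a_le by (simp add: mult_2 mult.assoc flip: power_add)
    then show ?thesis by simp
  qed
  have card_B: "card B = ?q ^ d * ?q ^ ?r"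
    unfolding B_def using card_span_indep[OF vs(1)] by (simp add: I_facts(4))
  have "card B \<le> card (perp (set us))" using B_perp by (intro card_mono) auto
  then have card_Y: "int (card Y) = int ?q ^ d * (int ?q ^ (d - ?a) - int ?q ^ ?r)"
    unfolding Y_def using B_perp
    by (simp add: card_Diff_subset of_nat_diff card_A card_B algebra_simps)
  have shift_Y: "v + x \<in> Y \<longleftrightarrow> v \<in> Y" if "x \<in> I" for v x
  proof -
    have xB: "x \<in> B" "x \<in> perp (set us)" using that I_B B_perp by auto
    have "v + x \<in> B \<longleftrightarrow> v \<in> B" using xB(1) B_sub by (metis add_diff_cancel vec.subspace_add vec.subspace_diff)
    moreover have "v + x \<in> perp (set us) \<longleftrightarrow> v \<in> perp (set us)"
      using xB(2) by (auto simp: perp_def b_add_right)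
    ultimately show ?thesis by (simp add: Y_def)
  qed
  have good_Y: "good \<subseteq> Y" by (auto simp: good_def Y_def perp_def B_def)
  have sols: "int (card {x\<in>I. v + x \<in> good}) = int ?q ^ (d - ?r - 1 + e)" if v: "v \<in> Y" for v
  proof -
    \<comment> \<open>For \<open>e = 0\<close> the condition from \<open>Q_shift\<close> is one more
      equation, with \<open>v\<close> itself as coefficient vector. This is the origin of the
      exponent \<open>d - length vs - 1 + e\<close>.\<close>
    define ws where "ws = vs @ (if e = 0 then [v] else [])"
    define c where "c = (\<lambda>i. if i < ?r then - b (vs ! i) v else - Q v)"
    have len: "length ws = ?r + (1 - e)" using e_le_1 by (auto simp: ws_def)
    have v': "v \<notin> B" "v \<in> perp (set us)" using v by (auto simp: Y_def)
    have ind: "indep_over I ws" using vs(1) v'(1) by (auto simp: ws_def B_def)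
    have "{x\<in>I. v + x \<in> good} = {x\<in>I. \<forall>i<length ws. b (ws ! i) x = c i}"
    proof (rule Collect_cong, rule conj_cong[OF refl])
      fix x assume x: "x \<in> I"
      have 1: "b u (v + x) = 0" if "u \<in> set us" for u
        using v'(2) that us(1) x I_facts(3) by (auto simp: perp_def b_add_right)
      have 2: "v + x \<notin> vec.span (I \<union> set vs)" using shift_Y[OF x] v by (auto simp: Y_def B_def)
      have 3: "(\<forall>u\<in>set vs. b u (v + x) = 0) \<longleftrightarrow> (\<forall>i<?r. b (vs ! i) x = - b (vs ! i) v)"
        by (auto simp: set_conv_nth b_add_right eq_neg_iff_add_eq_0 add.commute)
      have 4: "(\<forall>i<length ws. b (ws ! i) x = c i) \<longleftrightarrow>
          (\<forall>i<?r. b (vs ! i) x = - b (vs ! i) v) \<and> (e = 1 \<or> b v x = - Q v)"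
      proof (cases "e = 0")
        case True
        then show ?thesis by (auto simp: ws_def c_def nth_append less_Suc_eq)
      next
        case False
        then have "e = 1" using e_le_1 by simp
        then show ?thesis by (auto simp: ws_def c_def)
      qed
      show "v + x \<in> good \<longleftrightarrow> (\<forall>i<length ws. b (ws ! i) x = c i)"
        unfolding 4 good_def using 1 2 3 Q_shift[OF x, of v] by auto
    qed
    moreover have "card {x\<in>I. \<forall>i<length ws. b (ws ! i) x = c i} * ?q ^ length ws = card I"
    proof (rule card_solutions[OF I_facts(1)])
      fix j assume j: "j < length ws"
      then have "ws ! j \<notin> vec.span (I \<union> set (take j ws))" using ind by (simp add: indep_over_def)
      then obtain z where z: "z \<in> perp (I \<union> set (take j ws))" "b (ws ! j) z \<noteq> 0" by (rule perp_separates)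
      \<comment> \<open>The separating vector is orthogonal to \<open>I\<close>, hence lies in
        \<open>I\<close>; the equations are therefore independent already on
        \<open>I\<close>.\<close>
      have "z \<in> perp I" using z(1) by (simp add: perp_def)
      then have "z \<in> I" by (simp add: perp_I)
      moreover have "b (ws ! i) z = 0" if "i < j" for i
      proof -
        have "ws ! i \<in> set (take j ws)" using that j by (auto simp: in_set_conv_nth)
        then show ?thesis using z(1) by (simp add: perp_def)
      qed
      ultimately show "\<exists>z\<in>I. (\<forall>i<j. b (ws ! i) z = 0) \<and> b (ws ! j) z \<noteq> 0" using z by blast
    qed
    ultimately have "card {x\<in>I. v + x \<in> good} * ?q ^ (?r + (1 - e)) = ?q ^ d"
      by (simp add: len I_facts(4))
    also have "\<dots> = ?q ^ (d - ?r - 1 + e) * ?q ^ (?r + (1 - e))"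
      unfolding power_add[symmetric] using vs(2) e_le_1 by (intro arg_cong[where f = "\<lambda>n. ?q ^ n"]) auto
    finally have "card {x\<in>I. v + x \<in> good} = ?q ^ (d - ?r - 1 + e)" by simp
    then show ?thesis by simp
  qed
  have cols: "card {v\<in>Y. v + x \<in> good} = card good" if x: "x \<in> I" for x
  proof -
    have "v - x \<in> Y" if "v \<in> good" for v
      using shift_Y[OF x, of "v - x"] good_Y that by auto
    then have "bij_betw (\<lambda>v. v + x) {v\<in>Y. v + x \<in> good} good"
      by (intro bij_betw_byWitness[where f' = "\<lambda>v. v - x"]) auto
    then show ?thesis by (rule bij_betw_same_card)
  qed
  \<comment> \<open>Pairs of \<open>v\<close> in \<open>Y\<close> and \<open>x\<close> in
    \<open>I\<close> with \<open>v + x\<close> in \<open>good\<close> are counted in two ways.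
    Translation by \<open>x\<close> permutes \<open>Y\<close>, so every \<open>x\<close> sees all of
    \<open>good\<close>.\<close>
  have "int (card Y) * int ?q ^ (d - ?r - 1 + e) = (\<Sum>v\<in>Y. int (card {x\<in>I. v + x \<in> good}))"
    using sols by simp
  also have "\<dots> = (\<Sum>v\<in>Y. \<Sum>x\<in>I. of_bool (v + x \<in> good))" by (simp add: Int_def)
  also have "\<dots> = (\<Sum>x\<in>I. \<Sum>v\<in>Y. of_bool (v + x \<in> good))" by (rule sum.swap)
  also have "\<dots> = (\<Sum>x\<in>I. int (card {v\<in>Y. v + x \<in> good}))" by (simp add: Int_def)
  also have "\<dots> = int ?q ^ d * int (card good)" using cols by (simp add: I_facts(4))
  finally have "int ?q ^ d * int (card good) =
     int ?q ^ d * ((int ?q ^ (d - ?a) - int ?q ^ ?r) * int ?q ^ (d - ?r - 1 + e))"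
    unfolding card_Y by simp
  then show ?thesis unfolding good_def[symmetric] using q0 by simp
qed

text \<open>Read from the end of \<open>vs\<close>, each coefficient vanishes: otherwise its vector
  would lie in the span of \<open>I\<close> and the preceding ones.\<close>

lemma span_inter_I:
  assumes "set us \<subseteq> I" "indep_over I vs" "z \<in> vec.span (set us \<union> set vs)" "z \<in> I"
  shows "z \<in> vec.span (set us)"
  using assms(2,3)
proof (induction vs rule: rev_induct)
  case (snoc v vs)
  then obtain c where c: "z - c *s v \<in> vec.span (set us \<union> set vs)"
    by (auto simp: vec.span_insert)
  have "c = 0"
  proof (rule ccontr)
    assume c0: "c \<noteq> 0"
    have "set us \<union> set vs \<subseteq> I \<union> set vs" using assms(1) by auto
    then have "z - c *s v \<in> vec.span (I \<union> set vs)" using c vec.span_mono by blast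
    moreover have "z \<in> vec.span (I \<union> set vs)" using assms(4) by (simp add: vec.span_base)
    ultimately have "z - (z - c *s v) \<in> vec.span (I \<union> set vs)" by (rule vec.span_diff[rotated])
    then have "c *s v \<in> vec.span (I \<union> set vs)" by simp
    from vec.span_scale[OF this, of "inverse c"] show False using c0 snoc.prems(1) by simp
  qed
  then show ?case using c snoc by simp
qed simp

text \<open>A list built this way is a basis of an isotropic subspace whose first \<open>a\<close> entries are a basis of
  the intersection with \<open>I\<close>.\<close>

definition adapted_step :: "nat \<Rightarrow> ('k ^ 'm) list \<Rightarrow> ('k ^ 'm) set" where
  "adapted_step a L = (if length L < a then I - vec.span (set L)
     else {v. Q v = 0 \<and> (\<forall>u\<in>set L. b u v = 0) \<and> v \<notin> vec.span (I \<union> set L)})"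

lemma adapted_lists:
  assumes "L \<in> step_lists (adapted_step a) j"
  shows "set (take a L) \<subseteq> I \<and> indep_over {} L \<and> indep_over I (drop a L) \<and>
    (\<forall>x\<in>set L. Q x = 0 \<and> (\<forall>y\<in>set L. b x y = 0))"
  using assms
proof (induction j arbitrary: L)
  case (Suc j)
  then obtain L' x where L: "L = L' @ [x]" "L' \<in> step_lists (adapted_step a) j" "x \<in> adapted_step a L'"
    unfolding step_lists_Suc by auto
  note IH = Suc.IH[OF L(2)]
  have len: "length L' = j" using L(2) by (simp add: step_lists_def)
  show ?case
  proof (cases "j < a")
    case True
    then have x: "x \<in> I" "x \<notin> vec.span (set L')" using L(3) len by (auto simp: adapted_step_def)
    moreover have "set L' \<subseteq> I" using IH True len by simp
    ultimately show ?thesis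
      using IH True len I_facts by (auto simp: L(1))
  next
    case False
    then have x: "Q x = 0" "\<forall>u\<in>set L'. b u x = 0" "x \<notin> vec.span (I \<union> set L')"
      using L(3) len by (auto simp: adapted_step_def)
    have "vec.span (set L') \<subseteq> vec.span (I \<union> set L')" "vec.span (I \<union> set (drop a L')) \<subseteq> vec.span (I \<union> set L')"
      using set_drop_subset[of a L'] by (intro vec.span_mono; auto)+
    then show ?thesis
      using IH False len x b_refl b_self[OF x(1)] by (auto simp: L(1))
  qed
qed simp

text \<open>The first \<open>a\<close> choices are independent vectors of \<open>I\<close>; each
  later one is counted by \<open>card_extensions\<close>, with \<open>j - a\<close> earlier vectors
  outside \<open>I\<close>.\<close>

lemma card_adapted_lists:
  assumes "a + k \<le> d"
  shows "int (card (step_lists (adapted_step a) (a + k))) =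
    qfall CARD('k) d a * qfall CARD('k) (d - a) k * int CARD('k) ^ (\<Sum>j<k. d - j - 1 + e)"
proof -
  let ?q = "int CARD('k)"
  let ?n = "\<lambda>j. if j < a then ?q ^ d - ?q ^ j else (?q ^ (d - a) - ?q ^ (j - a)) * ?q ^ (d - (j - a) - 1 + e)"
  have "int (card (step_lists (adapted_step a) (a + k))) = (\<Prod>j<a + k. ?n j)"
  proof (rule card_step_lists)
    fix j L assume j: "j < a + k" and L: "L \<in> step_lists (adapted_step a) j"
    note inv = adapted_lists[OF L]
    have len: "length L = j" using L by (simp add: step_lists_def)
    show "int (card (adapted_step a L)) = ?n j"
    proof (cases "j < a")
      case True
      then have "vec.span (set L) \<subseteq> I" using inv len I_facts(1) by (simp add: vec.span_minimal)
      moreover from this have "card (vec.span (set L)) \<le> card I" by (intro card_mono) auto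
      ultimately show ?thesis
        using True len inv
        by (simp add: adapted_step_def card_Diff_subset of_nat_diff card_span_list I_facts(4))
    next
      case False
      define us vs where "us = take a L" and "vs = drop a L"
      have uv: "L = us @ vs" "length us = a" "length vs = j - a" using False len by (auto simp: us_def vs_def)
      have us: "set us \<subseteq> I" "indep_over {} us" and vs: "indep_over I vs"
        using inv by (auto simp: us_def vs_def) (metis append_take_drop_id indep_over_append)
      have "I \<union> set L = I \<union> set vs" using us(1) by (auto simp: uv(1))
      then have "adapted_step a L =
         {v. Q v = 0 \<and> (\<forall>u\<in>set us \<union> set vs. b u v = 0) \<and> v \<notin> vec.span (I \<union> set vs)}"
        using False len by (auto simp: adapted_step_def uv(1))
      moreover have "length vs < d" using uv j False assms by simp
      moreover have "b x y = 0" if "x \<in> set us \<union> set vs" "y \<in> set us \<union> set vs" for x y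
        using inv that by (simp add: uv(1))
      ultimately show ?thesis
        using card_extensions[OF us vs] False by (simp add: uv)
    qed
  qed
  also have "\<dots> = (\<Prod>j<a. ?n j) * (\<Prod>j<k. ?n (a + j))"
    by (rule prod_lessThan_add)
  also have "\<dots> = qfall CARD('k) d a * (\<Prod>j<k. (?q ^ (d - a) - ?q ^ j) * ?q ^ (d - j - 1 + e))"
    by (simp add: qfall_def)
  finally show ?thesis by (simp add: prod.distrib qfall_def power_sum mult.assoc)
qed

lemma adapted_span:
  assumes "L \<in> step_lists (adapted_step a) (a + k)"
  shows "isotropic (vec.span (set L))" "vec.dim (vec.span (set L)) = a + k"
    "vec.dim (vec.span (set L) \<inter> I) = a"
proof -
  note inv = adapted_lists[OF assms]
  have len: "length L = a + k" using assms by (simp add: step_lists_def)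
  show "isotropic (vec.span (set L))" using inv by (intro isotropic_span) auto
  show "vec.dim (vec.span (set L)) = a + k"
    using card_span_list[of L] inv len by (intro dim_eq_if_card) auto
  define us vs where "us = take a L" and "vs = drop a L"
  have uv: "L = us @ vs" "length us = a" using len by (auto simp: us_def vs_def)
  have us: "set us \<subseteq> I" "indep_over {} us" and vs: "indep_over I vs"
    using inv by (auto simp: us_def vs_def) (metis append_take_drop_id indep_over_append)
  have "vec.span (set L) \<inter> I = vec.span (set us)"
  proof
    show "vec.span (set L) \<inter> I \<subseteq> vec.span (set us)"
      using span_inter_I[OF us(1) vs] by (auto simp: uv(1))
    have "vec.span (set us) \<subseteq> vec.span (set L)" by (rule vec.span_mono) (auto simp: uv(1))
    then show "vec.span (set us) \<subseteq> vec.span (set L) \<inter> I"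
      using us(1) I_facts(1) by (simp add: vec.span_minimal)
  qed
  then show "vec.dim (vec.span (set L) \<inter> I) = a"
    using card_span_list[OF us(2)] uv(2) dim_eq_if_card[OF vec.subspace_span, of "set us" a] by simp
qed

text \<open>Describes the fibres of the span map in terms of \<open>V\<close> alone. The conditions
  on \<open>Q\<close> and \<open>b\<close> hold throughout the isotropic space \<open>V\<close>, so
  only independence remains to be counted.\<close>

lemma adapted_fibre:
  assumes V: "isotropic V" "vec.dim V = a + k" "vec.dim (V \<inter> I) = a"
  shows "{L \<in> step_lists (adapted_step a) (a + k). vec.span (set L) = V} =
    step_lists (\<lambda>L. (if length L < a then V \<inter> I else V) - vec.span (set L)) (a + k)" (is "?X = ?Y")
proof (intro equalityI subsetI)
  fix L assume "L \<in> ?X"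
  then have L: "length L = a + k" "\<And>j. j < a + k \<Longrightarrow> L ! j \<in> adapted_step a (take j L)" "vec.span (set L) = V"
    by (auto simp: step_lists_def)
  have "L ! j \<in> (if length (take j L) < a then V \<inter> I else V) - vec.span (set (take j L))" if j: "j < a + k" for j
  proof -
    have "L ! j \<in> V" using L j by (metis nth_mem vec.span_base)
    moreover have "vec.span (set (take j L)) \<subseteq> vec.span (I \<union> set (take j L))" by (rule vec.span_mono) auto
    ultimately show ?thesis using L(1) L(2)[OF j] j by (auto simp: adapted_step_def split: if_splits)
  qed
  then show "L \<in> ?Y" using L(1) by (simp add: step_lists_def)
next
  fix L assume "L \<in> ?Y"
  then have L: "length L = a + k"
    "\<And>j. j < a + k \<Longrightarrow> L ! j \<in> (if j < a then V \<inter> I else V) - vec.span (set (take j L))"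
    by (auto simp: step_lists_def)
  have sV: "vec.subspace V" "vec.subspace (V \<inter> I)"
    using V(1) I_facts(1) by (auto simp: isotropic_def vec.subspace_inter)
  have LV: "set L \<subseteq> V"
  proof
    fix x assume "x \<in> set L"
    then obtain j where "j < a + k" "x = L ! j" using L(1) by (auto simp: in_set_conv_nth)
    then show "x \<in> V" using L(2)[of j] by (auto split: if_splits)
  qed
  have ind: "indep_over {} L" using L by (auto simp: indep_over_def)
  have span_L: "vec.span (set L) = V" using ind sV LV L(1) V(2) by (intro span_list_eqI) auto
  have usI: "set (take a L) \<subseteq> V \<inter> I"
  proof
    fix x assume "x \<in> set (take a L)"
    then obtain j where "j < a" "x = L ! j" using L(1) by (auto simp: in_set_conv_nth)
    then show "x \<in> V \<inter> I" using L(2)[of j] by auto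
  qed
  have "indep_over {} (take a L)" using ind by (metis append_take_drop_id indep_over_append)
  then have span_us: "vec.span (set (take a L)) = V \<inter> I"
    using usI sV V(3) L(1) by (intro span_list_eqI) auto
  have "L ! j \<in> adapted_step a (take j L)" if j: "j < a + k" for j
  proof (cases "j < a")
    case True
    then show ?thesis using L(1) L(2)[OF j] by (auto simp: adapted_step_def)
  next
    case False
    have Lj: "L ! j \<in> V" "L ! j \<notin> vec.span (set (take j L))" using L(2)[OF j] False by auto
    have tV: "set (take j L) \<subseteq> V" using LV set_take_subset by fastforce
    \<comment> \<open>If the entry were a sum of a vector of \<open>I\<close> and one from the span
      of its predecessors, the first summand would lie in \<open>V \<inter> I\<close>, which the
      first \<open>a\<close> entries span; the entry would then depend on its predecessors.\<close>
    have "L ! j \<notin> vec.span (I \<union> set (take j L))"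
    proof
      assume "L ! j \<in> vec.span (I \<union> set (take j L))"
      then obtain x y where xy: "x \<in> I" "y \<in> vec.span (set (take j L))" "L ! j = x + y"
        unfolding vec.span_Un by auto
      have "y \<in> V" using xy(2) tV sV(1) vec.span_minimal by blast
      then have "x \<in> V" using Lj(1) xy(3) sV(1) by (metis add_diff_cancel_right' vec.subspace_diff)
      then have "x \<in> vec.span (set (take a L))" using xy(1) span_us by simp
      moreover have "set (take a L) \<subseteq> set (take j L)"
        using False by (intro set_take_subset_set_take) simp
      ultimately have "x \<in> vec.span (set (take j L))" using vec.span_mono by blast
      then show False using xy Lj(2) vec.span_add by metis
    qed
    then show ?thesis
      using False L(1) j V(1) Lj(1) tV by (auto simp: adapted_step_def isotropic_def subset_iff)
  qed
  then show "L \<in> ?X" using L(1) span_L by (simp add: step_lists_def)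
qed

text \<open>The last \<open>k\<close> entries complete a basis of \<open>V\<close> from one of
  \<open>V \<inter> I\<close>. The factor with exponent \<open>a * k\<close> comes from pulling
  \<open>q ^ a\<close> out of each difference \<open>q ^ (a + k) - q ^ (a + j)\<close>.\<close>

lemma card_fibre:
  assumes V: "isotropic V" "vec.dim V = a + k" "vec.dim (V \<inter> I) = a"
  shows "int (card (step_lists (\<lambda>L. (if length L < a then V \<inter> I else V) - vec.span (set L)) (a + k))) =
    qfall CARD('k) a a * (int CARD('k) ^ (a * k) * qfall CARD('k) k k)"
proof -
  let ?q = "int CARD('k)"
  let ?E = "\<lambda>L. (if length L < a then V \<inter> I else V) - vec.span (set L)"
  let ?n = "\<lambda>j. ?q ^ (if j < a then a else a + k) - ?q ^ j"
  have sV: "vec.subspace V" "vec.subspace (V \<inter> I)"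
    using V(1) I_facts(1) by (auto simp: isotropic_def vec.subspace_inter)
  have "int (card (step_lists ?E (a + k))) = (\<Prod>j<a + k. ?n j)"
  proof (rule card_step_lists)
    fix j L assume L: "L \<in> step_lists ?E j"
    define W where "W = (if j < a then V \<inter> I else V)"
    have sW: "vec.subspace W" "card W = CARD('k) ^ (if j < a then a else a + k)"
      using sV V card_subspace by (auto simp: W_def)
    have len: "length L = j" and el: "\<And>i. i < j \<Longrightarrow> L ! i \<in> (if i < a then V \<inter> I else V) - vec.span (set (take i L))"
      using L by (auto simp: step_lists_def)
    have "set L \<subseteq> W"
    proof
      fix x assume "x \<in> set L"
      then obtain i where "i < j" "x = L ! i" using len by (auto simp: in_set_conv_nth)
      then show "x \<in> W" using el[of i] by (auto simp: W_def split: if_splits)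
    qed
    then have sub: "vec.span (set L) \<subseteq> W" using sW by (simp add: vec.span_minimal)
    then have le: "card (vec.span (set L)) \<le> card W" by (intro card_mono) auto
    have "indep_over {} L" using len el by (auto simp: indep_over_def)
    note cs = card_span_list[OF this]
    have "?E L = W - vec.span (set L)" by (simp add: W_def len)
    then show "int (card (?E L)) = ?n j"
      using sub le unfolding cs sW(2) len by (simp add: card_Diff_subset of_nat_diff cs[unfolded len] sW(2))
  qed
  also have "\<dots> = (\<Prod>j<a. ?n j) * (\<Prod>j<k. ?n (a + j))"
    by (rule prod_lessThan_add)
  also have "\<dots> = qfall CARD('k) a a * (\<Prod>j<k. ?q ^ a * (?q ^ k - ?q ^ j))"
    by (simp add: qfall_def power_add right_diff_distrib)
  finally show ?thesis by (simp add: prod.distrib qfall_def power_mult)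
qed

text \<open>Adapted lists are counted in total and for each space. The quotient takes the form of
  \<open>iso_count\<close> once \<open>qbinom_mult\<close> has exchanged the order of the two
  choices.\<close>

lemma card_isotropic:
  assumes "k \<le> m" "m \<le> d"
  shows "card {V. isotropic V \<and> vec.dim V = m \<and> vec.dim (V \<inter> I) = m - k} = iso_count CARD('k) e d m k"
proof -
  define a where "a = m - k"
  have m: "m = a + k" "a + k \<le> d" using assms by (auto simp: a_def)
  let ?q = "CARD('k)"
  let ?V = "{V. isotropic V \<and> vec.dim V = m \<and> vec.dim (V \<inter> I) = a}"
  let ?D = "qfall ?q a a * (int ?q ^ (a * k) * qfall ?q k k)"
  have "int (card (step_lists (adapted_step a) (a + k))) = int (card ?V) * ?D"
  proof (rule card_by_fibres[where f = "\<lambda>L. vec.span (set L)"])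
    show "(\<lambda>L. vec.span (set L)) ` step_lists (adapted_step a) (a + k) \<subseteq> ?V"
      using adapted_span[of _ a k] by (auto simp: m(1))
    show "int (card {L \<in> step_lists (adapted_step a) (a + k). vec.span (set L) = V}) = ?D" if "V \<in> ?V" for V
      using that adapted_fibre[of V a k] card_fibre[of V a k] by (simp add: m(1))
  qed (simp_all add: finite_step_lists)
  then have "int (card ?V) * ?D = qfall ?q d a * qfall ?q (d - a) k * int ?q ^ (\<Sum>j<k. d - j - 1 + e)"
    using card_adapted_lists[OF m(2)] by simp
  \<comment> \<open>Writing \<open>d - j - 1\<close> as \<open>(d - m) + a + (k - Suc j)\<close>
    separates the exponent of \<open>iso_count\<close> from \<open>a * k\<close>; the latter is
    absorbed when \<open>qfall_add\<close> merges the two falling products.\<close>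
  also have "(\<Sum>j<k. d - j - 1 + e) = (k * (d - m) + k * (k - 1) div 2 + e * k) + a * k"
  proof -
    have "(\<Sum>j<k. d - j - 1 + e) = (\<Sum>j<k. (d - m) + a + e + (k - Suc j))"
      using m by (intro sum.cong refl) auto
    also have "\<dots> = k * (d - m) + k * a + k * e + (\<Sum>j<k. k - Suc j)"
      by (simp only: sum.distrib sum_constant card_lessThan) (simp add: algebra_simps)
    also have "(\<Sum>j<k. k - Suc j) = (\<Sum>j<k. j)" by (rule sum.nat_diff_reindex)
    also have "(\<Sum>j<k. j) = k * (k - 1) div 2" using Sum_Ico_nat[of 0 k] by (simp add: lessThan_atLeast0)
    finally show ?thesis by (simp add: algebra_simps)
  qed
  also have "qfall ?q d a * qfall ?q (d - a) k * int ?q ^ (k * (d - m) + k * (k - 1) div 2 + e * k + a * k) =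
     int ?q ^ (k * (d - m) + k * (k - 1) div 2 + e * k) * qfall ?q d (k + a)"
    using m(2) qfall_add[of a d ?q k] by (simp add: power_add mult_ac add.commute)
  also have "\<dots> = int ?q ^ (k * (d - m) + k * (k - 1) div 2 + e * k) *
     (int (qbinom ?q d k * qbinom ?q (d - k) a) * qfall ?q k k * qfall ?q a a * int ?q ^ (k * a))"
    using m(2) qbinom_mult[OF card_field_ge_2[where 'k = 'k], of k a d] by (simp add: add.commute)
  also have "\<dots> = int (iso_count ?q e d m k) * ?D"
    by (simp add: iso_count_def m(1) mult_ac)
  finally have "int (card ?V) * ?D = int (iso_count ?q e d m k) * ?D" .
  moreover have "?D \<noteq> 0"
    using qfall_pos[OF card_field_ge_2[where 'k = 'k]] by (simp add: less_imp_neq[symmetric] neq_iff)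
  ultimately show ?thesis unfolding a_def by simp
qed

end

end

subsection \<open>Generating series\<close>

text \<open>The series \<open>s t^j / (1 - s t^j)\<close> expanded in powers of \<open>s\<close>.
  The exponent \<open>n\<close> is the weight of a space of dimension \<open>j\<close>; the zero at
  \<open>n = 0\<close> reflects that weights are positive.\<close>

definition geom :: "nat \<Rightarrow> rat fps fps" where
  "geom j = Abs_fps (\<lambda>n. if n = 0 then 0 else fps_X ^ (j * n))"

lemma st_eq: "var_s * var_t ^ j = fps_X * fps_const (fps_X ^ j)"
  by (simp add: var_s_def var_t_def fps_const_power)

lemma one_minus_st_mult: "(1 - var_s * var_t ^ j) * (1 + geom j) = 1"
proof (rule fps_ext)
  fix n
  have "fps_nth ((1 - var_s * var_t ^ j) * (1 + geom j)) n =
     fps_nth (1 + geom j) n - fps_nth (fps_X * (fps_const (fps_X ^ j) * (1 + geom j))) n"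
    by (simp only: st_eq left_diff_distrib fps_sub_nth mult_1_left mult.assoc)
  also have "\<dots> = fps_nth 1 n"
    by (cases n) (auto simp: geom_def power_add mult.commute)
  finally show "fps_nth ((1 - var_s * var_t ^ j) * (1 + geom j)) n = fps_nth 1 n" .
qed

text \<open>The coefficients are power series in t and do not form a field. The inverse exists
  because the constant coefficient is 1, and is then identified through the product with
  \<open>1 + geom j\<close>.\<close>

lemma inverse_one_minus_st: "inverse (1 - var_s * var_t ^ j) = 1 + geom j"
proof -
  let ?f = "1 - var_s * var_t ^ j"
  have f0: "fps_nth ?f 0 = 1" by (simp add: st_eq)
  have "inverse ?f = fps_right_inverse ?f (inverse (fps_nth ?f 0))" by (rule fps_inverse_def)
  then have "inverse ?f = fps_right_inverse ?f 1" by (simp only: f0 fps_inverse_one)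
  moreover have "fps_nth ?f 0 * 1 = 1" using f0 by simp
  ultimately have "?f * inverse ?f = 1" using fps_right_inverse by metis
  then have "inverse ?f = (?f * (1 + geom j)) * inverse ?f" by (simp add: one_minus_st_mult)
  also have "\<dots> = (?f * inverse ?f) * (1 + geom j)" by (simp only: mult_ac)
  finally show ?thesis using \<open>?f * inverse ?f = 1\<close> by simp
qed

lemma st_mult_inverse: "var_s * var_t ^ j * (1 + geom j) = geom j"
  using one_minus_st_mult[of j] by (simp add: algebra_simps)

lemma monomial_nth: "fps_nth (var_s ^ a * var_t ^ w) n = (if n = a then fps_X ^ w else 0)"
  by (simp add: var_s_def var_t_def fps_const_power)

definition pos_comps :: "nat \<Rightarrow> nat \<Rightarrow> nat list set" where
  "pos_comps k n = {ws. length ws = k \<and> (\<forall>w\<in>set ws. 0 < w) \<and> sum_list ws = n}"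

lemma finite_pos_comps: "finite (pos_comps k n)"
proof (rule finite_subset[OF _ finite_lists_length_eq[of "{..n}" k]])
  show "pos_comps k n \<subseteq> {xs. set xs \<subseteq> {..n} \<and> length xs = k}"
    by (auto simp: pos_comps_def member_le_sum_list)
qed simp

lemma pos_comps_Suc:
  "pos_comps (Suc k) n = (\<lambda>(w, ws). w # ws) ` (SIGMA w:{1..n}. pos_comps k (n - w))"
proof (intro equalityI subsetI)
  fix x assume x: "x \<in> pos_comps (Suc k) n"
  then obtain w ws where "x = w # ws" by (cases x) (auto simp: pos_comps_def)
  then show "x \<in> (\<lambda>(w, ws). w # ws) ` (SIGMA w:{1..n}. pos_comps k (n - w))"
    using x by (intro image_eqI[of _ _ "(w, ws)"]) (auto simp: pos_comps_def)
qed (auto simp: pos_comps_def)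

text \<open>With \<open>js\<close> the dimensions in a flag, the coefficient at \<open>n\<close>
  runs over the weights of total \<open>n\<close>, and the exponent of t is the resulting weight of
  the flag.\<close>

lemma prod_geom_nth:
  "fps_nth (prod_list (map geom js)) n = (\<Sum>ws\<in>pos_comps (length js) n. fps_X ^ sum_list (map2 (*) ws js))"
proof (induction js arbitrary: n)
  case Nil
  have "pos_comps 0 n = (if n = 0 then {[]} else {})" by (auto simp: pos_comps_def)
  then show ?case by simp
next
  case (Cons j js)
  have "fps_nth (prod_list (map geom (j # js))) n = (\<Sum>w=0..n. fps_nth (geom j) w * fps_nth (prod_list (map geom js)) (n - w))"
    by (simp add: fps_mult_nth)
  also have "\<dots> = (\<Sum>w=1..n. fps_nth (geom j) w * fps_nth (prod_list (map geom js)) (n - w))"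
    by (rule sum.mono_neutral_right) (auto simp: geom_def)
  also have "\<dots> = (\<Sum>w=1..n. \<Sum>ws\<in>pos_comps (length js) (n - w). fps_X ^ sum_list (map2 (*) (w # ws) (j # js)))"
    by (intro sum.cong refl) (auto simp: Cons geom_def sum_distrib_left power_add mult.commute)
  also have "\<dots> = (\<Sum>(w, ws)\<in>(SIGMA w:{1..n}. pos_comps (length js) (n - w)). fps_X ^ sum_list (map2 (*) (w # ws) (j # js)))"
    by (rule sum.Sigma) (auto simp: finite_pos_comps)
  also have "\<dots> = (\<Sum>ws\<in>pos_comps (length (j # js)) n. fps_X ^ sum_list (map2 (*) ws (j # js)))"
    unfolding length_Cons pos_comps_Suc
    by (subst sum.reindex) (auto simp: inj_on_def case_prod_unfold intro!: sum.cong)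
  finally show ?case .
qed

lemma flag_weight_conv:
  assumes "length ws = length Vs"
  shows "flag_weight (Vs, ws) = sum_list (map2 (*) ws (map vec.dim Vs))"
  using assms by (simp add: flag_weight_def sum_list_sum_nth atLeast0LessThan)

lemma flag_alpha_conv: "length ws = length Vs \<Longrightarrow> flag_alpha (Vs, ws) = sum_list ws"
  by (simp add: flag_alpha_def sum_list_sum_nth atLeast0LessThan)

text \<open>Only the finite set \<open>X\<close> of weighted flags with \<alpha> equal to
  \<open>n\<close> affects the coefficient of \<open>s ^ n\<close>, so every finite partial sum that
  contains \<open>X\<close> already has the limiting coefficient.\<close>

lemma weighted_has_sum:
  fixes Fs :: "('k::field ^ 'm) set list set"
  assumes "finite Fs"
  shows "((\<lambda>F. var_s ^ flag_alpha F * var_t ^ flag_weight F) has_sum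
    (\<Sum>Vs\<in>Fs. prod_list (map geom (map vec.dim Vs)))) (weighted Fs)"
  unfolding has_sum_def tendsto_fps_iff
proof
  fix n
  let ?f = "\<lambda>F :: ('k ^ 'm) set list \<times> nat list. var_s ^ flag_alpha F * var_t ^ flag_weight F"
  define X where "X = (SIGMA Vs:Fs. pos_comps (length Vs) n)"
  have X: "X = {F \<in> weighted Fs. flag_alpha F = n}"
    by (auto simp: X_def weighted_def pos_comps_def flag_alpha_conv)
  have fin: "finite X" unfolding X_def using assms finite_pos_comps by blast
  have val: "(\<Sum>F\<in>X. fps_X ^ flag_weight F) = fps_nth (\<Sum>Vs\<in>Fs. prod_list (map geom (map vec.dim Vs))) n"
  proof -
    have "(\<Sum>F\<in>X. fps_X ^ flag_weight F) = (\<Sum>Vs\<in>Fs. \<Sum>ws\<in>pos_comps (length Vs) n. fps_X ^ flag_weight (Vs, ws))"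
      unfolding X_def using assms finite_pos_comps by (subst sum.Sigma) (auto simp: case_prod_unfold)
    also have "\<dots> = (\<Sum>Vs\<in>Fs. fps_nth (prod_list (map geom (map vec.dim Vs))) n)"
      unfolding prod_geom_nth
      by (intro sum.cong refl) (auto simp: pos_comps_def flag_weight_conv)
    finally show ?thesis by (simp add: fps_sum_nth)
  qed
  have eq: "fps_nth (sum ?f Y) n = fps_nth (\<Sum>Vs\<in>Fs. prod_list (map geom (map vec.dim Vs))) n"
    if Y: "finite Y" "X \<subseteq> Y" "Y \<subseteq> weighted Fs" for Y
  proof -
    have "fps_nth (sum ?f Y) n = (\<Sum>F\<in>Y. if n = flag_alpha F then fps_X ^ flag_weight F else 0)"
      by (simp add: fps_sum_nth monomial_nth)
    also have "\<dots> = (\<Sum>F\<in>X. if n = flag_alpha F then fps_X ^ flag_weight F else 0)"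
      using Y X by (intro sum.mono_neutral_right) auto
    also have "\<dots> = (\<Sum>F\<in>X. fps_X ^ flag_weight F)"
      using X by (intro sum.cong) auto
    finally show ?thesis using val by simp
  qed
  show "\<forall>\<^sub>F Y in finite_subsets_at_top (weighted Fs). fps_nth (sum ?f Y) n =
     fps_nth (\<Sum>Vs\<in>Fs. prod_list (map geom (map vec.dim Vs))) n"
    unfolding eventually_finite_subsets_at_top
    using fin X eq by (intro exI[of _ X]) auto
qed

section \<open>Flags with a condition on the top space\<close>

definition top_flags :: "(('k::field ^ 'm) set \<Rightarrow> bool) \<Rightarrow> ('k ^ 'm) set list set" where
  "top_flags T = {Vs. sorted_wrt (\<subset>) Vs \<and> (\<forall>V\<in>set Vs. vec.subspace V \<and> V \<noteq> {0}) \<and> (Vs \<noteq> [] \<longrightarrow> T (last Vs))}"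

lemma dim_pos_iff:
  fixes V :: "('k::field ^ 'm) set"
  assumes "vec.subspace V"
  shows "1 \<le> vec.dim V \<longleftrightarrow> V \<noteq> {0}"
proof -
  have "vec.dim V = 0 \<longleftrightarrow> V \<subseteq> {0}" by (rule vec.dim_eq_0)
  also have "\<dots> \<longleftrightarrow> V = {0}" using vec.subspace_0[OF assms] by auto
  finally have "vec.dim V = 0 \<longleftrightarrow> V = {0}" .
  moreover have "1 \<le> n \<longleftrightarrow> n \<noteq> 0" for n :: nat by auto
  ultimately show ?thesis by (simp only:)
qed

lemma sorted_dims:
  fixes Vs :: "('k::field ^ 'm) set list"
  assumes "sorted_wrt (\<subset>) Vs" "\<forall>V\<in>set Vs. vec.subspace V"
  shows "sorted_wrt (<) (map vec.dim Vs)"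
  unfolding sorted_wrt_map
  by (rule sorted_wrt_mono_rel[OF _ assms(1)]) (use assms(2) dim_strict_mono in blast)

lemma top_flags_UN:
  fixes T :: "('k::field ^ 'm) set \<Rightarrow> bool"
  assumes "\<And>V. T V \<Longrightarrow> vec.dim V \<le> d"
  shows "top_flags T = (\<Union>S\<in>Pow {1..d}. flag_chains T S)"
proof (intro equalityI subsetI)
  fix Vs assume Vs: "Vs \<in> top_flags T"
  then have h: "sorted_wrt (\<subset>) Vs" "\<forall>V\<in>set Vs. vec.subspace V \<and> V \<noteq> {0}" "Vs \<noteq> [] \<Longrightarrow> T (last Vs)"
    by (auto simp: top_flags_def)
  have "vec.dim V \<in> {1..d}" if V: "V \<in> set Vs" for V
  proof -
    have ne: "Vs \<noteq> []" using V by auto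
    then obtain Us W where eq: "Vs = Us @ [W]" by (cases Vs rule: rev_cases) auto
    have "V \<subseteq> W" using V h(1) by (auto simp: eq sorted_wrt_append)
    then have "vec.dim V \<le> vec.dim W" by (rule vec.dim_subset)
    moreover have "vec.dim W \<le> d" using assms h(3) ne by (simp add: eq)
    ultimately show ?thesis using dim_pos_iff[of V] h(2) V by auto
  qed
  then have "vec.dim ` set Vs \<in> Pow {1..d}" by auto
  moreover have "Vs \<in> flag_chains T (vec.dim ` set Vs)" using h by (auto simp: flag_chains_def)
  ultimately show "Vs \<in> (\<Union>S\<in>Pow {1..d}. flag_chains T S)" by blast
next
  fix Vs assume "Vs \<in> (\<Union>S\<in>Pow {1..d}. flag_chains T S)"
  then obtain S where S: "S \<subseteq> {1..d}" "Vs \<in> flag_chains T S" by auto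
  have "V \<noteq> {0}" if "V \<in> set Vs" for V
  proof -
    have "vec.dim V \<in> S" "vec.subspace V" using S(2) that by (auto simp: flag_chains_def)
    then show ?thesis using S(1) dim_pos_iff[of V] by auto
  qed
  then show "Vs \<in> top_flags T" using S(2) by (auto simp: flag_chains_def top_flags_def)
qed

lemma flag_chains_prod:
  assumes "Vs \<in> flag_chains T S"
  shows "prod_list (map geom (map vec.dim Vs)) = (\<Prod>j\<in>S. geom j)"
proof -
  have "sorted_wrt (<) (map vec.dim Vs)" using assms by (intro sorted_dims) (auto simp: flag_chains_def)
  then have "distinct (map vec.dim Vs)" by (simp add: strict_sorted_iff)
  moreover have "set (map vec.dim Vs) = S" using assms by (auto simp: flag_chains_def)
  ultimately show ?thesis by (metis prod.distinct_set_conv_list)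
qed

lemma finite_flag_chains:
  fixes T :: "('k::{field,finite} ^ 'm::finite) set \<Rightarrow> bool"
  assumes "finite S"
  shows "finite (flag_chains T S)"
proof (cases "S = {}")
  case False
  then have "S = insert (Max S) (S - {Max S})" using Max_in[OF assms] by auto
  moreover have "\<forall>x\<in>S - {Max S}. x < Max S" using assms by (auto simp: less_le)
  ultimately show ?thesis using card_flag_chains(1)[of "S - {Max S}" "Max S" T] assms by simp
qed (simp add: flag_chains_empty)

lemma sum_top_flags:
  fixes T :: "('k::{field,finite} ^ 'm::finite) set \<Rightarrow> bool"
  assumes "\<And>V. T V \<Longrightarrow> vec.dim V \<le> d"
  shows "finite (top_flags T)"
    "(\<Sum>Vs\<in>top_flags T. prod_list (map geom (map vec.dim Vs))) =
     (\<Sum>S\<in>Pow {1..d}. of_nat (card (flag_chains T S)) * (\<Prod>j\<in>S. geom j))"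
proof -
  have fin: "finite (flag_chains T S)" if "S \<in> Pow {1..d}" for S
    using that finite_subset by (intro finite_flag_chains) auto
  have UN: "top_flags T = (\<Union>S\<in>Pow {1..d}. flag_chains T S)" by (rule top_flags_UN) (rule assms)
  show "finite (top_flags T)" unfolding UN by (rule finite_UN_I[OF _ fin]) simp_all
  have "(\<Sum>Vs\<in>top_flags T. prod_list (map geom (map vec.dim Vs))) =
     (\<Sum>S\<in>Pow {1..d}. \<Sum>Vs\<in>flag_chains T S. prod_list (map geom (map vec.dim Vs)))"
    unfolding UN
  proof (rule sum.UNION_disjoint)
    show "\<forall>S\<in>Pow {1..d}. \<forall>S'\<in>Pow {1..d}. S \<noteq> S' \<longrightarrow> flag_chains T S \<inter> flag_chains T S' = {}"
      by (auto simp: flag_chains_def)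
  qed (use fin in auto)
  also have "\<dots> = (\<Sum>S\<in>Pow {1..d}. of_nat (card (flag_chains T S)) * (\<Prod>j\<in>S. geom j))"
  proof (rule sum.cong[OF refl])
    fix S
    have "(\<Sum>Vs\<in>flag_chains T S. prod_list (map geom (map vec.dim Vs))) = (\<Sum>Vs\<in>flag_chains T S. \<Prod>j\<in>S. geom j)"
      by (intro sum.cong refl flag_chains_prod)
    then show "(\<Sum>Vs\<in>flag_chains T S. prod_list (map geom (map vec.dim Vs))) =
       of_nat (card (flag_chains T S)) * (\<Prod>j\<in>S. geom j)" by simp
  qed
  finally show "(\<Sum>Vs\<in>top_flags T. prod_list (map geom (map vec.dim Vs))) =
     (\<Sum>S\<in>Pow {1..d}. of_nat (card (flag_chains T S)) * (\<Prod>j\<in>S. geom j))" .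
qed

lemma signed_des_subset:
  assumes "w \<in> signed_words d K" "d \<ge> 1"
  shows "signed_des d w \<subseteq> {1..d}"
  using assms by (auto simp: signed_des_def signed_words_def des_list_def)

text \<open>A factor with \<open>j\<close> in \<open>D\<close> becomes \<open>geom j\<close>, one
  with \<open>j\<close> outside \<open>D\<close> becomes \<open>1 + geom j\<close>; expanding the
  latter runs through all \<open>S\<close> between \<open>D\<close> and
  \<open>{1..d}\<close>.\<close>

lemma prod_st_expand:
  assumes "D \<subseteq> {1..d}"
  shows "(\<Prod>j\<in>D. var_s * var_t ^ j) * (\<Prod>j=1..d. inverse (1 - var_s * var_t ^ j)) =
    (\<Sum>S\<in>{S \<in> Pow {1..d}. D \<subseteq> S}. \<Prod>j\<in>S. geom j)"
proof -
  let ?R = "{1..d} - D"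
  have finD: "finite D" using assms finite_subset by auto
  have "(\<Prod>j=1..d. inverse (1 - var_s * var_t ^ j)) = (\<Prod>j\<in>D. 1 + geom j) * (\<Prod>j\<in>?R. 1 + geom j)"
    by (simp only: inverse_one_minus_st prod.subset_diff[OF assms finite_atLeastAtMost] mult.commute)
  then have "(\<Prod>j\<in>D. var_s * var_t ^ j) * (\<Prod>j=1..d. inverse (1 - var_s * var_t ^ j)) =
     (\<Prod>j\<in>D. var_s * var_t ^ j * (1 + geom j)) * (\<Prod>j\<in>?R. geom j + 1)"
    by (simp add: prod.distrib mult_ac add.commute)
  also have "(\<Prod>j\<in>?R. geom j + 1) = (\<Sum>X\<in>Pow ?R. \<Prod>j\<in>X. geom j)"
    by (subst prod_add) auto
  also have "(\<Prod>j\<in>D. var_s * var_t ^ j * (1 + geom j)) = (\<Prod>j\<in>D. geom j)"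
    by (simp only: st_mult_inverse)
  also have "(\<Prod>j\<in>D. geom j) * (\<Sum>X\<in>Pow ?R. \<Prod>j\<in>X. geom j) = (\<Sum>X\<in>Pow ?R. \<Prod>j\<in>D \<union> X. geom j)"
    unfolding sum_distrib_left
  proof (rule sum.cong[OF refl])
    fix X assume X: "X \<in> Pow ?R"
    then have "finite X" "D \<inter> X = {}" using finite_subset by auto
    then show "(\<Prod>j\<in>D. geom j) * (\<Prod>j\<in>X. geom j) = (\<Prod>j\<in>D \<union> X. geom j)"
      using finD by (simp add: prod.union_disjoint)
  qed
  also have "\<dots> = (\<Sum>S\<in>{S \<in> Pow {1..d}. D \<subseteq> S}. \<Prod>j\<in>S. geom j)"
  proof (rule sum.reindex_bij_witness[where i = "\<lambda>S. S - D" and j = "\<lambda>X. D \<union> X"])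
  qed (use assms in auto)
  finally show ?thesis .
qed

lemma flags_has_sum:
  fixes T :: "('k::{field,finite} ^ 'm::finite) set \<Rightarrow> bool"
  assumes d: "d \<ge> 1" and T: "\<And>V. T V \<Longrightarrow> vec.dim V \<le> d"
    and count: "\<And>m. 1 \<le> m \<Longrightarrow> m \<le> d \<Longrightarrow> card {V. vec.subspace V \<and> T V \<and> vec.dim V = m} =
      (\<Sum>k | k \<in> type_signs \<tau> \<and> k \<le> m. iso_count CARD('k) (type_shift \<tau>) d m k)"
  shows "((\<lambda>F. var_s ^ flag_alpha F * var_t ^ flag_weight F) has_sum
     M_tilde \<tau> CARD('k) d * (\<Prod>j=1..d. inverse (1 - var_s * var_t ^ j))) (weighted (top_flags T))"
proof -
  let ?W = "signed_words d (type_signs \<tau>)"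
  let ?c = "\<lambda>w. CARD('k) ^ (inv_list w + big_stat (type_shift \<tau>) d (set w))"
  have chains: "card (flag_chains T S) = (\<Sum>w | w \<in> ?W \<and> signed_des d w \<subseteq> S. ?c w)" if S: "S \<subseteq> {1..d}" for S
  proof (cases "S = {}")
    case True
    \<comment> \<open>The empty set has no maximum; it is covered by \<open>m = 0\<close>, as
      position 0 is never a signed descent.\<close>
    have "{w. w \<in> ?W \<and> signed_des d w \<subseteq> {}} = {w. w \<in> ?W \<and> signed_des d w \<subseteq> insert 0 {}}"
      using signed_des_subset[OF _ d] by fastforce
    moreover have "{k. k \<in> type_signs \<tau> \<and> k \<le> 0} = {0}" by (cases \<tau>) auto
    ultimately have "(\<Sum>w | w \<in> ?W \<and> signed_des d w \<subseteq> {}. ?c w) = iso_count CARD('k) (type_shift \<tau>) d 0 0"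
      using sum_signed_words[where S = "{}" and m = 0 and d = d and K = "type_signs \<tau>" and q = "CARD('k)" and e = "type_shift \<tau>"] by simp
    then show ?thesis by (simp add: True flag_chains_empty iso_count_def)
  next
    case False
    define m S' where "m = Max S" and "S' = S - {m}"
    have fin: "finite S" using S finite_subset by auto
    have m: "m \<in> S" "S = insert m S'" "finite S'" using Max_in[OF fin False] fin by (auto simp: m_def S'_def)
    have lt: "\<forall>x\<in>S'. x < m" using fin by (auto simp: m_def S'_def less_le)
    have md: "1 \<le> m" "m \<le> d" using m(1) S by auto
    have "S' \<subseteq> {..<m}" using lt by auto
    then show ?thesis
      using card_flag_chains(2)[OF m(3) lt, of T] count[OF md]
        sum_signed_words[OF m(3) _ md(2), where K = "type_signs \<tau>" and q = "CARD('k)" and e = "type_shift \<tau>"]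
      by (simp add: m(2)[symmetric])
  qed
  have "M_tilde \<tau> CARD('k) d * (\<Prod>j=1..d. inverse (1 - var_s * var_t ^ j)) =
    (\<Sum>w\<in>?W. of_nat (?c w) * ((\<Prod>j\<in>signed_des d w. var_s * var_t ^ j) * (\<Prod>j=1..d. inverse (1 - var_s * var_t ^ j))))"
    unfolding M_tilde_words[OF d] sum_distrib_right by (simp only: mult.assoc)
  also have "\<dots> = (\<Sum>w\<in>?W. \<Sum>S\<in>{S \<in> Pow {1..d}. signed_des d w \<subseteq> S}. of_nat (?c w) * (\<Prod>j\<in>S. geom j))"
    by (intro sum.cong refl) (simp only: prod_st_expand[OF signed_des_subset[OF _ d]] sum_distrib_left)
  \<comment> \<open>The exchange collects for each \<open>S\<close> the words with signed descents
    in \<open>S\<close>; by \<open>chains\<close> their weighted number is a number of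
    flags.\<close>
  also have "\<dots> = (\<Sum>S\<in>Pow {1..d}. \<Sum>w\<in>{w \<in> ?W. signed_des d w \<subseteq> S}. of_nat (?c w) * (\<Prod>j\<in>S. geom j))"
    by (rule sum.swap_restrict) (auto simp: finite_signed_words)
  also have "\<dots> = (\<Sum>S\<in>Pow {1..d}. of_nat (card (flag_chains T S)) * (\<Prod>j\<in>S. geom j))"
    by (intro sum.cong refl) (simp add: chains sum_distrib_right)
  also have "\<dots> = (\<Sum>Vs\<in>top_flags T. prod_list (map geom (map vec.dim Vs)))"
    using sum_top_flags(2)[of T d] T by simp
  finally show ?thesis
    using weighted_has_sum[OF sum_top_flags(1)[of T d]] T by simp
qed

lemma flags_A_eq: "(flags_A :: ('k::field ^ 'n) set list set) = top_flags (\<lambda>_. True)"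
proof -
  have "sorted_wrt (\<lambda>V W. V \<subseteq> W \<and> vec.dim V < vec.dim W) Vs \<longleftrightarrow> sorted_wrt (\<subset>) Vs"
    if sub: "\<forall>V\<in>set Vs. vec.subspace V" for Vs :: "('k ^ 'n) set list"
  proof
    assume "sorted_wrt (\<lambda>V W. V \<subseteq> W \<and> vec.dim V < vec.dim W) Vs"
    then show "sorted_wrt (\<subset>) Vs" by (rule sorted_wrt_mono_rel[rotated]) auto
  next
    assume "sorted_wrt (\<subset>) Vs"
    then show "sorted_wrt (\<lambda>V W. V \<subseteq> W \<and> vec.dim V < vec.dim W) Vs"
      by (rule sorted_wrt_mono_rel[rotated]) (use sub dim_strict_mono in blast)
  qed
  moreover have "0 < vec.dim V \<and> vec.dim V \<le> CARD('n) \<longleftrightarrow> V \<noteq> {0}" if "vec.subspace V" for V :: "('k ^ 'n) set"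
    using dim_pos_iff[OF that] dim_subset_UNIV_cart_gen[of V] by auto
  ultimately show ?thesis unfolding flags_A_def top_flags_def by blast
qed

section \<open>Flags in polar spaces\<close>

context polar_space
begin

lemma card_isotropic_signs:
  assumes I: "isotropic I" "vec.dim I = d" and "m \<le> d"
  shows "card {V. vec.subspace V \<and> (isotropic V \<and> vec.dim V - vec.dim (V \<inter> I) \<in> K) \<and> vec.dim V = m} =
    (\<Sum>k | k \<in> K \<and> k \<le> m. iso_count CARD('k) e d m k)"
proof -
  let ?A = "\<lambda>k. {V. isotropic V \<and> vec.dim V = m \<and> vec.dim (V \<inter> I) = m - k}"
  have "{V. vec.subspace V \<and> (isotropic V \<and> vec.dim V - vec.dim (V \<inter> I) \<in> K) \<and> vec.dim V = m} =
     (\<Union>k\<in>{k. k \<in> K \<and> k \<le> m}. ?A k)" (is "?L = ?R")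
  proof (intro equalityI subsetI)
    fix V assume V: "V \<in> ?L"
    then have "vec.dim (V \<inter> I) \<le> m" using vec.dim_subset[of "V \<inter> I" V] by auto
    then show "V \<in> ?R" using V by (auto intro!: exI[of _ "m - vec.dim (V \<inter> I)"])
  qed (auto simp: isotropic_def)
  then have "card {V. vec.subspace V \<and> (isotropic V \<and> vec.dim V - vec.dim (V \<inter> I) \<in> K) \<and> vec.dim V = m} =
     (\<Sum>k | k \<in> K \<and> k \<le> m. card (?A k))"
    by (simp only:) (rule card_UN_disjoint, auto)
  also have "\<dots> = (\<Sum>k | k \<in> K \<and> k \<le> m. iso_count CARD('k) e d m k)"
    by (intro sum.cong refl card_isotropic[OF I]) (use assms(3) in auto)
  finally show ?thesis .
qed

lemma isotropic_flags_has_sum: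
  assumes I: "isotropic I" "vec.dim I = d" and "d \<ge> 1" "e = type_shift \<tau>"
  shows "((\<lambda>F. var_s ^ flag_alpha F * var_t ^ flag_weight F) has_sum
     M_tilde \<tau> CARD('k) d * (\<Prod>j=1..d. inverse (1 - var_s * var_t ^ j)))
     (weighted (top_flags (\<lambda>V. isotropic V \<and> vec.dim V - vec.dim (V \<inter> I) \<in> type_signs \<tau>)))"
  using card_isotropic_signs[OF I] isotropic_dim_le assms(3,4) by (intro flags_has_sum) auto

lemma isotropic_last_imp:
  assumes "sorted_wrt (\<subset>) Vs" "\<forall>V\<in>set Vs. vec.subspace V" "isotropic (last Vs)" "V \<in> set Vs"
  shows "isotropic V"
proof -
  obtain Us W where eq: "Vs = Us @ [W]" using assms(4) by (cases Vs rule: rev_cases) auto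
  have VW: "V \<subseteq> W" using assms(1,4) by (auto simp: eq sorted_wrt_append)
  have W: "isotropic W" using assms(3) by (simp add: eq)
  have "vec.subspace V" using assms(2,4) by blast
  then show ?thesis by (rule isotropic_subset[OF W _ VW])
qed

text \<open>Isotropy is inherited by subspaces, so imposing it on the last space imposes it on all
  of them.\<close>

lemma top_flags_isotropic:
  "top_flags (\<lambda>V. isotropic V \<and> P V) = {Vs. (\<forall>V\<in>set Vs. isotropic V \<and> V \<noteq> {0}) \<and> sorted_wrt (\<subset>) Vs \<and>
     (Vs \<noteq> [] \<longrightarrow> P (last Vs))}" (is "?L = ?R")
proof (intro equalityI subsetI)
  fix Vs assume Vs: "Vs \<in> ?L"
  have "isotropic V" if V: "V \<in> set Vs" for V
  proof (rule isotropic_last_imp[OF _ _ _ V])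
    show "sorted_wrt (\<subset>) Vs" "\<forall>V\<in>set Vs. vec.subspace V" "isotropic (last Vs)"
      using Vs V unfolding top_flags_def by (blast, blast, fastforce)
  qed
  then show "Vs \<in> ?R" using Vs unfolding top_flags_def by blast
next
  fix Vs assume Vs: "Vs \<in> ?R"
  have "isotropic (last Vs)" if "Vs \<noteq> []" using Vs last_in_set[OF that] by blast
  moreover have "vec.subspace V" if "V \<in> set Vs" for V using Vs that by (simp add: isotropic_def)
  ultimately show "Vs \<in> ?L" using Vs by (simp add: top_flags_def)
qed

end

section \<open>The symplectic form and the hyperbolic form\<close>

lemma symplectic_polar_space:
  fixes \<omega> :: "'k::{field,finite} ^ 'm::finite \<Rightarrow> 'k ^ 'm \<Rightarrow> 'k"
  assumes \<omega>: "symplectic_form \<omega>" and card: "CARD('m) = 2 * d"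
  shows "polar_space \<omega> (\<lambda>_. 0) 1 d"
proof -
  have lin: "Vector_Spaces.linear (*s) (*) (\<lambda>y. \<omega> x y)" "Vector_Spaces.linear (*s) (*) (\<lambda>x. \<omega> x y)" for x y
    using \<omega> by (auto simp: symplectic_form_def)
  interpret r: Vector_Spaces.linear "(*s)" "(*)" "\<lambda>y. \<omega> x y" for x by (rule lin(1))
  interpret l: Vector_Spaces.linear "(*s)" "(*)" "\<lambda>x. \<omega> x y" for y by (rule lin(2))
  have self: "\<omega> x x = 0" and nondeg: "(\<And>y. \<omega> x y = 0) \<Longrightarrow> x = 0" for x
    using \<omega> by (auto simp: symplectic_form_def)
  have anti: "\<omega> y x = - \<omega> x y" for x y
  proof -
    have "\<omega> (x + y) (x + y) = (\<omega> x x + \<omega> y x) + (\<omega> x y + \<omega> y y)"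
      by (simp only: l.add r.add)
    then have "\<omega> y x + \<omega> x y = 0" unfolding self by simp
    then show ?thesis by (simp only: eq_neg_iff_add_eq_0)
  qed
  show ?thesis
  proof
    fix x y x' y' :: "'k ^ 'm" and c :: 'k
    show "\<omega> (x + x') y = \<omega> x y + \<omega> x' y" "\<omega> x (y + y') = \<omega> x y + \<omega> x y'"
      "\<omega> (c *s x) y = c * \<omega> x y" "\<omega> x (c *s y) = c * \<omega> x y"
      by (rule l.add r.add l.scale r.scale)+
    show "\<omega> y x = 0" if "\<omega> x y = 0" using anti[of y x] that by simp
  qed (use self nondeg card in auto)
qed

text \<open>The polarization of \<open>hyp_form\<close>; on the diagonal it is twice the quadratic
  form.\<close>

definition hyp_bilinear :: "'k::field ^ ('n::finite \<times> 2) \<Rightarrow> 'k ^ ('n \<times> 2) \<Rightarrow> 'k" where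
  "hyp_bilinear x y = (\<Sum>i\<in>UNIV. x $ (i, 1) * y $ (i, 2) + x $ (i, 2) * y $ (i, 1))"

lemma hyp_form_add: "hyp_form (x + y) = hyp_form x + hyp_form y + hyp_bilinear x y"
  by (simp add: hyp_form_def hyp_bilinear_def sum.distrib[symmetric] algebra_simps)

lemma hyp_form_scale: "hyp_form (c *s x) = c * c * hyp_form x"
  by (simp add: hyp_form_def sum_distrib_left algebra_simps)

text \<open>Pairing with a unit vector picks out the partner coordinate in the same hyperbolic
  plane.\<close>

lemma hyp_bilinear_nondeg:
  fixes x :: "'k::field ^ ('n::finite \<times> 2)"
  assumes "\<And>y. hyp_bilinear x y = 0"
  shows "x = 0"
proof -
  have "hyp_bilinear x (axis (i, 1) 1) = x $ (i, 2)" for i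
  proof -
    have "hyp_bilinear x (axis (i, 1) 1) = (\<Sum>j\<in>UNIV. if j = i then x $ (j, 2) else 0)"
      unfolding hyp_bilinear_def by (intro sum.cong) (auto simp: axis_def)
    then show ?thesis by simp
  qed
  moreover have "hyp_bilinear x (axis (i, 2) 1) = x $ (i, 1)" for i
  proof -
    have "hyp_bilinear x (axis (i, 2) 1) = (\<Sum>j\<in>UNIV. if j = i then x $ (j, 1) else 0)"
      unfolding hyp_bilinear_def by (intro sum.cong) (auto simp: axis_def)
    then show ?thesis by simp
  qed
  ultimately have "x $ (i, 1) = 0" "x $ (i, 2) = 0" for i using assms by metis+
  then have "x $ (i, j) = 0" for i j using exhaust_2[of j] by auto
  then show ?thesis by (simp add: vec_eq_iff split_paired_all)
qed

lemma hyp_polar_space: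
  assumes "CARD('n::finite) = d"
  shows "polar_space (hyp_bilinear :: 'k::{field,finite} ^ ('n \<times> 2) \<Rightarrow> _) hyp_form 0 d"
proof
  fix x y x' y' :: "'k ^ ('n \<times> 2)" and c :: 'k
  show "hyp_bilinear (x + x') y = hyp_bilinear x y + hyp_bilinear x' y"
    by (simp add: hyp_bilinear_def sum.distrib[symmetric] algebra_simps)
  show "hyp_bilinear x (y + y') = hyp_bilinear x y + hyp_bilinear x y'"
    by (simp add: hyp_bilinear_def sum.distrib[symmetric] algebra_simps)
  show "hyp_bilinear (c *s x) y = c * hyp_bilinear x y"
    by (simp add: hyp_bilinear_def sum_distrib_left algebra_simps)
  show "hyp_bilinear x (c *s y) = c * hyp_bilinear x y"
    by (simp add: hyp_bilinear_def sum_distrib_left algebra_simps)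
  show "hyp_bilinear y x = 0" if "hyp_bilinear x y = 0"
    using that by (simp add: hyp_bilinear_def algebra_simps)
  show "hyp_bilinear x x = 0" if "hyp_form x = 0"
  proof -
    have "hyp_bilinear x x = hyp_form x + hyp_form x"
      by (simp add: hyp_bilinear_def hyp_form_def sum.distrib[symmetric] algebra_simps)
    then show ?thesis using that by simp
  qed
qed (use assms hyp_bilinear_nondeg in \<open>auto simp: hyp_form_add hyp_form_scale\<close>)

theorem theorem19p1:
  fixes q d :: nat
  assumes q: "CARD('k::{field,finite}) = q" and "odd q"
    and d: "CARD('n::finite) = d"
  shows
    "((\<lambda>F. var_s ^ flag_alpha F * var_t ^ flag_weight F) has_sum
        M_tilde Type_A q d * (\<Prod>j=1..d. inverse (1 - var_s * var_t ^ j)))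
       (weighted (flags_A :: ('k ^ 'n) set list set)) \<and>
     (\<forall>\<omega> :: 'k ^ ('n \<times> 2) \<Rightarrow> 'k ^ ('n \<times> 2) \<Rightarrow> 'k. symplectic_form \<omega> \<longrightarrow>
       ((\<lambda>F. var_s ^ flag_alpha F * var_t ^ flag_weight F) has_sum
          M_tilde Type_BC q d * (\<Prod>j=1..d. inverse (1 - var_s * var_t ^ j)))
         (weighted (flags_BC \<omega>))) \<and>
     (\<forall>I :: ('k ^ ('n \<times> 2)) set. totally_isotropic I \<and> vec.dim I = d \<longrightarrow>
       ((\<lambda>F. var_s ^ flag_alpha F * var_t ^ flag_weight F) has_sum
          M_tilde Type_D q d * (\<Prod>j=1..d. inverse (1 - var_s * var_t ^ j)))
         (weighted (even_flags_D I)))"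
proof (intro conjI allI impI)
  have d1: "d \<ge> 1" using d by (metis One_nat_def Suc_leI zero_less_card_finite)
  show "((\<lambda>F. var_s ^ flag_alpha F * var_t ^ flag_weight F) has_sum
        M_tilde Type_A q d * (\<Prod>j=1..d. inverse (1 - var_s * var_t ^ j)))
       (weighted (flags_A :: ('k ^ 'n) set list set))"
    unfolding flags_A_eq q[symmetric]
  proof (rule flags_has_sum[OF d1])
    show "vec.dim V \<le> d" for V :: "('k ^ 'n) set"
      using dim_subset_UNIV_cart_gen[of V] d by simp
    fix m assume "1 \<le> m" "m \<le> d"
    \<comment> \<open>Only \<open>k = 0\<close> occurs, and there \<open>iso_count\<close> reduces
      to the Gaussian binomial that counts all subspaces of dimension \<open>m\<close>.\<close>
    have "{k. k \<in> type_signs Type_A \<and> k \<le> m} = {0}" by auto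
    then show "card {V :: ('k ^ 'n) set. vec.subspace V \<and> True \<and> vec.dim V = m} =
      (\<Sum>k | k \<in> type_signs Type_A \<and> k \<le> m. iso_count CARD('k) (type_shift Type_A) d m k)"
      using card_subspaces[of "UNIV :: ('k ^ 'n) set" m] d by (simp add: iso_count_def card_cart_basis)
  qed
next
  have d1: "d \<ge> 1" using d by (metis One_nat_def Suc_leI zero_less_card_finite)
  fix \<omega> :: "'k ^ ('n \<times> 2) \<Rightarrow> 'k ^ ('n \<times> 2) \<Rightarrow> 'k" assume "symplectic_form \<omega>"
  then interpret polar_space \<omega> "\<lambda>_. 0" 1 d
    using d by (intro symplectic_polar_space) simp_all
  \<comment> \<open>The flags of type BC do not refer to a Lagrangian; an auxiliary one is chosen in
    order to sort the top spaces by their intersection with it.\<close>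
  obtain I where I: "isotropic I" "vec.dim I = d" by (rule lagrangian_exists) simp
  have "flags_BC \<omega> = top_flags (\<lambda>V. isotropic V \<and> vec.dim V - vec.dim (V \<inter> I) \<in> type_signs Type_BC)"
    unfolding top_flags_isotropic flags_BC_def by (simp add: isotropic_def conj_ac)
  then show "((\<lambda>F. var_s ^ flag_alpha F * var_t ^ flag_weight F) has_sum
          M_tilde Type_BC q d * (\<Prod>j=1..d. inverse (1 - var_s * var_t ^ j)))
         (weighted (flags_BC \<omega>))"
    using isotropic_flags_has_sum[OF I d1, of Type_BC] q by simp
next
  have d1: "d \<ge> 1" using d by (metis One_nat_def Suc_leI zero_less_card_finite)
  fix I :: "('k ^ ('n \<times> 2)) set" assume I: "totally_isotropic I \<and> vec.dim I = d"
  interpret polar_space "hyp_bilinear :: 'k ^ ('n \<times> 2) \<Rightarrow> _" hyp_form 0 d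
    by (rule hyp_polar_space[OF d])
  have iso: "totally_isotropic V \<longleftrightarrow> isotropic V" for V :: "('k ^ ('n \<times> 2)) set"
  proof
    assume V: "totally_isotropic V"
    \<comment> \<open>Polarization: \<open>hyp_form\<close> vanishes at \<open>x\<close>,
      \<open>y\<close> and \<open>x + y\<close>.\<close>
    have "hyp_bilinear x y = 0" if "x \<in> V" "y \<in> V" for x y
      using V that hyp_form_add[of x y] vec.subspace_add[of V x y] by (auto simp: totally_isotropic_def)
    then show "isotropic V" using V by (auto simp: totally_isotropic_def isotropic_def)
  qed (auto simp: totally_isotropic_def isotropic_def)
  have "even_flags_D I = top_flags (\<lambda>V. isotropic V \<and> vec.dim V - vec.dim (V \<inter> I) \<in> type_signs Type_D)"
    unfolding top_flags_isotropic even_flags_D_def iso by simp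
  then show "((\<lambda>F. var_s ^ flag_alpha F * var_t ^ flag_weight F) has_sum
          M_tilde Type_D q d * (\<Prod>j=1..d. inverse (1 - var_s * var_t ^ j)))
         (weighted (even_flags_D I))"
    using isotropic_flags_has_sum[of I Type_D] I iso d1 q by simp
qed

end
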